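(* Let $n\ge1$, $\alpha>0$, and let $\mu$ be a positive Borel measure on $\mathbb C^n$. The following are equivalent: (1) $\mu(\mathbb C^n)<\infty$; (2) the form $q_\mu$ is bounded on $F^2_\alpha$ and $T_\mu\in\mathcal S_1$; (3) the form $q_\mu$ is bounded on $\mathrm{PH}^2_\alpha$ and $T_\mu^{\mathrm{ph}}\in\mathcal S_1$. Whenever these conditions hold, $$\|T_\mu\|_{\mathcal S_1}=\mu(\mathbb C^n),\qquad \|T_\mu^{\mathrm{ph}}\|_{\mathcal S_1}=2\mu(\mathbb C^n)-\int_{\mathbb C^n}e^{-|z|^2/\alpha}\,d\mu(z).$$ If (these conditions hold and) $\mu\ne0$, then $$\frac{\|T_\mu^{\mathrm{ph}}\|_{\mathcal S_1}}{\|T_\mu\|_{\mathcal S_1}}=2-\frac1{\mu(\mathbb C^n)}\int_{\mathbb C^n}e^{-|z|^2/\alpha}\,d\mu(z).$$ As $\mu$ ranges over the nonzero finite positive Borel measures on $\mathbb C^n$, the set of values of this ratio is exactly $[1,2)$. The ratio equals $1$ precisely when $\mu$ is concentrated at the origin.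
   Context: $dV$ is Lebesgue measure on $\mathbb C^n$ and $d\mu_\alpha(z)=(\pi\alpha)^{-n}e^{-|z|^2/\alpha}\,dV(z)$. $F^2_\alpha$ is the closed subspace of $L^2(\mathbb C^n,d\mu_\alpha)$ of entire functions; $\mathrm{PH}^2_\alpha$ is the closed subspace of $L^2(\mathbb C^n,d\mu_\alpha)$ of pluriharmonic functions, i.e. complex-valued $C^2$ functions $f$ with $\partial^2 f/\partial z_j\partial\overline z_k=0$ for all $1\le j,k\le n$. Inner products are linear in the first variable. For a positive Borel measure $\mu$ let $q_\mu(f,g)=\int_{\mathbb C^n}f\,\overline{g}\,e^{-|z|^2/\alpha}\,d\mu(z)$. It is bounded on a Hilbert space $H$ of functions if the integral converges absolutely for all $f,g\in H$ and $|q_\mu(f,g)|\le C\|f\|_H\|g\|_H$ for some $C$; it is then represented by a unique bounded positive operator $T$ on $H$, $\langle Tf,g\rangle=q_\mu(f,g)$, denoted $T_\mu$ for $H=F^2_\alpha$ and $T_\mu^{\mathrm{ph}}$ for $H=\mathrm{PH}^2_\alpha$. $\mathcal S_1$ is the trace class with trace norm $\|T\|_{\mathcal S_1}=\sum_ks_k(T)$. *)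

theory Defs
  imports "HOL-Analysis.Analysis" "HOL-Library.Function_Algebras"
begin

text \<open>The elements of the Hilbert spaces are honest functions on \<open>\<complex>\<^sup>n\<close>: an
  \<open>L\<^sup>2\<close>-class contains at most one continuous function. Accordingly a Hilbert space is
  a set \<open>H\<close> of functions, with the inner product of \<open>L\<^sup>2(d\<mu>\<^sub>\<alpha>)\<close>, and an
  operator on \<open>H\<close> is only meaningful on \<open>H\<close>.\<close>

interpretation cfun: vector_space "\<lambda>(c::complex) (f::'a \<Rightarrow> complex) x. c * f x"
  by unfold_locales (auto simp: fun_eq_iff algebra_simps)

definition gauss_measure :: "real \<Rightarrow> (complex^'n) measure" where
  "gauss_measure \<alpha> =
     density lborel (\<lambda>z. ennreal (exp (- (norm z)\<^sup>2 / \<alpha>) / (pi * \<alpha>) ^ CARD('n)))"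

definition L2_inner :: "real \<Rightarrow> (complex^'n \<Rightarrow> complex) \<Rightarrow> (complex^'n \<Rightarrow> complex) \<Rightarrow> complex" where
  "L2_inner \<alpha> f g = (\<integral>z. f z * cnj (g z) \<partial>gauss_measure \<alpha>)"

definition L2_norm :: "real \<Rightarrow> (complex^'n \<Rightarrow> complex) \<Rightarrow> real" where
  "L2_norm \<alpha> f = sqrt (\<integral>z. (norm (f z))\<^sup>2 \<partial>gauss_measure \<alpha>)"

definition square_integrable :: "real \<Rightarrow> (complex^'n \<Rightarrow> complex) \<Rightarrow> bool" where
  "square_integrable \<alpha> f \<longleftrightarrow>
     f \<in> borel_measurable borel \<and> integrable (gauss_measure \<alpha>) (\<lambda>z. (norm (f z))\<^sup>2)"


subsection \<open>Entire and pluriharmonic functions\<close>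

text \<open>Complex differentiability: the real derivative is \<open>\<complex>\<close>-linear.\<close>

definition entire :: "(complex^'n \<Rightarrow> complex) \<Rightarrow> bool" where
  "entire f \<longleftrightarrow>
     (\<forall>z. \<exists>D. (f has_derivative D) (at z) \<and> (\<forall>c v. D (c *s v) = c * D v))"

definition C2 :: "('a::real_normed_vector \<Rightarrow> 'b::real_normed_vector) \<Rightarrow> bool" where
  "C2 f \<longleftrightarrow>
     (\<exists>(f' :: 'a \<Rightarrow> 'a \<Rightarrow>\<^sub>L 'b) (f'' :: 'a \<Rightarrow> 'a \<Rightarrow>\<^sub>L ('a \<Rightarrow>\<^sub>L 'b)).
        (\<forall>x. (f has_derivative blinfun_apply (f' x)) (at x)) \<and>
        (\<forall>x. (f' has_derivative blinfun_apply (f'' x)) (at x)) \<and>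
        continuous_on UNIV f'')"

text \<open>Wirtinger derivatives
  \<open>\<partial>/\<partial>z\<^sub>j = (\<partial>/\<partial>x\<^sub>j - i \<partial>/\<partial>y\<^sub>j)/2\<close> and
  \<open>\<partial>/\<partial>z\<^sub>j\<^sup>* = (\<partial>/\<partial>x\<^sub>j + i \<partial>/\<partial>y\<^sub>j)/2\<close>, for real-differentiable
  functions.\<close>

definition dz :: "'n \<Rightarrow> (complex^'n \<Rightarrow> complex) \<Rightarrow> complex^'n \<Rightarrow> complex" where
  "dz j f z = (frechet_derivative f (at z) (axis j 1)
                 - \<i> * frechet_derivative f (at z) (axis j \<i>)) / 2"

definition dzbar :: "'n \<Rightarrow> (complex^'n \<Rightarrow> complex) \<Rightarrow> complex^'n \<Rightarrow> complex" where
  "dzbar j f z = (frechet_derivative f (at z) (axis j 1)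
                    + \<i> * frechet_derivative f (at z) (axis j \<i>)) / 2"

definition pluriharmonic :: "(complex^'n \<Rightarrow> complex) \<Rightarrow> bool" where
  "pluriharmonic f \<longleftrightarrow> C2 f \<and> (\<forall>j k z. dz j (dzbar k f) z = 0)"

definition Fock :: "real \<Rightarrow> (complex^'n \<Rightarrow> complex) set" where
  "Fock \<alpha> = {f. entire f \<and> square_integrable \<alpha> f}"

definition PH :: "real \<Rightarrow> (complex^'n \<Rightarrow> complex) set" where
  "PH \<alpha> = {f. pluriharmonic f \<and> square_integrable \<alpha> f}"


subsection \<open>Operators on a subspace \<open>H\<close> of \<open>L\<^sup>2(d\<mu>\<^sub>\<alpha>)\<close>\<close>

type_synonym 'n operator = "(complex^'n \<Rightarrow> complex) \<Rightarrow> (complex^'n \<Rightarrow> complex)"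

definition bounded_operator :: "real \<Rightarrow> (complex^'n \<Rightarrow> complex) set \<Rightarrow> 'n operator \<Rightarrow> bool" where
  "bounded_operator \<alpha> H T \<longleftrightarrow>
     (\<forall>f\<in>H. T f \<in> H) \<and>
     (\<forall>f\<in>H. \<forall>g\<in>H. T (f + g) = T f + T g) \<and>
     (\<forall>c. \<forall>f\<in>H. T (\<lambda>z. c * f z) = (\<lambda>z. c * T f z)) \<and>
     (\<exists>C. \<forall>f\<in>H. L2_norm \<alpha> (T f) \<le> C * L2_norm \<alpha> f)"

definition positive_operator :: "real \<Rightarrow> (complex^'n \<Rightarrow> complex) set \<Rightarrow> 'n operator \<Rightarrow> bool" where
  "positive_operator \<alpha> H T \<longleftrightarrow>
     (\<forall>f\<in>H. L2_inner \<alpha> (T f) f \<in> \<real> \<and> 0 \<le> Re (L2_inner \<alpha> (T f) f))"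

definition compact_operator :: "real \<Rightarrow> (complex^'n \<Rightarrow> complex) set \<Rightarrow> 'n operator \<Rightarrow> bool" where
  "compact_operator \<alpha> H T \<longleftrightarrow>
     bounded_operator \<alpha> H T \<and>
     (\<forall>x::nat \<Rightarrow> _. range x \<subseteq> H \<and> (\<exists>C. \<forall>k. L2_norm \<alpha> (x k) \<le> C) \<longrightarrow>
        (\<exists>y\<in>H. \<exists>r. strict_mono r \<and> (\<lambda>k. L2_norm \<alpha> (T (x (r k)) - y)) \<longlonglongrightarrow> 0))"

definition adjoint_op :: "real \<Rightarrow> (complex^'n \<Rightarrow> complex) set \<Rightarrow> 'n operator \<Rightarrow> 'n operator" where
  "adjoint_op \<alpha> H T f = (THE h. h \<in> H \<and> (\<forall>g\<in>H. L2_inner \<alpha> h g = L2_inner \<alpha> f (T g)))"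

text \<open>The singular values of a compact \<open>T\<close>: the square roots of the nonzero eigenvalues of
  \<open>T\<^sup>* T\<close>, in decreasing order and repeated according to multiplicity, followed by zeros
  if there are only finitely many. For compact \<open>T\<close> these conditions determine the sequence.\<close>

definition singular_values :: "real \<Rightarrow> (complex^'n \<Rightarrow> complex) set \<Rightarrow> 'n operator \<Rightarrow> nat \<Rightarrow> real" where
  "singular_values \<alpha> H T =
     (THE s. decseq s \<and> s \<longlonglongrightarrow> 0 \<and>
        (\<forall>\<sigma>>0. card {k. s k = \<sigma>} =
           cfun.dim {f\<in>H. adjoint_op \<alpha> H T (T f) = (\<lambda>z. of_real (\<sigma>\<^sup>2) * f z)}))"

definition trace_class :: "real \<Rightarrow> (complex^'n \<Rightarrow> complex) set \<Rightarrow> 'n operator \<Rightarrow> bool" where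
  "trace_class \<alpha> H T \<longleftrightarrow> compact_operator \<alpha> H T \<and> summable (singular_values \<alpha> H T)"

definition trace_norm :: "real \<Rightarrow> (complex^'n \<Rightarrow> complex) set \<Rightarrow> 'n operator \<Rightarrow> real" where
  "trace_norm \<alpha> H T = (\<Sum>k. singular_values \<alpha> H T k)"


subsection \<open>The form \<open>q\<^sub>\<mu>\<close> and the Toeplitz operators\<close>

definition q_form :: "real \<Rightarrow> (complex^'n) measure \<Rightarrow>
    (complex^'n \<Rightarrow> complex) \<Rightarrow> (complex^'n \<Rightarrow> complex) \<Rightarrow> complex" where
  "q_form \<alpha> \<mu> f g = (\<integral>z. f z * cnj (g z) * of_real (exp (- (norm z)\<^sup>2 / \<alpha>)) \<partial>\<mu>)"

definition q_bounded :: "real \<Rightarrow> (complex^'n) measure \<Rightarrow> (complex^'n \<Rightarrow> complex) set \<Rightarrow> bool" where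
  "q_bounded \<alpha> \<mu> H \<longleftrightarrow>
     (\<forall>f\<in>H. \<forall>g\<in>H. integrable \<mu> (\<lambda>z. f z * cnj (g z) * of_real (exp (- (norm z)\<^sup>2 / \<alpha>)))) \<and>
     (\<exists>C. \<forall>f\<in>H. \<forall>g\<in>H. norm (q_form \<alpha> \<mu> f g) \<le> C * L2_norm \<alpha> f * L2_norm \<alpha> g)"

text \<open>\<open>extensional H\<close> only fixes the irrelevant values outside \<open>H\<close>, so that the representing
  operator is unique as a function.\<close>

definition toeplitz :: "real \<Rightarrow> (complex^'n) measure \<Rightarrow> (complex^'n \<Rightarrow> complex) set \<Rightarrow> 'n operator" where
  "toeplitz \<alpha> \<mu> H =
     (THE T. T \<in> extensional H \<and> bounded_operator \<alpha> H T \<and> positive_operator \<alpha> H T \<and>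
        (\<forall>f\<in>H. \<forall>g\<in>H. L2_inner \<alpha> (T f) g = q_form \<alpha> \<mu> f g))"

definition norm_ratio :: "real \<Rightarrow> (complex^'n) measure \<Rightarrow> real" where
  "norm_ratio \<alpha> \<mu> =
     trace_norm \<alpha> (PH \<alpha>) (toeplitz \<alpha> \<mu> (PH \<alpha>)) / trace_norm \<alpha> (Fock \<alpha>) (toeplitz \<alpha> \<mu> (Fock \<alpha>))"

definition nonzero_finite_borel :: "(complex^'n) measure \<Rightarrow> bool" where
  "nonzero_finite_borel \<mu> \<longleftrightarrow> sets \<mu> = sets borel \<and> emeasure \<mu> UNIV < \<infinity> \<and> emeasure \<mu> UNIV \<noteq> 0"

end

(*
  Both spaces are reproducing kernel Hilbert spaces, with kernels K(z,w) = e^(z.w/a) on F^2 and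
  e^(z.w/a) + e^(w.z/a) - 1 on PH^2, so K(w,w) e^(-|w|^2/a) equals 1 and 2 - e^(-|w|^2/a).
  If the Toeplitz operator T is compact, with eigenvalues s_k and orthonormal eigenvectors e_k, then
  <T K_z, K_z> = sum_k s_k |e_k(z)|^2; integrating this against the Gaussian measure and using
  Tonelli gives sum_k s_k = int K(w,w) e^(-|w|^2/a) dmu(w) as an identity in [0,infinity], which
  yields both trace norms and the finiteness of mu. Conversely, for finite mu, the operator T is
  compact because bounded sequences in the space have pointwise convergent subsequences (Montel)
  and the form q_mu passes to the limit by dominated convergence. The reproducing property on F^2
  is the mean value property combined with a translation of the Gaussian; it carries over to PH^2
  because a pluriharmonic function is g + conj h with g, h entire and h(0) = 0, and the two
  summands are orthogonal on every circle centred at the origin.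
*)

theory Submission
  imports Defs "HOL-Complex_Analysis.Great_Picard" "HOL-Probability.Distributions"
begin

subsection \<open>Gaussian measures\<close>

text \<open>\<open>singular_values\<close> is a definite description built from eigenspace
  dimensions of T*T inside a set of honest functions, so a trace norm becomes accessible only once T
  is diagonalised within H itself. The locale \<open>rkhs\<close> collects what this takes; after
  that the two spaces differ only through the weighted diagonal k(w) = K(w,w) e^(-|w|^2/a), and all
  that matters is that k lies between 1 and a constant. The lower bound makes the trace dominate
  mu(C^n); the upper bound controls evaluation at w against the Gaussian weight and so bounds the
  form for finite mu. Tonelli requires a sigma-finite measure although mu is arbitrary in the
  converse direction; this is recovered from q_mu(1,1) < infinity. Montel's theorem also provides
  completeness of H, with Fatou's lemma in the place of classes of functions. The -1 in the second
  kernel comes from the constants, which are both holomorphic and antiholomorphic. A point mass at w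
  has ratio 2 - e^(-|w|^2/a), and these values already fill [1,2).\<close>

lemma nn_integral_lborel_translate:
  fixes f :: "'a::euclidean_space \<Rightarrow> ennreal"
  assumes [measurable]: "f \<in> borel_measurable borel"
  shows "(\<integral>\<^sup>+x. f (x + c) \<partial>lborel) = (\<integral>\<^sup>+x. f x \<partial>lborel)"
proof -
  have "(\<integral>\<^sup>+x. f x \<partial>lborel) = (\<integral>\<^sup>+x. f x \<partial>distr lborel borel ((+) c))"
    by (simp add: lborel_distr_plus)
  also have "\<dots> = (\<integral>\<^sup>+x. f (c + x) \<partial>lborel)"
    by (subst nn_integral_distr) auto
  finally show ?thesis by (simp add: add.commute)
qed

text \<open>The integrand factors over \<open>Basis\<close>, and each factor is, up to the constant
  sqrt(pi a), the normal density of variance a/2.\<close>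

lemma nn_integral_gaussian:
  fixes a :: real
  assumes "a > 0"
  shows "(\<integral>\<^sup>+(x::'a::euclidean_space). ennreal (exp (- (norm x)\<^sup>2 / a)) \<partial>lborel) = ennreal (sqrt (pi * a) ^ DIM('a))"
proof -
  have one: "(\<integral>\<^sup>+(x::real). ennreal (exp (- x\<^sup>2 / a)) \<partial>lborel) = ennreal (sqrt (pi * a))"
  proof -
    have s: "sqrt (a / 2) > 0" using assms by simp
    have nd: "normal_density 0 (sqrt (a / 2)) x = exp (- x\<^sup>2 / a) / sqrt (pi * a)" for x
      using assms by (simp add: normal_density_def)
    have "(\<integral>\<^sup>+x. ennreal (normal_density 0 (sqrt (a / 2)) x) \<partial>lborel) = 1"
      using s by (subst nn_integral_eq_integral) (auto simp: integrable_normal_density)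
    moreover have "ennreal (exp (- x\<^sup>2 / a)) = ennreal (sqrt (pi * a)) * ennreal (normal_density 0 (sqrt (a / 2)) x)" for x
      unfolding nd using assms by (subst ennreal_mult[symmetric]) auto
    ultimately show ?thesis
      by (simp add: nn_integral_cmult)
  qed
  have "exp (- (norm x)\<^sup>2 / a) = (\<Prod>b\<in>Basis. exp (- (x \<bullet> b)\<^sup>2 / a))" for x :: 'a
    unfolding exp_sum[OF finite_Basis, symmetric]
    by (simp only: power2_norm_eq_inner euclidean_inner[of x x]) (simp add: power2_eq_square sum_divide_distrib sum_negf)
  then have "(\<integral>\<^sup>+(x::'a). ennreal (exp (- (norm x)\<^sup>2 / a)) \<partial>lborel) =
    (\<integral>\<^sup>+(x::'a). (\<Prod>b\<in>Basis. ennreal (exp (- (x \<bullet> b)\<^sup>2 / a))) \<partial>lborel)"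
    by (simp add: prod_ennreal)
  also have "\<dots> = (\<Prod>b\<in>(Basis::'a set). \<integral>\<^sup>+x. ennreal (exp (- x\<^sup>2 / a)) \<partial>lborel)"
    by (subst nn_integral_lborel_prod) auto
  finally show ?thesis unfolding one using assms by (simp add: ennreal_power)
qed

text \<open>Translation invariance and Fubini applied to \<open>g(x) h(R y)\<close> with a Gaussian \<open>g\<close>:
  the factor \<open>\<integral> g\<close> cancels, since \<open>g\<close> is invariant under \<open>R\<close> and under \<open>x \<mapsto> -x\<close>.\<close>

lemma lborel_distr_isometry:
  fixes R :: "'a::euclidean_space \<Rightarrow> 'a"
  assumes R: "orthogonal_transformation R"
  shows "distr lborel borel R = lborel"
proof (rule measure_eqI)
  show "sets (distr lborel borel R) = sets lborel" by simp
next
  fix A assume "A \<in> sets (distr lborel borel R)"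
  then have A[measurable]: "A \<in> sets borel" by simp
  have lin: "linear R" and nR: "norm (R x) = norm x" for x
    using R by (auto simp: orthogonal_transformation)
  have [measurable]: "R \<in> borel_measurable borel"
    by (intro borel_measurable_continuous_onI linear_continuous_on linear_conv_bounded_linear[THEN iffD1] lin)
  \<comment> \<open>Shifting y by \<open>S x\<close> changes \<open>R y\<close> into
    \<open>x + R y\<close>, so translation invariance can be used in either variable.\<close>
  define S where "S = inv R"
  have RS: "R (S x) = x" for x
    using orthogonal_transformation_surj[OF R] by (simp add: S_def surj_f_inv_f)
  define g :: "'a \<Rightarrow> ennreal" where "g x = ennreal (exp (- (norm x)\<^sup>2 / 1))" for x
  define h :: "'a \<Rightarrow> ennreal" where "h = indicator A"
  have [measurable]: "g \<in> borel_measurable borel" "h \<in> borel_measurable borel"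
    unfolding g_def h_def by measurable
  have G: "(\<integral>\<^sup>+x. g x \<partial>lborel) = ennreal (sqrt pi ^ DIM('a))"
    using nn_integral_gaussian[of 1, where 'a = 'a] by (simp add: g_def)
  have RpS: "R (y + S x) = x + R y" for x y
    using lin by (simp add: linear_add RS add.commute)
  have "(\<integral>\<^sup>+y. h (R y) \<partial>lborel) * (\<integral>\<^sup>+x. g x \<partial>lborel) = (\<integral>\<^sup>+x. g x * (\<integral>\<^sup>+y. h (R y) \<partial>lborel) \<partial>lborel)"
    by (simp add: nn_integral_multc mult.commute)
  also have "\<dots> = (\<integral>\<^sup>+x. g x * (\<integral>\<^sup>+y. h (R (y + S x)) \<partial>lborel) \<partial>lborel)"
    by (subst nn_integral_lborel_translate) auto
  also have "\<dots> = (\<integral>\<^sup>+x. (\<integral>\<^sup>+y. g x * h (x + R y) \<partial>lborel) \<partial>lborel)"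
    by (simp add: RpS nn_integral_cmult)
  also have "\<dots> = (\<integral>\<^sup>+y. (\<integral>\<^sup>+x. g x * h (x + R y) \<partial>lborel) \<partial>lborel)"
    by (rule lborel_pair.Fubini') simp
  also have "\<dots> = (\<integral>\<^sup>+y. (\<integral>\<^sup>+x. g (x + (- R y)) * h x \<partial>lborel) \<partial>lborel)"
  proof (rule nn_integral_cong)
    fix y
    have "(\<integral>\<^sup>+x. g x * h (x + R y) \<partial>lborel) = (\<integral>\<^sup>+x. (\<lambda>x. g (x + (- R y)) * h x) (x + R y) \<partial>lborel)" by simp
    also have "\<dots> = (\<integral>\<^sup>+x. g (x + (- R y)) * h x \<partial>lborel)"
      by (subst nn_integral_lborel_translate) auto
    finally show "(\<integral>\<^sup>+x. g x * h (x + R y) \<partial>lborel) = (\<integral>\<^sup>+x. g (x + (- R y)) * h x \<partial>lborel)" .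
  qed
  also have "\<dots> = (\<integral>\<^sup>+x. (\<integral>\<^sup>+y. g (x + (- R y)) * h x \<partial>lborel) \<partial>lborel)"
    by (rule lborel_pair.Fubini') simp
  also have "\<dots> = (\<integral>\<^sup>+x. (\<integral>\<^sup>+y. g (x + (- R y)) \<partial>lborel) * h x \<partial>lborel)"
    by (simp add: nn_integral_multc)
  also have "\<dots> = (\<integral>\<^sup>+x. (\<integral>\<^sup>+y. g y \<partial>lborel) * h x \<partial>lborel)"
  proof (rule nn_integral_cong)
    fix x
    have "(\<integral>\<^sup>+y. g (x + (- R y)) \<partial>lborel) = (\<integral>\<^sup>+y. g (x + (- R (y + S x))) \<partial>lborel)"
      by (subst nn_integral_lborel_translate[where f = "\<lambda>y. g (x + (- R y))"]) auto
    also have "\<dots> = (\<integral>\<^sup>+y. g y \<partial>lborel)"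
      by (simp add: RpS) (simp add: g_def nR)
    finally show "(\<integral>\<^sup>+y. g (x + (- R y)) \<partial>lborel) * h x = (\<integral>\<^sup>+y. g y \<partial>lborel) * h x" by simp
  qed
  also have "\<dots> = (\<integral>\<^sup>+x. h x \<partial>lborel) * (\<integral>\<^sup>+x. g x \<partial>lborel)"
    by (subst nn_integral_cmult) (auto simp: mult.commute)
  \<comment> \<open>Cancelling in [0, infinity] requires a factor that is neither 0 nor infinite,
    which \<open>G\<close> supplies.\<close>
  finally have "(\<integral>\<^sup>+y. h (R y) \<partial>lborel) = (\<integral>\<^sup>+x. h x \<partial>lborel)"
    unfolding G by (simp add: mult.commute[of _ "ennreal _"] ennreal_mult_cancel_left)
  moreover have "(\<integral>\<^sup>+y. h (R y) \<partial>lborel) = emeasure (distr lborel borel R) A"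
  proof -
    have "(\<integral>\<^sup>+y. h (R y) \<partial>lborel) = (\<integral>\<^sup>+y. h y \<partial>distr lborel borel R)"
      by (subst nn_integral_distr) auto
    then show ?thesis by (simp add: h_def)
  qed
  ultimately show "emeasure (distr lborel borel R) A = emeasure lborel A"
    by (simp add: h_def)
qed

section \<open>Symmetries of the Gaussian measure and circle means\<close>

lemma sets_gauss_measure [simp, measurable_cong]: "sets (gauss_measure a) = sets borel"
  by (simp add: gauss_measure_def)

lemma space_gauss_measure [simp]: "space (gauss_measure a) = UNIV"
  by (simp add: gauss_measure_def)

lemma norm_vec_scalar_mult: "norm (c *s (z::complex^'n)) = norm c * norm z"
proof -
  have "norm (c *s z) = L2_set (\<lambda>i. norm c * norm (z $ i)) UNIV"
    by (simp add: norm_vec_def norm_mult)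
  also have "\<dots> = norm c * norm z"
    by (simp add: norm_vec_def L2_set_right_distrib)
  finally show ?thesis .
qed

lemma bounded_linear_scalar_mult: "bounded_linear (\<lambda>z::complex^'n. c *s z)"
proof -
  have "linear (\<lambda>z::complex^'n. c *s z)"
    by (auto simp: linear_iff vec_eq_iff algebra_simps)
  then show ?thesis by (simp add: linear_conv_bounded_linear)
qed

lemma bounded_linear_scalar_mult_left: "bounded_linear (\<lambda>c. c *s (v::complex^'n))"
proof -
  have "linear (\<lambda>c. c *s (v::complex^'n))"
    by (auto simp: linear_iff vec_eq_iff algebra_simps)
  then show ?thesis by (simp add: linear_conv_bounded_linear)
qed

lemma continuous_on_scalar_mult [continuous_intros]:
  fixes f :: "'a::topological_space \<Rightarrow> complex" and g :: "'a \<Rightarrow> complex^'n"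
  assumes "continuous_on S f" "continuous_on S g"
  shows "continuous_on S (\<lambda>x. f x *s g x)"
  unfolding continuous_on_componentwise vector_scalar_mult_def
  by (intro continuous_on_vec_lambda continuous_intros assms continuous_on_component)

lemma borel_measurable_scalar_mult [measurable]:
  fixes f :: "'a \<Rightarrow> complex" and g :: "'a \<Rightarrow> complex^'n"
  assumes "f \<in> borel_measurable M" "g \<in> borel_measurable M"
  shows "(\<lambda>x. f x *s g x) \<in> borel_measurable M"
  by (rule borel_measurable_continuous_Pair[OF assms]) (intro continuous_intros)

context
  fixes a :: real
  assumes a: "a > 0"
begin

lemma prob_space_gauss: "prob_space (gauss_measure a :: (complex^'n) measure)"
proof (rule prob_spaceI)
  have d: "ennreal (exp (- (norm z)\<^sup>2 / a) / (pi * a) ^ CARD('n)) =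
    ennreal (exp (- (norm z)\<^sup>2 / a)) * ennreal (1 / (pi * a) ^ CARD('n))" for z :: "complex^'n"
    using a by (subst ennreal_mult[symmetric]) auto
  have "emeasure (gauss_measure a :: (complex^'n) measure) UNIV =
    (\<integral>\<^sup>+(z::complex^'n). ennreal (exp (- (norm z)\<^sup>2 / a)) \<partial>lborel) * ennreal (1 / (pi * a) ^ CARD('n))"
    unfolding gauss_measure_def d by (simp add: emeasure_density nn_integral_multc)
  \<comment> \<open>The real dimension is 2n, so sqrt(pi a)^(2n) = (pi a)^n is the normalising
    constant.\<close>
  also have "\<dots> = ennreal (sqrt (pi * a) ^ (CARD('n) * 2)) * ennreal (1 / (pi * a) ^ CARD('n))"
    using a by (subst nn_integral_gaussian) auto
  also have "\<dots> = ennreal ((pi * a) ^ CARD('n) * (1 / (pi * a) ^ CARD('n)))"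
    using a by (subst ennreal_mult[symmetric]) (auto simp: power_mult mult.commute[of "CARD('n)"])
  also have "\<dots> = 1" using a by simp
  finally show "emeasure (gauss_measure a :: (complex^'n) measure) (space (gauss_measure a)) = 1" by simp
qed

lemma sigma_finite_gauss: "sigma_finite_measure (gauss_measure a :: (complex^'n) measure)"
  using prob_space_gauss prob_space_imp_sigma_finite by blast

text \<open>Multiplication by a unimodular scalar is a real isometry, so it preserves Lebesgue
  measure as well as the density.\<close>

lemma gauss_distr_rotation:
  assumes c: "norm (c::complex) = 1"
  shows "distr (gauss_measure a :: (complex^'n) measure) borel ((*s) c) = gauss_measure a"
proof -
  let ?d = "\<lambda>z::complex^'n. ennreal (exp (- (norm z)\<^sup>2 / a) / (pi * a) ^ CARD('n))"
  have "orthogonal_transformation ((*s) c :: complex^'n \<Rightarrow> _)"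
    using bounded_linear_scalar_mult[of c]
    by (auto simp: orthogonal_transformation norm_vec_scalar_mult c dest: bounded_linear.linear)
  then have "distr lborel borel ((*s) c :: complex^'n \<Rightarrow> _) = lborel"
    by (rule lborel_distr_isometry)
  then have "gauss_measure a = density (distr lborel borel ((*s) c)) ?d"
    by (simp add: gauss_measure_def)
  also have "\<dots> = distr (density lborel (\<lambda>z. ?d (c *s z))) borel ((*s) c)"
    by (subst density_distr) auto
  also have "\<dots> = distr (gauss_measure a) borel ((*s) c)"
    by (simp add: gauss_measure_def norm_vec_scalar_mult c)
  finally show ?thesis by simp
qed

lemma nn_integral_gauss_rotate:
  fixes f :: "complex^'n \<Rightarrow> ennreal"
  assumes "f \<in> borel_measurable borel" "norm c = 1"
  shows "(\<integral>\<^sup>+z. f (c *s z) \<partial>gauss_measure a) = (\<integral>\<^sup>+z. f z \<partial>gauss_measure a)"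
  using assms by (subst (2) gauss_distr_rotation[of c, symmetric]) (auto simp: nn_integral_distr)

lemma integral_gauss_rotate:
  fixes f :: "complex^'n \<Rightarrow> complex"
  assumes "f \<in> borel_measurable borel" "norm c = 1"
  shows "(\<integral>z. f (c *s z) \<partial>gauss_measure a) = (\<integral>z. f z \<partial>gauss_measure a)"
  using assms by (subst (2) gauss_distr_rotation[of c, symmetric]) (auto simp: integral_distr)

text \<open>The expansion |z + w|^2 = |z|^2 + 2 (z . w) + |w|^2, with the real inner product, gives
  the density that undoes a translation. It yields both the norm of the Fock kernel and its
  reproducing property.\<close>

lemma gauss_distr_translate:
  "distr (density (gauss_measure a) (\<lambda>z. ennreal (exp (- (2 * (z \<bullet> w) + (norm w)\<^sup>2) / a)))) borel (\<lambda>z. z + w)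
    = (gauss_measure a :: (complex^'n) measure)"
proof -
  let ?d = "\<lambda>z::complex^'n. ennreal (exp (- (norm z)\<^sup>2 / a) / (pi * a) ^ CARD('n))"
  have n: "(norm (z + w))\<^sup>2 = (norm z)\<^sup>2 + (2 * (z \<bullet> w) + (norm w)\<^sup>2)" for z
    by (simp add: power2_norm_eq_inner inner_add inner_commute)
  have d: "?d z * ennreal (exp (- (2 * (z \<bullet> w) + (norm w)\<^sup>2) / a)) = ?d (z + w)" for z
    using a unfolding n
    by (subst ennreal_mult[symmetric]) (auto simp: exp_add[symmetric] add_divide_distrib diff_divide_distrib)
  have "gauss_measure a = density (distr lborel borel ((+) w)) ?d"
    by (simp add: gauss_measure_def lborel_distr_plus)
  also have "\<dots> = distr (density lborel (\<lambda>z. ?d (w + z))) borel ((+) w)"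
    by (subst density_distr) auto
  also have "\<dots> = distr (density lborel (\<lambda>z. ?d (z + w))) borel (\<lambda>z. z + w)"
    by (intro distr_cong) (simp_all add: add.commute)
  also have "density lborel (\<lambda>z. ?d (z + w)) = density (gauss_measure a) (\<lambda>z. ennreal (exp (- (2 * (z \<bullet> w) + (norm w)\<^sup>2) / a)))"
    unfolding gauss_measure_def by (subst density_density_eq) (auto simp only: d, auto)
  finally show ?thesis by simp
qed

text \<open>For each fixed t the rotation leaves the integral unchanged, and t ranges over an
  interval of length 1. This reduces integrals over C^n to means over circles, where one-variable
  function theory applies.\<close>

lemma nn_integral_gauss_circle:
  fixes f :: "complex^'n \<Rightarrow> ennreal"
  assumes [measurable]: "f \<in> borel_measurable borel"
  shows "(\<integral>\<^sup>+z. (\<integral>\<^sup>+t. f (cis (2 * pi * t) *s z) * indicator {0..1} t \<partial>lborel) \<partial>gauss_measure a)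
    = (\<integral>\<^sup>+z. f z \<partial>gauss_measure a)"
proof -
  have [measurable]: "(\<lambda>t. cis (2 * pi * t)) \<in> borel_measurable borel"
    by (intro borel_measurable_continuous_onI continuous_intros)
  interpret pair_sigma_finite lborel "gauss_measure a :: (complex^'n) measure"
    by (intro pair_sigma_finite.intro sigma_finite_gauss sigma_finite_lborel)
  have "(\<integral>\<^sup>+z. (\<integral>\<^sup>+t. f (cis (2 * pi * t) *s z) * indicator {0..1} t \<partial>lborel) \<partial>gauss_measure a)
     = (\<integral>\<^sup>+t. (\<integral>\<^sup>+z. f (cis (2 * pi * t) *s z) * indicator {0..1} t \<partial>gauss_measure a) \<partial>lborel)"
    by (rule Fubini') simp
  also have "\<dots> = (\<integral>\<^sup>+t. (\<integral>\<^sup>+z. f z \<partial>gauss_measure a) * indicator {0..1} t \<partial>(lborel :: real measure))"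
    by (simp add: nn_integral_multc nn_integral_gauss_rotate)
  also have "\<dots> = (\<integral>\<^sup>+z. f z \<partial>gauss_measure a)"
    by (simp add: nn_integral_cmult)
  finally show ?thesis .
qed

text \<open>The rotation average once more, now with Fubini; the absolute integrability on the
  product that this demands comes from \<open>nn_integral_gauss_circle\<close> applied to the norm
  of \<open>f\<close>.\<close>

lemma integral_gauss_circle_mean:
  fixes f :: "complex^'n \<Rightarrow> complex"
  assumes [measurable]: "f \<in> borel_measurable borel" and f: "integrable (gauss_measure a) f"
    and c: "\<And>z. (LINT t:{0..1}|lborel. f (cis (2 * pi * t) *s z)) = c"
  shows "(\<integral>z. f z \<partial>gauss_measure a) = c"
proof -
  have [measurable]: "(\<lambda>t. cis (2 * pi * t)) \<in> borel_measurable borel"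
    by (intro borel_measurable_continuous_onI continuous_intros)
  interpret P: prob_space "gauss_measure a :: (complex^'n) measure" by (rule prob_space_gauss)
  interpret pair_sigma_finite lborel "gauss_measure a :: (complex^'n) measure"
    by (intro pair_sigma_finite.intro sigma_finite_gauss sigma_finite_lborel)
  let ?F = "\<lambda>t z. indicator {0..1} t *\<^sub>R f (cis (2 * pi * t) *s z)"
  have int: "integrable (lborel \<Otimes>\<^sub>M gauss_measure a) (\<lambda>(t, z). ?F t z)"
  proof (rule integrableI_bounded)
    show "(\<lambda>(t, z). ?F t z) \<in> borel_measurable (lborel \<Otimes>\<^sub>M gauss_measure a)" by measurable
    have "(\<integral>\<^sup>+x. ennreal (norm (case x of (t, z) \<Rightarrow> ?F t z)) \<partial>(lborel \<Otimes>\<^sub>M gauss_measure a))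
      = (\<integral>\<^sup>+z. (\<integral>\<^sup>+t. ennreal (norm (?F t z)) \<partial>lborel) \<partial>gauss_measure a)"
      by (subst nn_integral_snd[symmetric]) auto
    also have "\<dots> = (\<integral>\<^sup>+z. (\<integral>\<^sup>+t. ennreal (norm (f (cis (2 * pi * t) *s z))) * indicator {0..1} t \<partial>lborel) \<partial>gauss_measure a)"
      by (intro nn_integral_cong) (auto simp: indicator_def)
    also have "\<dots> = (\<integral>\<^sup>+z. ennreal (norm (f z)) \<partial>gauss_measure a)"
      by (subst nn_integral_gauss_circle[where f = "\<lambda>z. ennreal (norm (f z))", symmetric]) auto
    also have "\<dots> < \<infinity>" using f by (auto simp: integrable_iff_bounded)
    finally show "(\<integral>\<^sup>+x. ennreal (norm (case x of (t, z) \<Rightarrow> ?F t z)) \<partial>(lborel \<Otimes>\<^sub>M gauss_measure a)) < \<infinity>" .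
  qed
  have "c = (\<integral>z. (\<integral>t. ?F t z \<partial>lborel) \<partial>gauss_measure a)"
    using c P.prob_space by (simp add: set_lebesgue_integral_def)
  also have "\<dots> = (\<integral>t. (\<integral>z. ?F t z \<partial>gauss_measure a) \<partial>lborel)"
    by (rule Fubini_integral) (use int in simp)
  also have "\<dots> = (\<integral>t. indicator {0..1} t *\<^sub>R (\<integral>z. f z \<partial>gauss_measure a) \<partial>(lborel :: real measure))"
    by (simp add: integral_gauss_rotate)
  also have "\<dots> = (\<integral>z. f z \<partial>gauss_measure a)"
    by simp
  finally show ?thesis by simp
qed

end

subsection \<open>Entire functions of several variables\<close>

abbreviation fderiv :: "(complex^'n \<Rightarrow> complex) \<Rightarrow> complex^'n \<Rightarrow> complex^'n \<Rightarrow> complex" where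
  "fderiv f z \<equiv> frechet_derivative f (at z)"

lemma entireI:
  assumes "\<And>z. (f has_derivative D z) (at z)" "\<And>z c v. D z (c *s v) = c * D z v"
  shows "entire f"
  using assms unfolding entire_def by blast

lemma entire_has_derivative: "entire f \<Longrightarrow> (f has_derivative fderiv f z) (at z)"
  unfolding entire_def by (metis differentiableI frechet_derivative_works)

lemma fderiv_scalar_mult: "entire f \<Longrightarrow> fderiv f z (c *s v) = c * fderiv f z v"
  unfolding entire_def by (metis frechet_derivative_at)

lemma linear_fderiv: "entire f \<Longrightarrow> bounded_linear (fderiv f z)"
  using entire_has_derivative has_derivative_bounded_linear by blast

lemma fderiv_scaleR: "entire f \<Longrightarrow> fderiv f z (c *\<^sub>R v) = c *\<^sub>R fderiv f z v"
  using linear_fderiv[of f z] by (simp add: linear_simps)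

lemma entire_continuous_on: "entire f \<Longrightarrow> continuous_on S f"
  by (meson continuous_at_imp_continuous_on entire_has_derivative has_derivative_continuous)

lemma entire_const: "entire (\<lambda>z. c)"
  by (rule entireI[where D = "\<lambda>z v. 0"]) auto

lemma entire_add: "entire f \<Longrightarrow> entire g \<Longrightarrow> entire (\<lambda>z. f z + g z)"
  by (rule entireI[where D = "\<lambda>z v. fderiv f z v + fderiv g z v"])
    (auto intro!: derivative_intros entire_has_derivative simp: fderiv_scalar_mult algebra_simps)

lemma entire_diff: "entire f \<Longrightarrow> entire g \<Longrightarrow> entire (\<lambda>z. f z - g z)"
  by (rule entireI[where D = "\<lambda>z v. fderiv f z v - fderiv g z v"])
    (auto intro!: derivative_intros entire_has_derivative simp: fderiv_scalar_mult algebra_simps)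

lemma entire_mult: "entire f \<Longrightarrow> entire g \<Longrightarrow> entire (\<lambda>z. f z * g z)"
  by (rule entireI[where D = "\<lambda>z v. f z * fderiv g z v + fderiv f z v * g z"])
    (intro has_derivative_mult entire_has_derivative, auto simp: fderiv_scalar_mult algebra_simps)

lemma entire_cmult: "entire f \<Longrightarrow> entire (\<lambda>z. c * f z)"
  using entire_mult entire_const by blast

lemma entire_exp: "entire f \<Longrightarrow> entire (\<lambda>z. exp (f z))"
  by (rule entireI[where D = "\<lambda>z v. exp (f z) * fderiv f z v"])
    (intro has_derivative_compose[OF entire_has_derivative] DERIV_exp[unfolded has_field_derivative_def],
      auto simp: fderiv_scalar_mult algebra_simps)

lemma entire_translate: 
  assumes "entire f" shows "entire (\<lambda>z. f (z + w))"
proof (rule entireI[where D = "\<lambda>z v. fderiv f (z + w) v"])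
  fix z
  have "((\<lambda>z. z + w) has_derivative (\<lambda>v. v)) (at z)" by (auto intro!: derivative_eq_intros)
  from has_derivative_compose[OF this entire_has_derivative[OF assms]]
  show "((\<lambda>z. f (z + w)) has_derivative fderiv f (z + w)) (at z)" .
qed (auto simp: fderiv_scalar_mult assms)

text \<open>Complex linearity of the derivative makes the restriction to a complex line complex
  differentiable in the usual sense. One-variable theory enters through such restrictions.\<close>

lemma entire_line_deriv:
  assumes "entire f"
  shows "((\<lambda>s. f (z + s *s v)) has_field_derivative fderiv f (z + s *s v) v) (at s)"
proof -
  have "((\<lambda>s. z + s *s v) has_derivative (\<lambda>s. s *s v)) (at s)"
    using has_derivative_add[OF has_derivative_const bounded_linear_imp_has_derivative[OF bounded_linear_scalar_mult_left[of v]]] by simp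
  from has_derivative_compose[OF this entire_has_derivative[OF assms]]
  have "((\<lambda>s. f (z + s *s v)) has_derivative (\<lambda>t. fderiv f (z + s *s v) (t *s v))) (at s)" .
  then show ?thesis
    unfolding has_field_derivative_def fderiv_scalar_mult[OF assms]
    by (subst (asm) mult.commute) simp
qed

lemma entire_line_holomorphic: "entire f \<Longrightarrow> (\<lambda>s. f (z + s *s v)) holomorphic_on S"
  using entire_line_deriv unfolding holomorphic_on_def
  by (metis field_differentiable_def field_differentiable_at_within)

text \<open>Cauchy's inequality on the unit circle of the complex line through \<open>z\<close> in
  direction \<open>v\<close>.\<close>

lemma entire_cauchy_estimate:
  assumes f: "entire f" and B: "\<And>s. norm s = 1 \<Longrightarrow> norm (f (z + s *s v)) \<le> B"
  shows "norm (fderiv f z v) \<le> B"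
proof -
  let ?g = "\<lambda>s. f (z + s *s v)"
  have "norm ((deriv ^^ 1) ?g 0) \<le> fact 1 * B / 1 ^ 1"
    using B by (intro Cauchy_inequality holomorphic_on_imp_continuous_on entire_line_holomorphic f) auto
  moreover have "deriv ?g 0 = fderiv f z v"
    using DERIV_imp_deriv[OF entire_line_deriv[OF f, of z v 0]] by simp
  ultimately show ?thesis by simp
qed

lemma entire_locally_bounded:
  assumes "entire f" shows "\<exists>B. \<forall>z. norm z \<le> R \<longrightarrow> norm (f z) \<le> B"
proof -
  have "bounded (f ` cball 0 R)"
    by (intro compact_imp_bounded compact_continuous_image entire_continuous_on assms compact_cball)
  then show ?thesis unfolding bounded_iff by (metis imageI mem_cball_0)
qed

text \<open>After \<open>v\<close> is normalised, the unit circle around \<open>z\<close> on the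
  complex line stays within radius R + 1; the Cauchy estimate thus costs one unit of radius.\<close>

lemma entire_deriv_bound:
  assumes f: "entire f" and B: "\<And>z. norm z \<le> R + 1 \<Longrightarrow> norm (f z) \<le> B" and z: "norm z \<le> R"
  shows "norm (fderiv f z v) \<le> B * norm v"
proof (cases "v = 0")
  case True
  then show ?thesis using linear_fderiv[OF f, of z] by (simp add: linear_simps)
next
  case False
  have "norm (fderiv f z ((1 / norm v) *\<^sub>R v)) \<le> B"
  proof (rule entire_cauchy_estimate[OF f])
    fix s :: complex assume "norm s = 1"
    then have "norm (z + s *s ((1 / norm v) *\<^sub>R v)) \<le> R + 1"
      using z False by (intro norm_triangle_le) (simp add: norm_vec_scalar_mult)
    then show "norm (f (z + s *s ((1 / norm v) *\<^sub>R v))) \<le> B" by (rule B)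
  qed
  then show ?thesis
    using False by (simp add: fderiv_scaleR[OF f] field_simps)
qed

lemma entire_lipschitz:
  assumes f: "entire f" and B: "\<And>z. norm z \<le> R + 1 \<Longrightarrow> norm (f z) \<le> B" 
    and x: "norm x \<le> R" "norm y \<le> R"
  shows "norm (f x - f y) \<le> B * norm (x - y)"
proof (rule differentiable_bound[of "cball 0 R"])
  show "(f has_derivative fderiv f z) (at z within cball 0 R)" for z
    by (rule has_derivative_at_withinI[OF entire_has_derivative[OF f]])
  show "onorm (fderiv f z) \<le> B" if "z \<in> cball 0 R" for z
    using that entire_deriv_bound[OF f B] by (intro onorm_le) auto
qed (use x in auto)

section \<open>Limits and compactness for sequences of entire functions\<close>

text \<open>Local boundedness and the Cauchy estimate make the sequence locally equi-Lipschitz, hence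
  the convergence locally uniform (along a subsequence), and then also that of the derivatives.\<close>

lemma entire_pointwise_limit:
  fixes f :: "nat \<Rightarrow> complex^'n \<Rightarrow> complex"
  assumes f: "\<And>k. entire (f k)"
    and bd: "\<And>R. \<exists>B. \<forall>k z. norm z \<le> R \<longrightarrow> norm (f k z) \<le> B"
    and lim: "\<And>z. (\<lambda>k. f k z) \<longlonglongrightarrow> F z"
  shows "entire F"
  unfolding entire_def
proof
  fix z0 :: "complex^'n"
  \<comment> \<open>Three nested balls: bounds on radius R + 2, equi-Lipschitz and uniform
    convergence on R + 1, uniform convergence of the derivatives on R. Each Cauchy estimate uses up
    one unit, and \<open>z0\<close> stays in the interior.\<close>
  define R where "R = norm z0 + 1"
  obtain B where B: "\<And>k z. norm z \<le> R + 1 + 1 \<Longrightarrow> norm (f k z) \<le> B" using bd[of "R + 1 + 1"] by blast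
  have B0: "B \<ge> 0" using order.trans[OF norm_ge_zero B[of 0 0]] norm_ge_zero[of z0] by (simp add: R_def del: norm_ge_zero)
  have lip: "norm (f k x - f k y) \<le> B * norm (x - y)" if "norm x \<le> R + 1" "norm y \<le> R + 1" for k x y
    by (rule entire_lipschitz[OF f _ that]) (rule B)
  obtain g and r :: "nat \<Rightarrow> nat" where r: "strict_mono r" and
    uc: "\<And>e. 0 < e \<Longrightarrow> \<exists>N. \<forall>n x. n \<ge> N \<and> x \<in> cball 0 (R + 1) \<longrightarrow> norm (f (r n) x - g x) < e"
  proof (rule Arzela_Ascoli[of "cball 0 (R + 1)" f B])
    fix x :: "complex^'n" and e :: real assume x: "x \<in> cball 0 (R + 1)" "0 < e"
    show "\<exists>d. 0 < d \<and> (\<forall>n y. y \<in> cball 0 (R + 1) \<and> norm (x - y) < d \<longrightarrow> norm (f n x - f n y) < e)"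
    proof (intro exI[of _ "e / (B + 1)"] conjI allI impI)
      show "0 < e / (B + 1)" using x B0 by simp
      fix n y assume y: "y \<in> cball 0 (R + 1) \<and> norm (x - y) < e / (B + 1)"
      have "norm (f n x - f n y) \<le> B * norm (x - y)" using lip x y by auto
      also have "\<dots> \<le> (B + 1) * norm (x - y)" by (simp add: algebra_simps)
      also have "\<dots> < e" using y B0 by (simp add: field_simps)
      finally show "norm (f n x - f n y) < e" .
    qed
  qed (use B in auto)
  have gF: "g x = F x" if "x \<in> cball 0 (R + 1)" for x
  proof -
    have "(\<lambda>n. f (r n) x) \<longlonglongrightarrow> g x"
      unfolding LIMSEQ_def dist_norm using uc that by blast
    moreover have "(\<lambda>n. f (r n) x) \<longlonglongrightarrow> F x"
      using LIMSEQ_subseq_LIMSEQ[OF lim r, of x] by (simp add: o_def)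
    ultimately show ?thesis using LIMSEQ_unique by blast
  qed
  let ?D = "\<lambda>n z. fderiv (f (r n)) z"
  \<comment> \<open>The derivative estimate is applied to the difference of two members, which is
    entire and uniformly small, so the derivatives are uniformly Cauchy.\<close>
  have close: "\<exists>N. \<forall>n\<ge>N. \<forall>m\<ge>N. \<forall>x\<in>cball 0 R. \<forall>h. norm (?D n x h - ?D m x h) \<le> e * norm h" if "e > 0" for e
  proof -
    have "0 < e / 2" using that by simp
    from uc[OF this] obtain N where "\<forall>n x. n \<ge> N \<and> x \<in> cball 0 (R + 1) \<longrightarrow> norm (f (r n) x - g x) < e / 2"
      by (elim exE)
    then have N: "\<And>n x. n \<ge> N \<Longrightarrow> x \<in> cball 0 (R + 1) \<Longrightarrow> norm (f (r n) x - g x) < e / 2" by blast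
    show ?thesis
    proof (intro exI[of _ N] allI impI ballI)
      fix n m and x h :: "complex^'n" assume nm: "n \<ge> N" "m \<ge> N" and x: "x \<in> cball 0 R"
      have d: "fderiv (\<lambda>z. f (r n) z - f (r m) z) x = (\<lambda>h. ?D n x h - ?D m x h)"
        by (rule frechet_derivative_at[symmetric]) (intro derivative_intros entire_has_derivative f)
      have "norm (fderiv (\<lambda>z. f (r n) z - f (r m) z) x h) \<le> e * norm h"
      proof (rule entire_deriv_bound[where R = R])
        fix z :: "complex^'n" assume "norm z \<le> R + 1"
        then have "norm (f (r n) z - g z) < e / 2" "norm (f (r m) z - g z) < e / 2"
          using N nm by auto
        then show "norm (f (r n) z - f (r m) z) \<le> e"
          using norm_triangle_ineq4[of "f (r n) z - g z" "f (r m) z - g z"] by simp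
      qed (use x f in \<open>auto intro: entire_diff\<close>)
      then show "norm (?D n x h - ?D m x h) \<le> e * norm h" by (simp add: d)
    qed
  qed
  have "\<exists>l. (\<lambda>n. ?D n x h) \<longlonglongrightarrow> l" if x: "x \<in> cball 0 R" for x h
  proof -
    have "Cauchy (\<lambda>n. ?D n x h)"
    proof (rule metric_CauchyI)
      fix e :: real assume e: "e > 0"
      then have "e / (norm h + 1) > 0" by (simp add: add_nonneg_pos)
      from close[OF this] obtain N
        where N: "\<And>n m. n\<ge>N \<Longrightarrow> m\<ge>N \<Longrightarrow> norm (?D n x h - ?D m x h) \<le> e / (norm h + 1) * norm h"
        using x by blast
      have "norm h + 1 > 0" by (simp add: add_nonneg_pos)
      then have "e / (norm h + 1) * norm h < e" using e by (simp add: field_simps)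
      then show "\<exists>M. \<forall>m\<ge>M. \<forall>n\<ge>M. dist (?D m x h) (?D n x h) < e"
        unfolding dist_norm using N by (meson order.strict_trans1)
    qed
    then show ?thesis by (simp add: Cauchy_convergent_iff convergent_def)
  qed
  then obtain g' where g': "\<And>x h. x \<in> cball 0 R \<Longrightarrow> (\<lambda>n. ?D n x h) \<longlonglongrightarrow> g' x h"
    by metis
  have "\<exists>G. \<forall>x\<in>ball 0 R. (\<lambda>n. f (r n) x) \<longlonglongrightarrow> G x \<and> (G has_derivative g' x) (at x within ball 0 R)"
  proof (rule has_derivative_sequence)
    show "(f (r n) has_derivative ?D n x) (at x within ball 0 R)" for n x
      by (rule has_derivative_at_withinI[OF entire_has_derivative[OF f]])
    show "\<forall>\<^sub>F n in sequentially. \<forall>x\<in>ball 0 R. \<forall>h. norm (?D n x h - g' x h) \<le> e * norm h" if e: "e > 0" for e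
    proof -
      obtain N where N: "\<And>n m x h. n\<ge>N \<Longrightarrow> m\<ge>N \<Longrightarrow> x\<in>cball 0 R \<Longrightarrow> norm (?D n x h - ?D m x h) \<le> e * norm h"
        using close[OF e] by blast
      show ?thesis unfolding eventually_sequentially
      proof (intro exI[of _ N] allI impI ballI)
        fix n and x h :: "complex^'n" assume n: "n \<ge> N" and x: "x \<in> ball 0 R"
        then have x': "x \<in> cball 0 R" by auto
        have "(\<lambda>m. norm (?D n x h - ?D m x h)) \<longlonglongrightarrow> norm (?D n x h - g' x h)"
          by (intro tendsto_intros g' x')
        then show "norm (?D n x h - g' x h) \<le> e * norm h"
          by (rule LIMSEQ_le_const2) (use N n x' in blast)
      qed
    qed
    show "z0 \<in> ball 0 R" by (simp add: R_def)
    show "(\<lambda>n. f (r n) z0) \<longlonglongrightarrow> F z0"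
      using LIMSEQ_subseq_LIMSEQ[OF lim r, of z0] by (simp add: o_def)
  qed auto
  then obtain G where G: "\<And>x. x\<in>ball 0 R \<Longrightarrow> (\<lambda>n. f (r n) x) \<longlonglongrightarrow> G x"
     "\<And>x. x\<in>ball 0 R \<Longrightarrow> (G has_derivative g' x) (at x within ball 0 R)" by blast
  have z0: "z0 \<in> ball 0 R" by (simp add: R_def)
  have GF: "G x = F x" if "x \<in> ball 0 R" for x
    using G(1)[OF that] LIMSEQ_subseq_LIMSEQ[OF lim r, of x] LIMSEQ_unique by (auto simp: o_def)
  have "(G has_derivative g' z0) (at z0)"
    using G(2)[OF z0] at_within_open[OF z0 open_ball] by simp
  then have "(F has_derivative g' z0) (at z0)"
    by (rule has_derivative_transform_within_open[OF _ open_ball z0]) (simp add: GF)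
  moreover have "g' z0 (c *s v) = c * g' z0 v" for c v
  proof -
    have "(\<lambda>n. c * ?D n z0 v) \<longlonglongrightarrow> c * g' z0 v" using z0 by (intro tendsto_intros g') auto
    moreover have "(\<lambda>n. c * ?D n z0 v) \<longlonglongrightarrow> g' z0 (c *s v)"
      using g'[of z0 "c *s v"] z0 by (simp add: fderiv_scalar_mult f)
    ultimately show ?thesis using LIMSEQ_unique by blast
  qed
  ultimately show "\<exists>D. (F has_derivative D) (at z0) \<and> (\<forall>c v. D (c *s v) = c * D v)" by blast
qed

text \<open>Extraction on a countable dense set gives convergence there; the local Lipschitz bound,
  uniform in k, makes the subsequence Cauchy at every other point.\<close>

lemma entire_montel:
  fixes f :: "nat \<Rightarrow> complex^'n \<Rightarrow> complex"
  assumes f: "\<And>k. entire (f k)"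
    and bd: "\<And>R. \<exists>B. \<forall>k z. norm z \<le> R \<longrightarrow> norm (f k z) \<le> B"
  obtains r F where "strict_mono (r :: nat \<Rightarrow> nat)" "\<And>z. (\<lambda>k. f (r k) z) \<longlonglongrightarrow> F z" "entire F"
proof -
  obtain B where B: "\<And>R k z. norm z \<le> R \<Longrightarrow> norm (f k z) \<le> B R" using bd by metis
  obtain S :: "(complex^'n) set" where S: "countable S" "\<And>X. open X \<Longrightarrow> X \<noteq> {} \<Longrightarrow> \<exists>d\<in>S. d \<in> X"
    using countable_dense_setE by blast
  \<comment> \<open>The extraction asks for one bound at all points, so the values are rescaled by
    the bound valid at radius \<open>norm z\<close>; adding 1 keeps the divisor nonzero.\<close>
  have b: "norm (f k z / of_real (\<bar>B (norm z)\<bar> + 1)) \<le> 1" for k z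
    using B[of z "norm z" k] by (auto simp: norm_divide divide_le_eq)
  obtain r where r: "strict_mono r" and
    conv: "\<And>x. x \<in> S \<Longrightarrow> \<exists>l. (\<lambda>n. f (r n) x / of_real (\<bar>B (norm x)\<bar> + 1)) \<longlonglongrightarrow> l"
    by (rule function_convergent_subsequence[OF S(1), of "\<lambda>n x. f n x / of_real (\<bar>B (norm x)\<bar> + 1)" 1])
      (use b in auto)
  have convS: "Cauchy (\<lambda>n. f (r n) x)" if "x \<in> S" for x
  proof -
    obtain l where "(\<lambda>n. f (r n) x / of_real (\<bar>B (norm x)\<bar> + 1)) \<longlonglongrightarrow> l" using conv[OF \<open>x \<in> S\<close>] by blast
    then have "(\<lambda>n. f (r n) x / of_real (\<bar>B (norm x)\<bar> + 1) * of_real (\<bar>B (norm x)\<bar> + 1)) \<longlonglongrightarrow> l * of_real (\<bar>B (norm x)\<bar> + 1)"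
      by (intro tendsto_intros)
    moreover have "of_real (\<bar>B (norm x)\<bar> + 1) \<noteq> (0::complex)"
      unfolding of_real_eq_0_iff by linarith
    ultimately show ?thesis by (auto intro!: LIMSEQ_imp_Cauchy)
  qed
  have "Cauchy (\<lambda>n. f (r n) z)" for z
  proof (rule metric_CauchyI)
    fix e :: real assume e: "e > 0"
    define L where "L = \<bar>B (norm z + 1 + 1)\<bar> + 1"
    have L: "L > 0" by (simp add: L_def add_nonneg_pos)
    have "z \<in> ball z (min 1 (e / (3 * L)))" using e L by simp
    then obtain d where d: "d \<in> S" "dist z d < min 1 (e / (3 * L))"
      using S(2)[OF open_ball] by (metis empty_iff mem_ball)
    have nd: "norm d \<le> norm z + 1"
      using d norm_triangle_ineq4[of z "z - d"] by (simp add: dist_norm)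
    have lip: "norm (f k z - f k d) < e / 3" for k
    proof -
      have "norm (f k z - f k d) \<le> L * norm (z - d)"
      proof (rule entire_lipschitz[OF f, where R = "norm z + 1"])
        fix x :: "complex^'n" assume "norm x \<le> norm z + 1 + 1"
        from B[OF this, of k] show "norm (f k x) \<le> L" by (simp add: L_def)
      qed (use nd in auto)
      also have "\<dots> < e / 3" using d L by (simp add: dist_norm field_simps)
      finally show ?thesis .
    qed
    obtain N where N: "\<And>m n. m \<ge> N \<Longrightarrow> n \<ge> N \<Longrightarrow> dist (f (r m) d) (f (r n) d) < e / 3"
      using metric_CauchyD[OF convS[OF d(1)], of "e / 3"] e by auto
    show "\<exists>M. \<forall>m\<ge>M. \<forall>n\<ge>M. dist (f (r m) z) (f (r n) z) < e"
    proof (intro exI[of _ N] allI impI)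
      fix m n assume "m \<ge> N" "n \<ge> N"
      then have "dist (f (r m) d) (f (r n) d) < e / 3" by (rule N)
      moreover have "dist (f (r m) z) (f (r m) d) < e / 3" "dist (f (r n) z) (f (r n) d) < e / 3"
        using lip by (auto simp: dist_norm)
      ultimately show "dist (f (r m) z) (f (r n) z) < e"
        using dist_triangle[of "f (r m) z" "f (r n) z" "f (r m) d"] dist_triangle[of "f (r m) d" "f (r n) z" "f (r n) d"]
        by (simp add: dist_commute)
    qed
  qed
  then have "\<forall>z. \<exists>l. (\<lambda>n. f (r n) z) \<longlonglongrightarrow> l"
    by (simp add: Cauchy_convergent_iff convergent_def)
  then obtain F where F: "\<And>z. (\<lambda>k. f (r k) z) \<longlonglongrightarrow> F z" by metis
  have "entire F"
  proof (rule entire_pointwise_limit[of "\<lambda>k. f (r k)"])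
    show "\<exists>B. \<forall>k z. norm z \<le> R \<longrightarrow> norm (f (r k) z) \<le> B" for R
      using B by blast
  qed (use f F in auto)
  then show ?thesis using that r F by blast
qed

text \<open>The derivative is the pointwise limit of difference quotients with step 1/(k+1), which
  are entire and, by the Lipschitz estimate, locally bounded uniformly in k. This supplies the
  second derivatives required by \<open>C2\<close>.\<close>

lemma entire_fderiv:
  fixes f :: "complex^'n \<Rightarrow> complex"
  assumes f: "entire f"
  shows "entire (\<lambda>z. fderiv f z v)"
proof (rule entire_pointwise_limit)
  let ?c = "\<lambda>k. inverse (real (Suc k))"
  let ?g = "\<lambda>k (z :: complex^'n). of_nat (Suc k) * (f (z + ?c k *\<^sub>R v) - f z)"
  show "entire (?g k)" for k
    by (intro entire_cmult entire_diff entire_translate f)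
  show "\<exists>B. \<forall>k z. norm z \<le> R \<longrightarrow> norm (?g k z) \<le> B" for R
  proof -
    obtain B where B: "\<And>z. norm z \<le> R + norm v + 1 \<Longrightarrow> norm (f z) \<le> B"
      using entire_locally_bounded[OF f] by blast
    show ?thesis
    proof (intro exI allI impI)
      fix k and z :: "complex^'n" assume z: "norm z \<le> R"
      have c: "?c k \<le> 1" by (simp add: field_simps)
      have "norm (z + ?c k *\<^sub>R v) \<le> R + norm v"
        using z mult_right_mono[OF c norm_ge_zero[of v]] by (intro norm_triangle_le add_mono) auto
      moreover have "norm z \<le> R + norm v" using z by (simp add: add_increasing2)
      ultimately have "norm (f (z + ?c k *\<^sub>R v) - f z) \<le> B * norm ((z + ?c k *\<^sub>R v) - z)"
        by (intro entire_lipschitz[OF f B])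
      then have "norm (?g k z) \<le> real (Suc k) * (B * norm ((z + ?c k *\<^sub>R v) - z))"
        unfolding norm_mult norm_of_nat by (intro mult_left_mono) auto
      also have "\<dots> = B * norm v" by (simp add: field_simps del: of_nat_Suc)
      finally show "norm (?g k z) \<le> B * norm v" .
    qed
  qed
  show "(\<lambda>k. ?g k z) \<longlonglongrightarrow> fderiv f z v" for z
  proof -
    have d: "((\<lambda>s. f (z + s *s v)) has_field_derivative fderiv f z v) (at 0)"
      using entire_line_deriv[OF f, of z v 0] by simp
    have "filterlim (\<lambda>k. complex_of_real (?c k)) (at 0) sequentially"
      unfolding filterlim_at using tendsto_of_real[OF LIMSEQ_inverse_real_of_nat, where 'a = complex]
      by (auto intro!: always_eventually simp del: of_nat_Suc of_real_inverse)
    from filterlim_compose[OF d[unfolded DERIV_def] this]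
    have "(\<lambda>k. (f (z + complex_of_real (?c k) *s v) - f z) / complex_of_real (?c k)) \<longlonglongrightarrow> fderiv f z v"
      by simp
    moreover have "complex_of_real (?c k) *s v = ?c k *\<^sub>R v" for k
      by (simp add: vec_eq_iff scaleR_conv_of_real[where 'a = complex])
    moreover have "(f (z + ?c k *\<^sub>R v) - f z) / complex_of_real (?c k) = ?g k z" for k
      by (simp add: divide_inverse mult.commute)
    ultimately show ?thesis by (simp only:)
  qed
qed

text \<open>A rank-one map. Summed over \<open>Basis\<close> it rebuilds an operator from its values
  there, and it depends on \<open>w\<close> linearly and boundedly.\<close>

definition coord_blinfun :: "'a::euclidean_space \<Rightarrow> 'b::real_normed_vector \<Rightarrow> 'a \<Rightarrow>\<^sub>L 'b" where
  "coord_blinfun b w = blinfun_scaleR_left w o\<^sub>L blinfun_inner_left b"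

lemma coord_blinfun_apply [simp]: "coord_blinfun b w v = (v \<bullet> b) *\<^sub>R w"
  by (simp add: coord_blinfun_def)

lemma bounded_linear_coord_blinfun: "bounded_linear (coord_blinfun b)"
  unfolding coord_blinfun_def
  by (intro bounded_linear_compose[OF bounded_bilinear.bounded_linear_left[OF bounded_bilinear_blinfun_compose]] bounded_linear_intros)

text \<open>\<open>C2\<close> asks for derivatives as points of operator spaces, whereas concrete
  functions come with explicit derivative maps. Rebuilding both operators from their values on
  \<open>Basis\<close> reduces differentiability and continuity to finitely many ordinary
  functions.\<close>

lemma C2_if_continuous_partials:
  fixes f :: "'a::euclidean_space \<Rightarrow> 'b::real_normed_vector"
  assumes D: "\<And>z. (f has_derivative D z) (at z)"
    and DD: "\<And>z b. ((\<lambda>z. D z b) has_derivative DD b z) (at z)"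
    and cont: "\<And>b c. continuous_on UNIV (\<lambda>z. DD b z c)"
  shows "C2 f"
proof -
  note lin = bounded_linear_coord_blinfun
  have expand: "L v = (\<Sum>b\<in>Basis. (v \<bullet> b) *\<^sub>R L b)" if "bounded_linear L" for L :: "'a \<Rightarrow> 'b" and v
  proof -
    have "L v = L (\<Sum>b\<in>Basis. (v \<bullet> b) *\<^sub>R b)" by (simp add: euclidean_representation)
    also have "\<dots> = (\<Sum>b\<in>Basis. (v \<bullet> b) *\<^sub>R L b)"
      using that by (simp add: linear_sum linear_simps bounded_linear.linear)
    finally show ?thesis .
  qed
  define f' where "f' z = (\<Sum>b\<in>Basis. coord_blinfun b (D z b))" for z
  define f'' where "f'' z = (\<Sum>c\<in>Basis. coord_blinfun c (\<Sum>b\<in>Basis. coord_blinfun b (DD b z c)))" for z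
  show ?thesis unfolding C2_def
  proof (intro exI[of _ f'] exI[of _ f''] conjI allI)
    fix z
    have "blinfun_apply (f' z) = D z"
      unfolding f'_def by (rule ext, subst expand[OF has_derivative_bounded_linear[OF D]]) (simp add: blinfun.sum_left)
    then show "(f has_derivative blinfun_apply (f' z)) (at z)"
      using D by simp
    have "blinfun_apply (f'' z) = (\<lambda>v. \<Sum>b\<in>Basis. coord_blinfun b (DD b z v))"
    proof
      fix v
      have "blinfun_apply (f'' z) v = (\<Sum>c\<in>Basis. \<Sum>b\<in>Basis. (v \<bullet> c) *\<^sub>R coord_blinfun b (DD b z c))"
        by (simp add: f''_def blinfun.sum_left scaleR_sum_right)
      also have "\<dots> = (\<Sum>b\<in>Basis. \<Sum>c\<in>Basis. (v \<bullet> c) *\<^sub>R coord_blinfun b (DD b z c))"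
        by (rule sum.swap)
      also have "\<dots> = (\<Sum>b\<in>Basis. coord_blinfun b (\<Sum>c\<in>Basis. (v \<bullet> c) *\<^sub>R DD b z c))"
        by (simp add: lin linear_sum linear_simps bounded_linear.linear)
      also have "\<dots> = (\<Sum>b\<in>Basis. coord_blinfun b (DD b z v))"
        by (subst expand[OF has_derivative_bounded_linear[OF DD]]) simp
      finally show "blinfun_apply (f'' z) v = (\<Sum>b\<in>Basis. coord_blinfun b (DD b z v))" .
    qed
    moreover have "(f' has_derivative (\<lambda>v. \<Sum>b\<in>Basis. coord_blinfun b (DD b z v))) (at z)"
      unfolding f'_def by (intro has_derivative_sum bounded_linear.has_derivative[OF lin] DD)
    ultimately show "(f' has_derivative blinfun_apply (f'' z)) (at z)" by simp
  next
    show "continuous_on UNIV f''"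
      unfolding f''_def
      by (intro continuous_on_sum bounded_linear.continuous_on[OF lin] cont)
  qed
qed

text \<open>Cauchy's integral formula on the unit circle: in the parametrisation by t in [0,1] the
  path derivative 2 pi i u cancels the denominator u.\<close>

lemma circle_mean_value:
  assumes g: "g holomorphic_on UNIV"
  shows "(LINT t:{0..1}|lborel. g (cis (2 * pi * t))) = g 0"
proof -
  have c: "continuous_on S g" for S
    using g holomorphic_on_imp_continuous_on continuous_on_subset by blast
  have "((\<lambda>u. g u / (u - 0)) has_contour_integral (2 * of_real pi * \<i> * g 0)) (circlepath 0 1)"
    by (rule Cauchy_integral_circlepath) (use g c holomorphic_on_subset in auto)
  then have "((\<lambda>x. g (circlepath 0 1 x) / circlepath 0 1 x * vector_derivative (circlepath 0 1) (at x)) has_integral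
      (2 * of_real pi * \<i> * g 0)) {0..1}"
    by (simp add: has_contour_integral)
  moreover have "g (circlepath 0 1 x) / circlepath 0 1 x * vector_derivative (circlepath 0 1) (at x) =
      (2 * of_real pi * \<i>) * g (cis (2 * pi * x))" for x
  proof -
    have "circlepath 0 1 x = cis (2 * pi * x)"
      by (simp add: circlepath cis_conv_exp mult_ac)
    moreover have "vector_derivative (circlepath 0 1) (at x) = (2 * of_real pi * \<i>) * cis (2 * pi * x)"
      by (simp add: vector_derivative_circlepath cis_conv_exp mult_ac)
    ultimately show ?thesis by simp
  qed
  ultimately have "((\<lambda>x. (2 * of_real pi * \<i>) * g (cis (2 * pi * x))) has_integral
      (2 * of_real pi * \<i> * g 0)) {0..1}" by (simp only:)
  from has_integral_mult_right[OF this, of "1 / (2 * of_real pi * \<i>)"]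
  have "((\<lambda>x. g (cis (2 * pi * x))) has_integral g 0) {0..1}" by simp
  moreover have "set_integrable lborel {0..1} (\<lambda>t. g (cis (2 * pi * t)))"
    by (rule borel_integrable_atLeastAtMost') (intro continuous_on_compose2[OF c[of UNIV]] continuous_intros, auto)
  ultimately show ?thesis
    using set_borel_integral_eq_integral(2) integral_unique by metis
qed

subsection \<open>Pluriharmonic functions\<close>

text \<open>Writing f(x + su + tv) - f(x + su) as an integral along v and differentiating in s under
  the integral expresses f'(x + tv)u - f'(x)u as an integral of f'' u v. Differentiating both sides
  in t at 0 gives the two orders.\<close>

lemma symmetric_second_derivative:
  fixes f :: "'a::euclidean_space \<Rightarrow> 'b::banach" and f' :: "'a \<Rightarrow> 'a \<Rightarrow>\<^sub>L 'b"
  assumes f': "\<And>x. (f has_derivative blinfun_apply (f' x)) (at x)"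
    and f'': "\<And>x. (f' has_derivative blinfun_apply (f'' x)) (at x)"
    and cont: "continuous_on UNIV f''"
  shows "f'' x u v = f'' x v u"
proof -
  have cont_f': "continuous_on S f'" for S
    by (meson f'' continuous_at_imp_continuous_on has_derivative_continuous)
  note [continuous_intros] = continuous_on_compose2[OF cont] continuous_on_compose2[OF cont_f'[of UNIV]]
  have line: "((\<lambda>s. f' (y + s *\<^sub>R w) z) has_vector_derivative f'' (y + s *\<^sub>R w) w z) (at s within S)" for y w z s S
  proof -
    have "((\<lambda>s. y + s *\<^sub>R w) has_derivative (\<lambda>s. s *\<^sub>R w)) (at s within S)"
      by (auto intro!: derivative_eq_intros)
    from has_derivative_compose[OF this f'']
    have "((\<lambda>s. f' (y + s *\<^sub>R w)) has_derivative (\<lambda>t. f'' (y + s *\<^sub>R w) (t *\<^sub>R w))) (at s within S)" .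
    then show ?thesis unfolding has_vector_derivative_def
      by (auto intro!: derivative_eq_intros simp: blinfun.bilinear_simps)
  qed
  have linef: "((\<lambda>s. f (y + s *\<^sub>R w)) has_vector_derivative f' (y + s *\<^sub>R w) w) (at s within S)" for y w s S
  proof -
    have "((\<lambda>s. y + s *\<^sub>R w) has_derivative (\<lambda>s. s *\<^sub>R w)) (at s within S)"
      by (auto intro!: derivative_eq_intros)
    from has_derivative_compose[OF this f']
    show ?thesis unfolding has_vector_derivative_def by (simp add: blinfun.bilinear_simps)
  qed
  have eq: "f' (x + t *\<^sub>R v) u - f' x u = integral {0..t} (\<lambda>\<tau>. f'' (x + \<tau> *\<^sub>R v) u v)" if t: "t \<ge> 0" for t
  proof -
    have 1: "integral {0..t} (\<lambda>\<tau>. f' (x + s *\<^sub>R u + \<tau> *\<^sub>R v) v) = f (x + s *\<^sub>R u + t *\<^sub>R v) - f (x + s *\<^sub>R u)" for s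
      using fundamental_theorem_of_calculus[OF t linef, of "x + s *\<^sub>R u" v]
      by (simp add: integral_unique)
    have "((\<lambda>s. integral (cbox 0 t) (\<lambda>\<tau>. f' (x + s *\<^sub>R u + \<tau> *\<^sub>R v) v)) has_vector_derivative
        integral (cbox 0 t) (\<lambda>\<tau>. f'' (x + 0 *\<^sub>R u + \<tau> *\<^sub>R v) u v)) (at 0 within UNIV)"
    proof (rule leibniz_rule_vector_derivative)
      show "((\<lambda>s. f' (x + s *\<^sub>R u + \<tau> *\<^sub>R v) v) has_vector_derivative f'' (x + s *\<^sub>R u + \<tau> *\<^sub>R v) u v) (at s within UNIV)" for s \<tau>
        using line[of "x + \<tau> *\<^sub>R v" u v s UNIV] by (simp add: algebra_simps)
      show "(\<lambda>\<tau>. f' (x + s *\<^sub>R u + \<tau> *\<^sub>R v) v) integrable_on cbox 0 t" for s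
        by (intro integrable_continuous continuous_intros) auto
      show "continuous_on (UNIV \<times> cbox 0 t) (\<lambda>(s, \<tau>). f'' (x + s *\<^sub>R u + \<tau> *\<^sub>R v) u v)"
        unfolding split_beta by (intro continuous_intros) auto
    qed auto
    moreover have "((\<lambda>s. f (x + s *\<^sub>R u + t *\<^sub>R v) - f (x + s *\<^sub>R u)) has_vector_derivative
        f' (x + t *\<^sub>R v) u - f' x u) (at 0)"
      using has_vector_derivative_diff[OF linef[of "x + t *\<^sub>R v" u 0 UNIV] linef[of x u 0 UNIV]]
      by (simp add: algebra_simps)
    ultimately show ?thesis
      unfolding box_real 1 by (simp add: vector_derivative_unique_at)
  qed
  \<comment> \<open>The integral formula covers only t \<ge> 0, so both derivatives at 0 are taken
    within {0..1}.\<close>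
  have "((\<lambda>t. f' (x + t *\<^sub>R v) u - f' x u) has_vector_derivative f'' x v u) (at 0 within {0..1})"
    using line[of x v u 0 "{0..1}"] by (auto intro!: derivative_eq_intros)
  then have "((\<lambda>t. integral {0..t} (\<lambda>\<tau>. f'' (x + \<tau> *\<^sub>R v) u v)) has_vector_derivative f'' x v u) (at 0 within {0..1})"
    by (rule has_vector_derivative_transform[rotated 2]) (auto simp: eq)
  moreover have "((\<lambda>t. integral {0..t} (\<lambda>\<tau>. f'' (x + \<tau> *\<^sub>R v) u v)) has_vector_derivative f'' (x + 0 *\<^sub>R v) u v) (at 0 within {0..1})"
    by (rule integral_has_vector_derivative) (intro continuous_intros, auto)
  ultimately show ?thesis
    using vector_derivative_unique_within_closed_interval[of 0 1 0] by simp
qed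

text \<open>The Poincare lemma on the whole space. The primitive is the integral of L(tx) x over t
  in [0,1]; by symmetry of \<open>L'\<close> its derivative is the integral of d/dt (t L(tx)), that
  is L(x).\<close>

lemma closed_form_exact:
  fixes L :: "'a::euclidean_space \<Rightarrow> 'a \<Rightarrow>\<^sub>L 'b::banach"
  assumes L': "\<And>x. (L has_derivative blinfun_apply (L' x)) (at x)"
    and cont: "continuous_on UNIV L'" and sym: "\<And>x u v. L' x u v = L' x v u"
  shows "\<exists>g. \<forall>x. (g has_derivative blinfun_apply (L x)) (at x)"
proof (intro exI allI)
  fix x
  have cont_L: "continuous_on S L" for S
    by (meson L' continuous_at_imp_continuous_on has_derivative_continuous)
  note [continuous_intros] = continuous_on_compose2[OF cont] continuous_on_compose2[OF cont_L[of UNIV]]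
  let ?g = "\<lambda>x. integral (cbox 0 1) (\<lambda>t. L (t *\<^sub>R x) x)"
  let ?h = "\<lambda>x t. t *\<^sub>R L' (t *\<^sub>R x) x + L (t *\<^sub>R x)"
  have Lt: "((\<lambda>x. L (t *\<^sub>R x)) has_derivative (\<lambda>v. t *\<^sub>R L' (t *\<^sub>R x) v)) (at x)" for t x
  proof -
    have "((\<lambda>x. t *\<^sub>R x) has_derivative (\<lambda>v. t *\<^sub>R v)) (at x)"
      by (auto intro!: derivative_eq_intros)
    from has_derivative_compose[OF this L'] show ?thesis by (simp add: blinfun.bilinear_simps)
  qed
  have "(?g has_derivative blinfun_apply (integral (cbox 0 1) (?h x))) (at x within UNIV)"
  proof (rule leibniz_rule)
    fix y :: 'a and t :: real
    have "((\<lambda>x. L (t *\<^sub>R x) x) has_derivative (\<lambda>v. L (t *\<^sub>R y) v + (t *\<^sub>R L' (t *\<^sub>R y) v) y)) (at y)"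
      by (rule bounded_bilinear.FDERIV[OF bounded_bilinear_blinfun_apply Lt has_derivative_ident])
    moreover have "(\<lambda>v. L (t *\<^sub>R y) v + (t *\<^sub>R L' (t *\<^sub>R y) v) y) = blinfun_apply (?h y t)"
      by (auto simp: fun_eq_iff blinfun.bilinear_simps sym[of "t *\<^sub>R y" _ y])
    ultimately show "((\<lambda>x. L (t *\<^sub>R x) x) has_derivative blinfun_apply (?h y t)) (at y within UNIV)" by simp
  next
    show "(\<lambda>t. L (t *\<^sub>R y) y) integrable_on cbox 0 1" for y
      by (intro integrable_continuous continuous_intros) auto
    show "continuous_on (UNIV \<times> cbox 0 1) (\<lambda>(x, t). ?h x t)"
      unfolding split_beta by (intro continuous_intros) auto
  qed auto
  moreover have "(?h x has_integral 1 *\<^sub>R L (1 *\<^sub>R x) - 0 *\<^sub>R L (0 *\<^sub>R x)) {0..1}"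
  proof (rule fundamental_theorem_of_calculus)
    fix t :: real
    have "((\<lambda>t. t *\<^sub>R x) has_derivative (\<lambda>s. s *\<^sub>R x)) (at t within {0..1})"
      by (auto intro!: derivative_eq_intros)
    from has_derivative_compose[OF this L']
    have "((\<lambda>t. L (t *\<^sub>R x)) has_vector_derivative L' (t *\<^sub>R x) x) (at t within {0..1})"
      by (simp add: has_vector_derivative_def blinfun.bilinear_simps)
    from has_vector_derivative_scaleR[OF has_real_derivative_iff_has_vector_derivative[THEN iffD2, OF has_vector_derivative_id] this]
    show "((\<lambda>t. t *\<^sub>R L (t *\<^sub>R x)) has_vector_derivative ?h x t) (at t within {0..1})"
      by (simp add: add.commute)
  qed simp
  ultimately show "(?g has_derivative blinfun_apply (L x)) (at x)"
    by (simp add: integral_unique)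
qed

lemma scalar_i_mult: "\<i> *s (\<i> *s v) = - (v :: complex^'n)"
  by (simp add: vec_eq_iff)

lemma axis_i: "axis k \<i> = \<i> *s (axis k 1 :: complex^'n)"
  by (simp add: vec_eq_iff axis_def)

lemma scalar_mult_Re_Im: "c *s v = Re c *\<^sub>R v + Im c *\<^sub>R (\<i> *s v)" for v :: "complex^'n"
  by (auto simp: vec_eq_iff complex_eq_iff)

text \<open>The Levi form of a pluriharmonic function vanishes, so \<open>\<partial>f\<close> is a closed 1-form. It has a
  primitive \<open>g\<close>, which is holomorphic, and \<open>f - g\<close> is antiholomorphic.\<close>

lemma pluriharmonic_decompose:
  assumes f: "pluriharmonic f"
  shows "\<exists>g h. entire g \<and> entire h \<and> h 0 = 0 \<and> f = (\<lambda>z. g z + cnj (h z))"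
proof -
  obtain f' f'' where f': "\<And>x. (f has_derivative blinfun_apply (f' x)) (at x)"
    and f'': "\<And>x. (f' has_derivative blinfun_apply (f'' x)) (at x)"
    and cont: "continuous_on UNIV f''"
    using f unfolding pluriharmonic_def C2_def by blast
  note sym = symmetric_second_derivative[OF f' f'' cont]
  \<comment> \<open>Multiplication by i as a real-linear operator; \<open>f''\<close> is only real
    bilinear, so the complex structure has to be tracked separately.\<close>
  define J :: "(complex^'a) \<Rightarrow>\<^sub>L (complex^'a)" where "J = Blinfun ((*s) \<i>)"
  have J: "J v = \<i> *s v" for v
    unfolding J_def by (simp add: bounded_linear_Blinfun_apply bounded_linear_scalar_mult)
  have JJ: "J (J v) = - v" for v by (simp add: J scalar_i_mult)
  have fr: "frechet_derivative f (at z) = f' z" for z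
    using frechet_derivative_at[OF f'] by metis
  have db: "dzbar k f = (\<lambda>z. (f' z (axis k 1) + \<i> * f' z (axis k \<i>)) / 2)" for k
    by (simp add: dzbar_def[abs_def] fr)
  have levi: "(f'' z (axis j 1) (axis k 1) + \<i> * f'' z (axis j 1) (axis k \<i>)
     - \<i> * (f'' z (axis j \<i>) (axis k 1) + \<i> * f'' z (axis j \<i>) (axis k \<i>))) = 0" for j k z
  proof -
    have "((\<lambda>z. (f' z (axis k 1) + \<i> * f' z (axis k \<i>)) / 2) has_derivative
       (\<lambda>u. (f'' z u (axis k 1) + \<i> * f'' z u (axis k \<i>)) / 2)) (at z)"
      by (auto intro!: derivative_eq_intros f'' simp: blinfun.bilinear_simps)
    from frechet_derivative_at[OF this, folded db]
    have d: "frechet_derivative (dzbar k f) (at z) = (\<lambda>u. (f'' z u (axis k 1) + \<i> * f'' z u (axis k \<i>)) / 2)" by simp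
    have "dz j (dzbar k f) z = 0" using f by (simp add: pluriharmonic_def)
    then show ?thesis unfolding dz_def d by (simp add: diff_divide_distrib[symmetric])
  qed
  \<comment> \<open>The defect in f''(Ju, Jv) = -f''(u, v), which is the coordinate-free form of the
    vanishing of all mixed Wirtinger derivatives.\<close>
  define N where "N z u v = f'' z (J u) (J v) + f'' z u v" for z u v
  have lev1: "f'' z (axis j 1) (axis k 1) + f'' z (axis j \<i>) (axis k \<i>) = 0"
    and lev2: "f'' z (axis j 1) (axis k \<i>) = f'' z (axis j \<i>) (axis k 1)" for z j k
  proof -
    have s: "f'' z (axis k \<i>) (axis j \<i>) = f'' z (axis j \<i>) (axis k \<i>)"
      "f'' z (axis k 1) (axis j 1) = f'' z (axis j 1) (axis k 1)"
      "f'' z (axis k 1) (axis j \<i>) = f'' z (axis j \<i>) (axis k 1)"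
      "f'' z (axis k \<i>) (axis j 1) = f'' z (axis j 1) (axis k \<i>)"
      by (rule sym)+
    \<comment> \<open>The values are complex, so p and q cannot be separated by real and imaginary
      parts. Instead the equations for (j,k) and (k,j), combined with the symmetry of
      \<open>f''\<close>, read p + iq = 0 and p - iq = 0.\<close>
    define p where "p = f'' z (axis j 1) (axis k 1) + f'' z (axis j \<i>) (axis k \<i>)"
    define q where "q = f'' z (axis j 1) (axis k \<i>) - f'' z (axis j \<i>) (axis k 1)"
    have "p + \<i> * q = 0" "p - \<i> * q = 0"
      using levi[of z j k] levi[of z k j] unfolding s by (simp_all add: p_def q_def algebra_simps)
    then have "2 * p = 0" "2 * \<i> * q = 0" by (simp_all add: algebra_simps)
    then have "p = 0" "q = 0" by simp_all
    then show "f'' z (axis j 1) (axis k 1) + f'' z (axis j \<i>) (axis k \<i>) = 0"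
      "f'' z (axis j 1) (axis k \<i>) = f'' z (axis j \<i>) (axis k 1)" by (simp_all add: p_def q_def)
  qed
  have N0: "N z u v = 0" for z u v
  proof -
    have lin1: "linear (\<lambda>u. N z u v)" for v
      unfolding N_def by (auto simp: linear_iff blinfun.bilinear_simps algebra_simps)
    have lin2: "linear (\<lambda>v. N z u v)" for u
      unfolding N_def by (auto simp: linear_iff blinfun.bilinear_simps algebra_simps)
    have JB: "J (axis k 1) = axis k \<i>" "J (axis k \<i>) = - axis k 1" for k
      unfolding J axis_i scalar_i_mult by auto
    have "N z b c = 0" if b: "b \<in> Basis" and c: "c \<in> Basis" for b c :: "complex^'a"
    proof -
      obtain j where j: "b = axis j 1 \<or> b = axis j \<i>" using b by (auto simp: Basis_vec_def Basis_complex_def)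
      obtain k where k: "c = axis k 1 \<or> c = axis k \<i>" using c by (auto simp: Basis_vec_def Basis_complex_def)
      show ?thesis using j k lev1[of z j k] lev2[of z j k]
        by (auto simp: N_def JB blinfun.bilinear_simps add.commute)
    qed
    then have "N z u c = 0" if "c \<in> Basis" for u c
      using that linear_eq_stdbasis[OF lin1[of c] linear_zero] by metis
    then show ?thesis
      using linear_eq_stdbasis[OF lin2[of u] linear_zero] by metis
  qed
  have BJ: "f'' z u (J v) = f'' z (J u) v" for z u v
    using N0[of z u "J v"] by (simp add: N_def JJ blinfun.bilinear_simps algebra_simps)
  \<comment> \<open>\<open>P X\<close> is the complex-linear part of a real-linear map, so
    \<open>L\<close> is the (1,0)-part of the differential of \<open>f\<close>.\<close>
  define P :: "((complex^'a) \<Rightarrow>\<^sub>L complex) \<Rightarrow> (complex^'a) \<Rightarrow>\<^sub>L complex"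
    where "P X = (1/2) *\<^sub>R (X - (blinfun_mult_right \<i> o\<^sub>L X o\<^sub>L J))" for X
  have P: "P X v = (X v - \<i> * X (J v)) / 2" for X v
    by (simp add: P_def blinfun.bilinear_simps scaleR_conv_of_real blinfun_mult_right.rep_eq)
  have linP: "bounded_linear P"
    unfolding P_def
    by (intro bounded_linear_intros bounded_linear_sub bounded_linear_const_scaleR
      bounded_linear_compose[OF bounded_bilinear.bounded_linear_left[OF bounded_bilinear_blinfun_compose]]
      bounded_bilinear.bounded_linear_right[OF bounded_bilinear_blinfun_compose])
  define L where "L z = P (f' z)" for z
  define L' where "L' z = Blinfun P o\<^sub>L f'' z" for z
  have L'ap: "L' z u = P (f'' z u)" for z u
    by (simp add: L'_def bounded_linear_Blinfun_apply[OF linP])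
  have "\<exists>g. \<forall>x. (g has_derivative blinfun_apply (L x)) (at x)"
  proof (rule closed_form_exact)
    show "(L has_derivative blinfun_apply (L' x)) (at x)" for x
      unfolding L_def ext[of "blinfun_apply (L' x)", OF L'ap] by (rule bounded_linear.has_derivative[OF linP f''])
    show "continuous_on UNIV L'"
      unfolding L'_def by (intro bounded_bilinear.continuous_on[OF bounded_bilinear_blinfun_compose] continuous_on_const cont)
    \<comment> \<open>Here the vanishing of \<open>N\<close> enters: in the form \<open>BJ\<close>
      it moves J from one argument of \<open>f''\<close> to the other, which makes the twisted half
      of \<open>L'\<close> symmetric.\<close>
    show "L' x u v = L' x v u" for x u v
      by (simp add: L'ap P sym[of x u v] BJ) (metis BJ sym)
  qed
  then obtain g where g: "\<And>x. (g has_derivative blinfun_apply (L x)) (at x)" by blast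
  have LJ: "L z (J v) = \<i> * L z v" for z v
    by (simp add: L_def P JJ blinfun.bilinear_simps field_simps)
  have sm: "blinfun_apply X (c *s v) = Re c *\<^sub>R X v + Im c *\<^sub>R X (J v)" for X :: "(complex^'a) \<Rightarrow>\<^sub>L complex" and c v
    by (subst scalar_mult_Re_Im) (simp add: blinfun.bilinear_simps J)
  have eg: "entire g"
  proof (rule entireI[OF g])
    fix z c v
    have "L z (c *s v) = (of_real (Re c) + \<i> * of_real (Im c)) * L z v" by (simp add: sm LJ scaleR_conv_of_real algebra_simps)
    then show "L z (c *s v) = c * L z v" by (simp add: complex_eq[symmetric])
  qed
  define h where "h z = cnj (f z - g z)" for z
  have eh: "entire h"
  proof (rule entireI)
    show "(h has_derivative (\<lambda>v. cnj (f' z v - L z v))) (at z)" for z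
      unfolding h_def by (intro bounded_linear.has_derivative[OF bounded_linear_cnj] derivative_intros f' g)
    fix z c v
    have MJ: "f' z (J v) - L z (J v) = - \<i> * (f' z v - L z v)" for v
      by (simp add: L_def P JJ blinfun.bilinear_simps field_simps)
    have "f' z (c *s v) - L z (c *s v) = Re c *\<^sub>R (f' z v - L z v) + Im c *\<^sub>R (f' z (J v) - L z (J v))"
      by (simp add: sm algebra_simps)
    also have "\<dots> = (of_real (Re c) - \<i> * of_real (Im c)) * (f' z v - L z v)"
      unfolding MJ by (simp add: scaleR_conv_of_real algebra_simps)
    also have "of_real (Re c) - \<i> * of_real (Im c) = cnj c" by (simp add: complex_eq_iff)
    finally show "cnj (f' z (c *s v) - L z (c *s v)) = c * cnj (f' z v - L z v)" by simp
  qed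
  show ?thesis
  proof (intro exI conjI)
    \<comment> \<open>The constant term of \<open>h\<close> is moved into the holomorphic part; the
      later orthogonality of the two summands depends on the antiholomorphic one vanishing at
      0.\<close>
    show "entire (\<lambda>z. g z + cnj (h 0))" by (intro entire_add eg entire_const)
    show "entire (\<lambda>z. h z - h 0)" by (intro entire_diff eh entire_const)
    show "h 0 - h 0 = 0" by simp
    show "f = (\<lambda>z. (g z + cnj (h 0)) + cnj (h z - h 0))" by (simp add: h_def)
  qed
qed

text \<open>The operator \<open>dzbar\<close> annihilates \<open>g\<close> and maps the conjugate of
  \<open>h\<close> to the conjugate of a derivative of \<open>h\<close>, which \<open>dz\<close>
  annihilates.\<close>

lemma pluriharmonic_add_cnj:
  assumes g: "entire g" and h: "entire h"
  shows "pluriharmonic (\<lambda>z. g z + cnj (h z))"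
  unfolding pluriharmonic_def
proof (intro conjI allI)
  \<comment> \<open>Stated for an arbitrary pair, because the partial derivatives of such a sum are
    again sums of this kind; the second derivatives are obtained from the same fact.\<close>
  have D: "((\<lambda>z. g z + cnj (h z)) has_derivative (\<lambda>v. fderiv g z v + cnj (fderiv h z v))) (at z)"
    if "entire g" "entire h" for g h and z :: "complex^'a"
    by (intro derivative_intros bounded_linear.has_derivative[OF bounded_linear_cnj] entire_has_derivative that)
  show "C2 (\<lambda>z. g z + cnj (h z))"
    by (rule C2_if_continuous_partials[OF D[OF g h] D[OF entire_fderiv[OF g] entire_fderiv[OF h]]])
      (intro continuous_intros entire_continuous_on entire_fderiv g h)
  fix j k z
  note Dg = frechet_derivative_at[OF D, symmetric]
  have "dzbar k (\<lambda>z. g z + cnj (h z)) = (\<lambda>z. 0 + cnj (fderiv h z (axis k 1)))"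
    unfolding dzbar_def Dg[OF g h] axis_i fderiv_scalar_mult[OF g] fderiv_scalar_mult[OF h]
    by (auto simp: fun_eq_iff algebra_simps)
  then show "dz j (dzbar k (\<lambda>z. g z + cnj (h z))) z = 0"
    unfolding dz_def axis_i
    by (simp only: Dg[OF entire_const entire_fderiv[OF h]] fderiv_scalar_mult[OF entire_fderiv[OF h]]
      fderiv_scalar_mult[OF entire_const]) (simp add: frechet_derivative_const)
qed

subsection \<open>Reproducing kernel Hilbert spaces\<close>

text \<open>At t = -d / (|n| + 1) the quadratic is negative as soon as d is nonzero. In the Riesz
  argument this extracts a linear identity from minimality.\<close>

lemma quadratic_nonneg_imp_zero:
  fixes n d :: real
  assumes "\<And>t. 0 \<le> t\<^sup>2 * n + 2 * t * d" shows "d = 0"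
proof (rule ccontr)
  assume d: "d \<noteq> 0"
  define a where "a = \<bar>n\<bar> + 1"
  have a: "a > 0" "n < a" by (auto simp: a_def)
  have "0 \<le> (- d / a)\<^sup>2 * n + 2 * (- d / a) * d" by (rule assms)
  also have "\<dots> = d\<^sup>2 / a * (n / a - 2)"
    using a by (simp add: field_simps power2_eq_square)
  also have "\<dots> < 0"
  proof -
    have "n / a - 2 < 0" using a by (simp add: divide_less_eq)
    moreover have "d\<^sup>2 / a > 0" using d a by simp
    ultimately show ?thesis by (rule mult_pos_neg[rotated])
  qed
  finally show False by simp
qed

text \<open>Cancels a factor that may vanish, for Cauchy-Schwarz bounds in which the unknown norm
  occurs on both sides.\<close>

lemma mult_self_le_imp_le:
  fixes x y :: real
  assumes "x * x \<le> y * x" "0 \<le> y" "0 \<le> x" shows "x \<le> y"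
  using assms by (cases "x = 0") (auto simp: mult_le_cancel_right)

lemma mult_le_sum_squares:
  fixes x y :: real
  assumes "0 \<le> x" "0 \<le> y" shows "x * y \<le> x\<^sup>2 + y\<^sup>2"
  using zero_le_power2[of "x - y"] mult_nonneg_nonneg[OF assms] unfolding power2_diff by linarith

lemma borel_measurable_cnj' [measurable (raw)]:
  "f \<in> borel_measurable M \<Longrightarrow> (\<lambda>x. cnj (f x)) \<in> borel_measurable M"
  by (rule borel_measurable_continuous_on[of cnj]) (auto intro: continuous_intros)

lemma square_integrable_add:
  assumes "square_integrable a f" "square_integrable a g"
  shows "square_integrable a (\<lambda>z. f z + g z)"
proof -
  have m: "f \<in> borel_measurable borel" "g \<in> borel_measurable borel"
    and i: "integrable (gauss_measure a) (\<lambda>z. (norm (f z))\<^sup>2)" "integrable (gauss_measure a) (\<lambda>z. (norm (g z))\<^sup>2)"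
    using assms by (auto simp: square_integrable_def)
  note [measurable] = m
  have "integrable (gauss_measure a) (\<lambda>z. (norm (f z + g z))\<^sup>2)"
  proof (rule Bochner_Integration.integrable_bound)
    show "integrable (gauss_measure a) (\<lambda>z. 2 * (norm (f z))\<^sup>2 + 2 * (norm (g z))\<^sup>2)" using i by auto
    have "(norm (f z + g z))\<^sup>2 \<le> 2 * (norm (f z))\<^sup>2 + 2 * (norm (g z))\<^sup>2" for z
    proof -
      have "(norm (f z + g z))\<^sup>2 \<le> (norm (f z) + norm (g z))\<^sup>2"
        by (intro power_mono norm_triangle_ineq) auto
      also have "\<dots> \<le> 2 * (norm (f z))\<^sup>2 + 2 * (norm (g z))\<^sup>2"
        using zero_le_power2[of "norm (f z) - norm (g z)"] by (simp add: power2_eq_square algebra_simps)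
      finally show ?thesis .
    qed
    then show "AE z in gauss_measure a. norm ((norm (f z + g z))\<^sup>2) \<le> norm (2 * (norm (f z))\<^sup>2 + 2 * (norm (g z))\<^sup>2)"
      by auto
  qed measurable
  then show ?thesis by (simp add: square_integrable_def m)
qed

lemma square_integrable_cmult:
  assumes "square_integrable a f" shows "square_integrable a (\<lambda>z. c * f z)"
  using assms by (auto simp: square_integrable_def norm_mult power_mult_distrib)

lemma integrable_inner_product:
  assumes "square_integrable a f" "square_integrable a g"
  shows "integrable (gauss_measure a) (\<lambda>z. f z * cnj (g z))"
proof -
  have m: "f \<in> borel_measurable borel" "g \<in> borel_measurable borel"
    and i: "integrable (gauss_measure a) (\<lambda>z. (norm (f z))\<^sup>2)" "integrable (gauss_measure a) (\<lambda>z. (norm (g z))\<^sup>2)"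
    using assms by (auto simp: square_integrable_def)
  note [measurable] = m
  show ?thesis
  proof (rule Bochner_Integration.integrable_bound)
    show "integrable (gauss_measure a) (\<lambda>z. (norm (f z))\<^sup>2 + (norm (g z))\<^sup>2)" using i by auto
    show "AE z in gauss_measure a. norm (f z * cnj (g z)) \<le> norm ((norm (f z))\<^sup>2 + (norm (g z))\<^sup>2)"
      by (auto simp: norm_mult mult_le_sum_squares)
  qed measurable
qed

lemma L2_norm_nonneg [simp]: "0 \<le> L2_norm a f"
  by (simp add: L2_norm_def)

lemma L2_inner_cnj: "cnj (L2_inner a f g) = L2_inner a g f"
  unfolding L2_inner_def by (subst Bochner_Integration.integral_cnj[symmetric]) (simp add: mult.commute)

lemma L2_inner_self: "L2_inner a f f = of_real ((L2_norm a f)\<^sup>2)"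
proof -
  have "L2_inner a f f = (\<integral>z. complex_of_real ((norm (f z))\<^sup>2) \<partial>gauss_measure a)"
    unfolding L2_inner_def by (simp only: complex_norm_square)
  also have "\<dots> = of_real (\<integral>z. (norm (f z))\<^sup>2 \<partial>gauss_measure a)"
    by (rule integral_complex_of_real)
  finally show ?thesis by (simp add: L2_norm_def)
qed

lemma ennreal_L2_norm_square:
  assumes "square_integrable a f"
  shows "ennreal ((L2_norm a f)\<^sup>2) = (\<integral>\<^sup>+z. ennreal ((norm (f z))\<^sup>2) \<partial>gauss_measure a)"
  using assms by (subst nn_integral_eq_integral) (auto simp: square_integrable_def L2_norm_def)

text \<open>Fatou's lemma for the squared moduli. Together with pointwise convergent subsequences it
  takes over the role of completeness of the L2 space.\<close>

lemma L2_norm_fatou: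
  assumes u: "\<And>m. square_integrable a (u m)"
    and lim: "\<And>z. (\<lambda>m. u m z) \<longlonglongrightarrow> v z" and C: "\<And>m. L2_norm a (u m) \<le> C"
  shows "square_integrable a v" "L2_norm a v \<le> C"
proof -
  have C0: "0 \<le> C" using C[of 0] L2_norm_nonneg[of a "u 0"] by linarith
  have [measurable]: "u m \<in> borel_measurable borel" for m using u by (auto simp: square_integrable_def)
  have [measurable]: "v \<in> borel_measurable borel"
    by (rule borel_measurable_LIMSEQ_metric[OF _ lim]) measurable
  have "(\<integral>\<^sup>+z. ennreal ((norm (v z))\<^sup>2) \<partial>gauss_measure a) = (\<integral>\<^sup>+z. liminf (\<lambda>m. ennreal ((norm (u m z))\<^sup>2)) \<partial>gauss_measure a)"
  proof (rule nn_integral_cong)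
    fix z
    have "(\<lambda>m. ennreal ((norm (u m z))\<^sup>2)) \<longlonglongrightarrow> ennreal ((norm (v z))\<^sup>2)"
      by (intro tendsto_ennrealI tendsto_intros lim)
    then show "ennreal ((norm (v z))\<^sup>2) = liminf (\<lambda>m. ennreal ((norm (u m z))\<^sup>2))"
      by (subst lim_imp_Liminf) auto
  qed
  also have "\<dots> \<le> liminf (\<lambda>m. \<integral>\<^sup>+z. ennreal ((norm (u m z))\<^sup>2) \<partial>gauss_measure a)"
    by (rule nn_integral_liminf) measurable
  also have "\<dots> = liminf (\<lambda>m. ennreal ((L2_norm a (u m))\<^sup>2))"
    by (simp add: ennreal_L2_norm_square[OF u])
  also have "\<dots> \<le> liminf (\<lambda>m::nat. ennreal (C\<^sup>2))"
    by (intro Liminf_mono always_eventually allI ennreal_leI power_mono C) auto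
  finally have le: "(\<integral>\<^sup>+z. ennreal ((norm (v z))\<^sup>2) \<partial>gauss_measure a) \<le> ennreal (C\<^sup>2)"
    by (simp add: Liminf_const)
  then show v: "square_integrable a v"
    unfolding square_integrable_def by (auto intro!: integrableI_bounded le_less_trans[OF le])
  have "(L2_norm a v)\<^sup>2 \<le> C\<^sup>2"
    using le C0 unfolding ennreal_L2_norm_square[OF v, symmetric] by (simp add: ennreal_le_iff)
  then show "L2_norm a v \<le> C" using C0 by (rule power2_le_imp_le)
qed

abbreviation (input) sc :: "complex \<Rightarrow> ('a \<Rightarrow> complex) \<Rightarrow> 'a \<Rightarrow> complex" where
  "sc c f \<equiv> (\<lambda>z. c * f z)"

text \<open>An abstraction covering both spaces. The constant 1 in \<open>H\<close> yields
  sigma-finiteness of measures with bounded form, and \<open>montel\<close> is the source of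
  completeness as well as compactness. The base point is the first argument of the kernel, so that
  \<open>K w\<close> is an element of \<open>H\<close>.\<close>

locale rkhs =
  fixes a :: real and H :: "(complex^'n \<Rightarrow> complex) set" and K :: "complex^'n \<Rightarrow> complex^'n \<Rightarrow> complex"
  assumes pos: "a > 0"
    and H_add: "\<And>f g. f \<in> H \<Longrightarrow> g \<in> H \<Longrightarrow> f + g \<in> H"
    and H_sc: "\<And>c f. f \<in> H \<Longrightarrow> sc c f \<in> H"
    and one: "(\<lambda>z. 1) \<in> H"
    and sqi: "\<And>f. f \<in> H \<Longrightarrow> square_integrable a f"
    and kernel_mem: "\<And>w. K w \<in> H"
    and repro: "\<And>f w. f \<in> H \<Longrightarrow> L2_inner a f (K w) = f w"
    and kernel_measurable: "(\<lambda>(w, z). K w z) \<in> borel_measurable (borel \<Otimes>\<^sub>M borel)"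
    and montel: "\<And>x C. (\<And>k. x k \<in> H) \<Longrightarrow> (\<And>k::nat. L2_norm a (x k) \<le> C) \<Longrightarrow>
        \<exists>y\<in>H. \<exists>r. strict_mono r \<and> (\<forall>z. (\<lambda>k. x (r k) z) \<longlonglongrightarrow> y z)"
begin

abbreviation ip where "ip \<equiv> L2_inner a"
abbreviation nm where "nm \<equiv> L2_norm a"

lemma H_measurable: "f \<in> H \<Longrightarrow> f \<in> borel_measurable borel"
  using sqi by (auto simp: square_integrable_def)

lemma H_minus: "f \<in> H \<Longrightarrow> - f \<in> H"
  using H_sc[of f "-1"] by (simp add: fun_Compl_def)

lemma H_diff: "f \<in> H \<Longrightarrow> g \<in> H \<Longrightarrow> f - g \<in> H"
  using H_add[OF _ H_minus, of f g] by simp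

lemma H_zero: "0 \<in> H"
  using H_sc[OF one, of 0] by (simp add: zero_fun_def)

lemma H_sum: "(\<And>i. i \<in> I \<Longrightarrow> f i \<in> H) \<Longrightarrow> sum f I \<in> H"
  by (induction I rule: infinite_finite_induct) (auto intro: H_zero H_add)

lemmas H_intros = H_add H_sc H_minus H_diff H_zero H_sum kernel_mem

lemma ip_add_left: "f \<in> H \<Longrightarrow> g \<in> H \<Longrightarrow> h \<in> H \<Longrightarrow> ip (f + g) h = ip f h + ip g h"
  unfolding L2_inner_def
  by (subst Bochner_Integration.integral_add[symmetric]) (auto intro!: integrable_inner_product sqi simp: algebra_simps)

lemma ip_sc_left: "ip (sc c f) h = c * ip f h"
  unfolding L2_inner_def by (simp add: mult.assoc)

lemma ip_sc_right: "ip h (sc c f) = cnj c * ip h f"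
  by (subst (1 2) L2_inner_cnj[symmetric]) (simp add: ip_sc_left)

lemma ip_minus_left: "ip (- f) h = - ip f h"
  using ip_sc_left[of "-1" f h] by (simp add: fun_Compl_def)

lemma ip_diff_left: "f \<in> H \<Longrightarrow> g \<in> H \<Longrightarrow> h \<in> H \<Longrightarrow> ip (f - g) h = ip f h - ip g h"
  using ip_add_left[of f "- g" h] by (simp add: H_minus ip_minus_left)

lemma ip_zero_left [simp]: "ip 0 h = 0"
  by (simp add: L2_inner_def)

lemma ip_zero_right [simp]: "ip h 0 = 0"
  by (simp add: L2_inner_def)

lemma ip_sum_left: "(\<And>i. i \<in> I \<Longrightarrow> f i \<in> H) \<Longrightarrow> h \<in> H \<Longrightarrow> ip (sum f I) h = (\<Sum>i\<in>I. ip (f i) h)"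
  by (induction I rule: infinite_finite_induct) (auto simp: ip_add_left H_sum)

text \<open>One notion for the inner product, the form of \<mu> and \<open>ip (T f) g\<close>, so
  that a single Cauchy-Schwarz inequality serves all three. Degenerate forms are allowed, because
  the form of a measure may vanish on nonzero functions.\<close>

definition pos_form :: "((complex^'n \<Rightarrow> complex) \<Rightarrow> (complex^'n \<Rightarrow> complex) \<Rightarrow> complex) \<Rightarrow> bool" where
  "pos_form B \<longleftrightarrow>
    (\<forall>f\<in>H. \<forall>g\<in>H. \<forall>h\<in>H. B (f + g) h = B f h + B g h) \<and>
    (\<forall>c. \<forall>f\<in>H. \<forall>h\<in>H. B (sc c f) h = c * B f h) \<and>
    (\<forall>f\<in>H. \<forall>g\<in>H. B g f = cnj (B f g)) \<and> (\<forall>f\<in>H. 0 \<le> Re (B f f))"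

lemma pos_form_ip: "pos_form ip"
  by (auto simp: pos_form_def ip_add_left ip_sc_left L2_inner_cnj) (simp add: L2_inner_self)

lemma pos_form_rules:
  assumes "pos_form B" "f \<in> H" "g \<in> H" "h \<in> H"
  shows "B (f + g) h = B f h + B g h" "B (sc c f) h = c * B f h" "B g f = cnj (B f g)" "0 \<le> Re (B f f)"
    "B h (f + g) = B h f + B h g" "B h (sc c f) = cnj c * B h f" "B f f = of_real (Re (B f f))"
proof -
  show 1: "B (f + g) h = B f h + B g h" "B (sc c f) h = c * B f h" "B g f = cnj (B f g)" "0 \<le> Re (B f f)"
    using assms unfolding pos_form_def by blast+
  have herm: "B h f = cnj (B f h)" if "f \<in> H" for f
    using assms that unfolding pos_form_def by blast
  have "B h (f + g) = cnj (B (f + g) h)" "B h (sc c f) = cnj (B (sc c f) h)"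
    using assms by (intro herm H_intros; simp)+
  then show "B h (f + g) = B h f + B h g" "B h (sc c f) = cnj c * B h f"
    by (simp_all add: 1 herm[OF assms(2)] herm[OF assms(3)])
  have "cnj (B f f) = B f f" using assms unfolding pos_form_def by metis
  then show "B f f = of_real (Re (B f f))"
    by (metis Reals_cnj_iff of_real_Re)
qed

lemma pos_form_expand:
  assumes B: "pos_form B" and f: "f \<in> H" and g: "g \<in> H"
  shows "Re (B (f + sc c g) (f + sc c g)) = Re (B f f) + 2 * Re (cnj c * B f g) + (norm c)\<^sup>2 * Re (B g g)"
proof -
  have cg: "sc c g \<in> H" by (intro H_intros g)
  have "B (f + sc c g) (f + sc c g) = B f f + cnj c * B f g + c * B g f + c * cnj c * B g g"
    using f g cg by (simp add: pos_form_rules(1,2,5,6)[OF B] H_intros algebra_simps)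
  also have "c * B g f = cnj (cnj c * B f g)" using pos_form_rules(3)[OF B f g f] by simp
  also have "c * cnj c * B g g = of_real ((norm c)\<^sup>2 * Re (B g g))"
    by (subst pos_form_rules(7)[OF B g g g], subst complex_norm_square[symmetric]) simp
  finally have eq: "B (f + sc c g) (f + sc c g) = B f f + cnj c * B f g + cnj (cnj c * B f g) +
    of_real ((norm c)\<^sup>2 * Re (B g g))" .
  show ?thesis unfolding eq by simp
qed

text \<open>Positivity at f - t B(f,g) g for real t. If B(g,g) = 0, a large t forces B(f,g) = 0;
  otherwise t = 1/B(g,g) is optimal.\<close>

lemma pos_form_CS:
  assumes B: "pos_form B" and f: "f \<in> H" and g: "g \<in> H"
  shows "(norm (B f g))\<^sup>2 \<le> Re (B f f) * Re (B g g)"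
proof -
  let ?b = "B f g"
  have key: "0 \<le> Re (B f f) - 2 * t * (norm ?b)\<^sup>2 + t\<^sup>2 * (norm ?b)\<^sup>2 * Re (B g g)" for t
  proof -
    have "0 \<le> Re (B (f + sc (- of_real t * ?b) g) (f + sc (- of_real t * ?b) g))"
      using f g by (intro pos_form_rules(4)[OF B] H_intros)
    also have "\<dots> = Re (B f f) + 2 * Re (cnj (- of_real t * ?b) * ?b) + (norm (- of_real t * ?b))\<^sup>2 * Re (B g g)"
      by (rule pos_form_expand[OF B f g])
    also have "cnj (- of_real t * ?b) * ?b = of_real (- t * (norm ?b)\<^sup>2)"
      by (simp add: complex_norm_square[symmetric] mult.commute[of "cnj _"] del: of_real_power)
    also have "(norm (- of_real t * ?b))\<^sup>2 = t\<^sup>2 * (norm ?b)\<^sup>2"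
      by (simp add: norm_mult power_mult_distrib)
    finally show ?thesis by simp
  qed
  show ?thesis
  proof (cases "Re (B g g) = 0")
    case True
    have "(norm ?b)\<^sup>2 = 0"
    proof (rule ccontr)
      assume nz: "(norm ?b)\<^sup>2 \<noteq> 0"
      show False using key[of "(Re (B f f) + 1) / (2 * (norm ?b)\<^sup>2)"] nz True by simp
    qed
    then show ?thesis using True by simp
  next
    case False
    then have "Re (B g g) > 0" using pos_form_rules(4)[OF B g g g] by simp
    then show ?thesis using key[of "1 / Re (B g g)"]
      by (simp add: field_simps power2_eq_square)
  qed
qed

section \<open>Norm, completeness and Riesz representation in H\<close>

lemma nm_square: "(nm f)\<^sup>2 = Re (ip f f)"
  by (simp add: L2_inner_self)

lemma ip_CS: "f \<in> H \<Longrightarrow> g \<in> H \<Longrightarrow> norm (ip f g) \<le> nm f * nm g"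
proof -
  assume "f \<in> H" "g \<in> H"
  then have "(norm (ip f g))\<^sup>2 \<le> (nm f * nm g)\<^sup>2"
    using pos_form_CS[OF pos_form_ip] by (simp add: power_mult_distrib nm_square)
  then show ?thesis by (rule power2_le_imp_le) auto
qed

lemma eval_bound: "f \<in> H \<Longrightarrow> norm (f z) \<le> nm f * nm (K z)"
  using ip_CS[OF _ kernel_mem, of f z] by (simp add: repro)

lemma nm_zero_imp: "f \<in> H \<Longrightarrow> nm f = 0 \<Longrightarrow> f = 0"
  using eval_bound[of f] by (auto simp: fun_eq_iff)

lemma nm_zero [simp]: "nm 0 = 0"
  by (simp add: L2_norm_def)

lemma nm_sc: "nm (sc c f) = norm c * nm f"
proof -
  have "ip (sc c f) (sc c f) = (c * cnj c) * ip f f"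
    by (simp add: ip_sc_left ip_sc_right)
  then have "(nm (sc c f))\<^sup>2 = (norm c * nm f)\<^sup>2"
    unfolding nm_square power_mult_distrib complex_norm_square[symmetric] by simp
  then show ?thesis by (simp add: power2_eq_iff_nonneg)
qed

lemma nm_minus: "nm (- f) = nm f"
  using nm_sc[of "-1" f] by (simp add: fun_Compl_def)

lemma nm_minus_commute: "nm (f - g) = nm (g - f)"
  using nm_minus[of "f - g"] by simp

lemma nm_triangle: "f \<in> H \<Longrightarrow> g \<in> H \<Longrightarrow> nm (f + g) \<le> nm f + nm g"
proof -
  assume f: "f \<in> H" and g: "g \<in> H"
  have "(nm (f + g))\<^sup>2 = (nm f)\<^sup>2 + 2 * Re (ip f g) + (nm g)\<^sup>2"
    using pos_form_expand[OF pos_form_ip f g, of 1] by (simp add: nm_square)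
  also have "\<dots> \<le> (nm f)\<^sup>2 + 2 * (nm f * nm g) + (nm g)\<^sup>2"
    using ip_CS[OF f g] complex_Re_le_cmod[of "ip f g"] by simp
  also have "\<dots> = (nm f + nm g)\<^sup>2" by (simp add: power2_eq_square algebra_simps)
  finally show ?thesis by (rule power2_le_imp_le) auto
qed

lemma nm_triangle3: "f \<in> H \<Longrightarrow> g \<in> H \<Longrightarrow> h \<in> H \<Longrightarrow> nm (f - h) \<le> nm (f - g) + nm (g - h)"
  using nm_triangle[of "f - g" "g - h"] by (simp add: H_diff)

lemma nm_diff_abs: "f \<in> H \<Longrightarrow> g \<in> H \<Longrightarrow> \<bar>nm f - nm g\<bar> \<le> nm (f - g)"
  using nm_triangle[of "f - g" g] nm_triangle[of "g - f" f] nm_minus_commute[of f g] by (auto simp: H_diff)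

lemma nm_limit_unique:
  assumes "\<And>k. x k \<in> H" "y \<in> H" "y' \<in> H" "(\<lambda>k. nm (x k - y)) \<longlonglongrightarrow> 0" "(\<lambda>k. nm (x k - y')) \<longlonglongrightarrow> 0"
  shows "y = y'"
proof -
  have "(\<lambda>k. nm (x k - y) + nm (x k - y')) \<longlonglongrightarrow> 0 + 0" by (intro tendsto_intros assms)
  moreover have "nm (y - y') \<le> nm (x k - y) + nm (x k - y')" for k
    using nm_triangle3[of y "x k" y'] assms by (simp add: nm_minus_commute[of y])
  ultimately have "nm (y - y') \<le> 0" by (intro LIMSEQ_le_const[where X = "\<lambda>k. nm (x k - y) + nm (x k - y')"]) auto
  then have "y - y' = 0" using assms by (intro nm_zero_imp H_diff antisym) auto
  then show ?thesis by simp
qed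

lemma nm_limit_nm:
  assumes "\<And>k. x k \<in> H" "y \<in> H" "(\<lambda>k. nm (x k - y)) \<longlonglongrightarrow> 0"
  shows "(\<lambda>k. nm (x k)) \<longlonglongrightarrow> nm y"
proof -
  have "(\<lambda>k. nm (x k) - nm y) \<longlonglongrightarrow> 0"
    by (rule Lim_null_comparison[OF always_eventually assms(3)]) (use nm_diff_abs assms in auto)
  then show ?thesis by (simp add: LIM_zero_iff)
qed

text \<open>Montel yields a pointwise limit of a subsequence; Fatou, applied to \<open>x k\<close>
  minus later terms of that subsequence, turns the Cauchy bound into a norm bound against the
  limit.\<close>

lemma complete:
  assumes x: "\<And>k. x k \<in> H" and cau: "\<And>e. e > 0 \<Longrightarrow> \<exists>N. \<forall>j\<ge>N. \<forall>k\<ge>N. nm (x j - x k) \<le> e"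
  shows "\<exists>y\<in>H. (\<lambda>k. nm (x k - y)) \<longlonglongrightarrow> 0"
proof -
  obtain N where N: "\<And>j k. j \<ge> N \<Longrightarrow> k \<ge> N \<Longrightarrow> nm (x j - x k) \<le> 1" using cau[of 1] by auto
  have "nm (x (k + N)) \<le> nm (x N) + 1" for k
    using nm_diff_abs[OF x x, of "k + N" N] N[of "k + N" N] by auto
  \<comment> \<open>Shifted by N, since only the tail is bounded by
    \<open>nm (x N) + 1\<close>.\<close>
  from montel[of "\<lambda>k. x (k + N)", OF x this]
  obtain y r where y: "y \<in> H" and r: "strict_mono r" and lim: "\<And>z. (\<lambda>k. x (r k + N) z) \<longlonglongrightarrow> y z" by auto
  have "(\<lambda>k. nm (x k - y)) \<longlonglongrightarrow> 0"
  proof (rule LIMSEQ_I)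
    fix e :: real assume "e > 0"
    then obtain M where M: "\<And>j k. j \<ge> M \<Longrightarrow> k \<ge> M \<Longrightarrow> nm (x j - x k) \<le> e / 2" using cau[of "e/2"] by auto
    have "nm (x k - y) \<le> e / 2" if k: "k \<ge> M" for k
    proof (rule L2_norm_fatou(2)[where u = "\<lambda>m. x k - x (r (m + M) + N)"])
      show "square_integrable a (x k - x (r (m + M) + N))" for m by (intro sqi H_diff x)
      show "(\<lambda>m. (x k - x (r (m + M) + N)) z) \<longlonglongrightarrow> (x k - y) z" for z
        using LIMSEQ_ignore_initial_segment[OF lim[of z], of M] by (auto intro!: tendsto_intros)
      have "r (m + M) + N \<ge> M" for m using seq_suble[OF r, of "m + M"] by linarith
      then show "nm (x k - x (r (m + M) + N)) \<le> e / 2" for m using M k by auto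
    qed
    then show "\<exists>no. \<forall>n\<ge>no. norm (nm (x n - y) - 0) < e"
      using \<open>e > 0\<close> by (intro exI[of _ M]) force
  qed
  then show ?thesis using y by blast
qed

text \<open>The representing vector minimises \<open>\<parallel>g\<parallel>\<^sup>2 - 2 Re \<phi>(g)\<close>.\<close>

lemma riesz:
  assumes add: "\<And>f g. f \<in> H \<Longrightarrow> g \<in> H \<Longrightarrow> \<phi> (f + g) = \<phi> f + \<phi> g"
    and scal: "\<And>c f. f \<in> H \<Longrightarrow> \<phi> (sc c f) = c * \<phi> f"
    and bound: "\<And>f. f \<in> H \<Longrightarrow> norm (\<phi> f) \<le> C * nm f"
  shows "\<exists>h\<in>H. \<forall>g\<in>H. ip g h = \<phi> g"
proof -
  define E where "E g = (nm g)\<^sup>2 - 2 * Re (\<phi> g)" for g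
  have low: "- C\<^sup>2 \<le> E g" if "g \<in> H" for g
  proof -
    have "E g \<ge> (nm g)\<^sup>2 - 2 * (C * nm g)"
      using bound[OF that] complex_Re_le_cmod[of "\<phi> g"] by (simp add: E_def)
    moreover have "(nm g)\<^sup>2 - 2 * (C * nm g) \<ge> - C\<^sup>2"
      using zero_le_power2[of "nm g - C"] by (simp add: power2_eq_square algebra_simps)
    ultimately show ?thesis by linarith
  qed
  define m where "m = Inf (E ` H)"
  have bb: "bdd_below (E ` H)" using low by (intro bdd_belowI2) auto
  have m_le: "m \<le> E g" if "g \<in> H" for g
    unfolding m_def using that bb by (intro cInf_lower) auto
  have "\<exists>g\<in>H. E g < m + 1 / real (Suc k)" for k
  proof -
    have "m < m + 1 / real (Suc k)" by simp
    then show ?thesis unfolding m_def using cInf_lessD[of "E ` H"] H_zero by fastforce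
  qed
  then obtain x where x: "\<And>k. x k \<in> H" and xE: "\<And>k. E (x k) < m + 1 / real (Suc k)" by metis
  \<comment> \<open>Parallelogram identity: the midpoint of two near-minimisers cannot lie below the
    infimum m, so they are close to each other. Hence the minimising sequence is Cauchy.\<close>
  have par: "(nm (x j - x k))\<^sup>2 \<le> 2 / real (Suc j) + 2 / real (Suc k)" for j k
  proof -
    let ?s = "sc (1/2) (x j + x k)"
    have s: "?s \<in> H" by (intro H_intros x)
    have d: "(nm (x j - x k))\<^sup>2 = (nm (x j))\<^sup>2 - 2 * Re (ip (x j) (x k)) + (nm (x k))\<^sup>2"
    proof -
      have eq: "x j - x k = x j + sc (- 1) (x k)" by (auto simp: fun_eq_iff)
      show ?thesis unfolding nm_square eq using pos_form_expand[OF pos_form_ip x[of j] x[of k], of "-1"] by simp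
    qed
    have p: "(nm (x j + x k))\<^sup>2 = (nm (x j))\<^sup>2 + 2 * Re (ip (x j) (x k)) + (nm (x k))\<^sup>2"
      using pos_form_expand[OF pos_form_ip x[of j] x[of k], of 1] by (simp add: nm_square)
    have "4 * E ?s = (nm (x j + x k))\<^sup>2 - 4 * Re (\<phi> (x j) + \<phi> (x k))"
    proof -
      have "nm ?s = nm (x j + x k) / 2"
        using nm_sc[of "1/2" "x j + x k"] by simp
      moreover have "Re (\<phi> ?s) = Re (\<phi> (x j) + \<phi> (x k)) / 2"
        unfolding scal[OF H_add[OF x x]] add[OF x x] by simp
      moreover have "4 * (P\<^sup>2 - 2 * Q) = S\<^sup>2 - 4 * R" if "P = S / 2" "Q = R / 2" for P Q R S :: real
        unfolding that by (simp add: power2_eq_square)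
      ultimately show ?thesis unfolding E_def by blast
    qed
    then have "(nm (x j - x k))\<^sup>2 = 2 * E (x j) + 2 * E (x k) - 4 * E ?s"
      unfolding d p by (simp add: E_def)
    then show ?thesis using xE[of j] xE[of k] m_le[OF s] by simp
  qed
  have "\<exists>h\<in>H. (\<lambda>k. nm (x k - h)) \<longlonglongrightarrow> 0"
  proof (rule complete[OF x])
    fix e :: real assume e: "e > 0"
    obtain N where N: "1 / real (Suc N) < e\<^sup>2 / 4"
      using nat_approx_posE[of "e\<^sup>2/4"] e by auto
    show "\<exists>N. \<forall>j\<ge>N. \<forall>k\<ge>N. nm (x j - x k) \<le> e"
    proof (intro exI[of _ N] allI impI)
      fix j k assume jk: "j \<ge> N" "k \<ge> N"
      have "1 / real (Suc j) \<le> 1 / real (Suc N)" "1 / real (Suc k) \<le> 1 / real (Suc N)"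
        using jk by (auto simp: frac_le)
      then have "(nm (x j - x k))\<^sup>2 \<le> e\<^sup>2" using par[of j k] N by simp
      then show "nm (x j - x k) \<le> e" by (rule power2_le_imp_le) (use e in simp)
    qed
  qed
  then obtain h where h: "h \<in> H" and lim: "(\<lambda>k. nm (x k - h)) \<longlonglongrightarrow> 0" by blast
  have "(\<lambda>k. \<phi> (x k) - \<phi> h) \<longlonglongrightarrow> 0"
  proof (rule Lim_null_comparison[OF always_eventually])
    show "\<forall>k. norm (\<phi> (x k) - \<phi> h) \<le> C * nm (x k - h)"
    proof
      fix k
      have "\<phi> (x k) = \<phi> (x k - h) + \<phi> h" using add[of "x k - h" h] x h by (simp add: H_diff)
      then show "norm (\<phi> (x k) - \<phi> h) \<le> C * nm (x k - h)" using bound[of "x k - h"] x h by (simp add: H_diff)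
    qed
    show "(\<lambda>k. C * nm (x k - h)) \<longlonglongrightarrow> 0" using tendsto_mult_right_zero[OF lim] by simp
  qed
  then have "(\<lambda>k. \<phi> (x k)) \<longlonglongrightarrow> \<phi> h" by (simp add: LIM_zero_iff)
  then have "(\<lambda>k. E (x k)) \<longlonglongrightarrow> E h"
    unfolding E_def by (intro tendsto_intros nm_limit_nm x h lim)
  moreover have "(\<lambda>k. m + 1 / real (Suc k)) \<longlonglongrightarrow> m + 0"
    by (intro tendsto_intros LIMSEQ_Suc[OF lim_1_over_n])
  ultimately have "E h \<le> m + 0" by (rule LIMSEQ_le) (use xE less_imp_le in blast)
  then have min: "E h \<le> E g" if "g \<in> H" for g using m_le[OF that] by simp
  have Re_eq: "Re (ip g h) = Re (\<phi> g)" if g: "g \<in> H" for g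
  proof -
    have "0 \<le> t\<^sup>2 * (nm g)\<^sup>2 + 2 * t * (Re (ip g h) - Re (\<phi> g))" for t
    proof -
      have "Re (ip h g) = Re (ip g h)" using L2_inner_cnj[of a g h] by (metis complex_cnj(1) cnj.sel(1))
      then have "E (h + sc (of_real t) g) = E h + (t\<^sup>2 * (nm g)\<^sup>2 + 2 * t * (Re (ip g h) - Re (\<phi> g)))"
        using pos_form_expand[OF pos_form_ip h g, of "of_real t"] g h
        by (simp add: E_def nm_square add scal H_sc algebra_simps)
      then show ?thesis using min[of "h + sc (of_real t) g"] g h by (simp add: H_intros)
    qed
    then have "Re (ip g h) - Re (\<phi> g) = 0" by (rule quadratic_nonneg_imp_zero)
    then show ?thesis by simp
  qed
  \<comment> \<open>The imaginary part is the real part at i g, up to sign.\<close>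
  have "ip g h = \<phi> g" if g: "g \<in> H" for g
    using Re_eq[OF g] Re_eq[OF H_sc[OF g, of \<i>]] g by (simp add: ip_sc_left scal complex_eq_iff)
  then show ?thesis using h by blast
qed

end

text \<open>At the first index k where the sequences differ, say s(k) > t(k), every j with t(j) =
  s(k) precedes k, where both agree; so t takes this value strictly less often. Convergence to 0
  keeps the index set finite, which matters because \<open>card\<close> of an infinite set is 0.
  This is the uniqueness behind \<open>singular_values\<close>.\<close>

lemma decseq_eq_if_multiplicities_eq:
  fixes s t :: "nat \<Rightarrow> real"
  assumes s: "decseq s" "s \<longlonglongrightarrow> 0" and t: "decseq t" "t \<longlonglongrightarrow> 0"
    and card: "\<And>\<sigma>. \<sigma> > 0 \<Longrightarrow> card {k. s k = \<sigma>} = card {k. t k = \<sigma>}"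
  shows "s = t"
proof -
  have less: False if s: "decseq s" "s \<longlonglongrightarrow> 0" and t: "decseq t" "t \<longlonglongrightarrow> 0"
    and card: "\<And>\<sigma>. \<sigma> > 0 \<Longrightarrow> card {k. s k = \<sigma>} = card {k. t k = \<sigma>}"
    and IH: "\<And>j. j < k \<Longrightarrow> s j = t j" and lt: "s k > t k" for s t :: "nat \<Rightarrow> real" and k
  proof -
    have "t k \<ge> 0" using decseq_ge[OF t] .
    then have pos: "s k > 0" using lt by simp
    have "\<forall>\<^sub>F j in sequentially. s j < s k" using order_tendstoD(2)[OF s(2) pos] .
    then obtain N where "\<And>j. j \<ge> N \<Longrightarrow> s j < s k" by (auto simp: eventually_sequentially)
    then have "{j. s j = s k} \<subseteq> {..<N}" by (force simp: not_less[symmetric])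
    then have fin: "finite {j. s j = s k}" by (rule finite_subset) simp
    have "j < k" if "t j = s k" for j
      by (rule ccontr) (use decseqD[OF t(1), of k j] that lt in auto)
    then have "{j. t j = s k} \<subseteq> {j. s j = s k}" using IH by auto
    moreover have "k \<in> {j. s j = s k}" "k \<notin> {j. t j = s k}" using lt by auto
    ultimately have "{j. t j = s k} \<subset> {j. s j = s k}" by blast
    then have "card {j. t j = s k} < card {j. s j = s k}" by (rule psubset_card_mono[OF fin])
    then show False using card[OF pos] by simp
  qed
  have "s k = t k" for k
  proof (induction k rule: less_induct)
    case IH: (less k)
    show ?case
    proof (rule ccontr)
      assume "s k \<noteq> t k"
      then consider "s k > t k" | "t k > s k" by linarith
      then show False
        using less[OF s t card IH] less[OF t s card[symmetric] IH[symmetric]] by cases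
    qed
  qed
  then show ?thesis by blast
qed

context rkhs
begin

lemma bounded_operatorD:
  assumes "bounded_operator a H T"
  shows "f \<in> H \<Longrightarrow> T f \<in> H" "f \<in> H \<Longrightarrow> g \<in> H \<Longrightarrow> T (f + g) = T f + T g"
    "f \<in> H \<Longrightarrow> T (sc c f) = sc c (T f)"
  using assms by (auto simp: bounded_operator_def)

lemma bounded_operator_bound:
  assumes "bounded_operator a H T"
  obtains C where "C \<ge> 0" "\<And>f. f \<in> H \<Longrightarrow> nm (T f) \<le> C * nm f"
proof -
  have "\<exists>C. \<forall>f\<in>H. nm (T f) \<le> C * nm f" using assms by (simp add: bounded_operator_def)
  then obtain C where C: "\<And>f. f \<in> H \<Longrightarrow> nm (T f) \<le> C * nm f" by blast
  have "nm (T f) \<le> \<bar>C\<bar> * nm f" if "f \<in> H" for f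
    using C[OF that] mult_right_mono[OF abs_ge_self[of C] L2_norm_nonneg[of a f]] by linarith
  then show ?thesis using that[of "\<bar>C\<bar>"] by simp
qed

lemma operator_diff:
  assumes T: "bounded_operator a H T" and "f \<in> H" "g \<in> H"
  shows "T (f - g) = T f - T g"
proof -
  have "T f = T (f - g) + T g"
    using bounded_operatorD(2)[OF T, of "f - g" g] assms by (simp add: H_diff)
  then show ?thesis by simp
qed

lemma operator_zero: "bounded_operator a H T \<Longrightarrow> T 0 = 0"
  using operator_diff[of T 0 0] H_zero by simp

lemma operator_sum:
  assumes T: "bounded_operator a H T" and "\<And>i. i \<in> I \<Longrightarrow> f i \<in> H"
  shows "T (sum f I) = (\<Sum>i\<in>I. T (f i))"
  using assms(2)
proof (induction I rule: infinite_finite_induct)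
  case (insert i I)
  then have "T (f i + sum f I) = T (f i) + T (sum f I)"
    by (intro bounded_operatorD(2)[OF T] H_sum) auto
  moreover have "T (sum f I) = (\<Sum>i\<in>I. T (f i))" using insert by simp
  ultimately show ?case by (simp only: sum.insert[OF insert(1,2)])
qed (simp_all add: operator_zero[OF T])

subsection \<open>Toeplitz operators\<close>

context
  fixes \<mu> :: "(complex^'n) measure"
  assumes sets_mu: "sets \<mu> = sets borel"
begin

lemma space_mu: "space \<mu> = UNIV"
  using sets_eq_imp_space_eq[OF sets_mu] by simp

lemma pos_form_q:
  assumes "q_bounded a \<mu> H"
  shows "pos_form (q_form a \<mu>)"
proof -
  have int: "integrable \<mu> (\<lambda>z. f z * cnj (g z) * of_real (exp (- (norm z)\<^sup>2 / a)))" if "f \<in> H" "g \<in> H" for f g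
    using assms that unfolding q_bounded_def by blast
  show ?thesis unfolding pos_form_def
  proof (intro conjI ballI allI)
    fix f g h assume H: "f \<in> H" "g \<in> H" "h \<in> H"
    show "q_form a \<mu> (f + g) h = q_form a \<mu> f h + q_form a \<mu> g h"
      unfolding q_form_def Bochner_Integration.integral_add[OF int[OF H(1,3)] int[OF H(2,3)], symmetric]
      by (simp add: distrib_right)
  next
    show "q_form a \<mu> (sc c f) h = c * q_form a \<mu> f h" for c f h
      unfolding q_form_def by (simp add: mult.assoc)
  next
    show "q_form a \<mu> g f = cnj (q_form a \<mu> f g)" for f g
      unfolding q_form_def
      by (subst Bochner_Integration.integral_cnj[symmetric]) (simp add: mult.commute)
  next
    fix f
    have "q_form a \<mu> f f = (\<integral>z. of_real ((norm (f z))\<^sup>2 * exp (- (norm z)\<^sup>2 / a)) \<partial>\<mu>)"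
      unfolding q_form_def by (simp only: complex_norm_square of_real_mult)
    also have "\<dots> = of_real (\<integral>z. (norm (f z))\<^sup>2 * exp (- (norm z)\<^sup>2 / a) \<partial>\<mu>)"
      by (rule integral_complex_of_real)
    finally show "0 \<le> Re (q_form a \<mu> f f)" by simp
  qed
qed

text \<open>Passes from the Bochner integral to an integral in [0, infinity], the form in which
  Tonelli can be applied to the kernel.\<close>

lemma Re_q_form_self:
  assumes "q_bounded a \<mu> H" "f \<in> H"
  shows "ennreal (Re (q_form a \<mu> f f)) = (\<integral>\<^sup>+z. ennreal ((norm (f z))\<^sup>2) * ennreal (exp (- (norm z)\<^sup>2 / a)) \<partial>\<mu>)"
proof -
  have eq: "f z * cnj (f z) * of_real (exp (- (norm z)\<^sup>2 / a)) = of_real ((norm (f z))\<^sup>2 * exp (- (norm z)\<^sup>2 / a))" for z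
    by (simp only: complex_norm_square of_real_mult)
  have "integrable \<mu> (\<lambda>z. complex_of_real ((norm (f z))\<^sup>2 * exp (- (norm z)\<^sup>2 / a)))"
    using assms unfolding q_bounded_def eq[symmetric] by blast
  then have "integrable \<mu> (\<lambda>z. (norm (f z))\<^sup>2 * exp (- (norm z)\<^sup>2 / a))"
    by (simp only: complex_of_real_integrable_eq)
  then have "(\<integral>\<^sup>+z. ennreal ((norm (f z))\<^sup>2 * exp (- (norm z)\<^sup>2 / a)) \<partial>\<mu>) =
      ennreal (\<integral>z. (norm (f z))\<^sup>2 * exp (- (norm z)\<^sup>2 / a) \<partial>\<mu>)"
    by (intro nn_integral_eq_integral) auto
  also have "(\<integral>z. (norm (f z))\<^sup>2 * exp (- (norm z)\<^sup>2 / a) \<partial>\<mu>) = Re (q_form a \<mu> f f)"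
    unfolding q_form_def eq by (subst integral_complex_of_real) simp
  finally show ?thesis by (simp add: ennreal_mult)
qed

text \<open>Existence comes from the Riesz representation, uniqueness from testing against kernel
  functions; together they resolve the description in \<open>toeplitz\<close>.\<close>

lemma toeplitz_properties:
  assumes q: "q_bounded a \<mu> H"
  defines "T \<equiv> toeplitz a \<mu> H"
  shows "bounded_operator a H T" "f \<in> H \<Longrightarrow> g \<in> H \<Longrightarrow> ip (T f) g = q_form a \<mu> f g"
proof -
  note B = pos_form_rules[OF pos_form_q[OF q]]
  obtain C0 where C0: "\<And>f g. f \<in> H \<Longrightarrow> g \<in> H \<Longrightarrow> norm (q_form a \<mu> f g) \<le> C0 * nm f * nm g"
    using q unfolding q_bounded_def by blast
  \<comment> \<open>Riesz applies to functionals linear in g, hence to q(g, f); conjugation then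
    gives the vector representing q(f, g).\<close>
  have "\<exists>h\<in>H. \<forall>g\<in>H. ip g h = q_form a \<mu> g f" if f: "f \<in> H" for f
  proof (rule riesz[where C = "C0 * nm f"])
    show "norm (q_form a \<mu> g f) \<le> C0 * nm f * nm g" if "g \<in> H" for g
      using C0[OF that f] by (simp add: mult_ac)
  qed (use f B(1,2) in auto)
  then have "\<exists>h\<in>H. \<forall>g\<in>H. ip h g = q_form a \<mu> f g" if f: "f \<in> H" for f
    using f B(3) L2_inner_cnj by metis
  then obtain S0 where S0: "\<And>f. f \<in> H \<Longrightarrow> S0 f \<in> H" "\<And>f g. f \<in> H \<Longrightarrow> g \<in> H \<Longrightarrow> ip (S0 f) g = q_form a \<mu> f g"
    by metis
  have uniq: "h = h'" if "h \<in> H" "h' \<in> H" "\<And>g. g \<in> H \<Longrightarrow> ip h g = ip h' g" for h h'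
  proof
    fix z show "h z = h' z" using that(3)[OF kernel_mem[of z]] that by (simp add: repro)
  qed
  define S where "S = restrict S0 H"
  have S: "f \<in> H \<Longrightarrow> S f \<in> H" "f \<in> H \<Longrightarrow> g \<in> H \<Longrightarrow> ip (S f) g = q_form a \<mu> f g" for f g
    using S0 by (auto simp: S_def)
  have bS: "bounded_operator a H S"
    unfolding bounded_operator_def
  proof (intro conjI ballI allI)
    show "S f \<in> H" if "f \<in> H" for f using S that by blast
    show "S (f + g) = S f + S g" if "f \<in> H" "g \<in> H" for f g
      by (rule uniq) (use that S B(1) in \<open>auto simp: H_intros ip_add_left\<close>)
    show "S (sc c f) = sc c (S f)" if "f \<in> H" for f c
      by (rule uniq) (use that S B(2) in \<open>auto simp: H_intros ip_sc_left\<close>)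
    show "\<exists>C. \<forall>f\<in>H. nm (S f) \<le> C * nm f"
    proof (intro exI ballI)
      fix f assume f: "f \<in> H"
      \<comment> \<open>Testing against \<open>S f\<close> itself bounds its norm.\<close>
      have "q_form a \<mu> f (S f) = of_real ((nm (S f))\<^sup>2)"
        using S(2)[OF f S(1)[OF f]] L2_inner_self by metis
      then have "(nm (S f))\<^sup>2 = norm (q_form a \<mu> f (S f))"
        by (simp only: norm_of_real abs_power2)
      also have "\<dots> \<le> (C0 * nm f) * nm (S f)" by (intro C0 f S)
      finally have "nm (S f) * nm (S f) \<le> (C0 * nm f) * nm (S f)" by (simp add: power2_eq_square)
      moreover have "(C0 * nm f) * nm (S f) \<le> (\<bar>C0\<bar> * nm f) * nm (S f)"
        by (intro mult_right_mono) auto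
      ultimately have "nm (S f) * nm (S f) \<le> (\<bar>C0\<bar> * nm f) * nm (S f)" by linarith
      then show "nm (S f) \<le> \<bar>C0\<bar> * nm f" by (rule mult_self_le_imp_le) auto
    qed
  qed
  have pS: "positive_operator a H S"
    unfolding positive_operator_def
  proof
    fix f assume f: "f \<in> H"
    show "ip (S f) f \<in> \<real> \<and> 0 \<le> Re (ip (S f) f)"
      using B(7)[OF f f f] B(4)[OF f f f] S(2)[OF f f] by (metis Reals_of_real)
  qed
  have "T = S"
    unfolding T_def toeplitz_def
  proof (rule the_equality)
    show "S \<in> extensional H \<and> bounded_operator a H S \<and> positive_operator a H S \<and>
      (\<forall>f\<in>H. \<forall>g\<in>H. ip (S f) g = q_form a \<mu> f g)"
      using bS pS S by (auto simp: S_def)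
    fix R assume R: "R \<in> extensional H \<and> bounded_operator a H R \<and> positive_operator a H R \<and>
      (\<forall>f\<in>H. \<forall>g\<in>H. ip (R f) g = q_form a \<mu> f g)"
    show "R = S"
    proof (rule extensionalityI)
      show "R \<in> extensional H" "S \<in> extensional H" using R by (auto simp: S_def)
      show "R f = S f" if "f \<in> H" for f
        by (rule uniq) (use R S that bounded_operatorD(1)[of R f] in auto)
    qed
  qed
  then show "bounded_operator a H T" "f \<in> H \<Longrightarrow> g \<in> H \<Longrightarrow> ip (T f) g = q_form a \<mu> f g"
    using bS S by auto
qed

end

subsection \<open>The spectral theorem for compact positive operators\<close>

context
  fixes T
  assumes compact: "compact_operator a H T"
    and form: "pos_form (\<lambda>f g. ip (T f) g)"
begin

lemma bounded_T: "bounded_operator a H T"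
  using compact by (simp add: compact_operator_def)

lemmas T_mem = bounded_operatorD(1)[OF bounded_T]
  and T_add = bounded_operatorD(2)[OF bounded_T]
  and T_sc = bounded_operatorD(3)[OF bounded_T]

lemma T_selfadjoint: "f \<in> H \<Longrightarrow> g \<in> H \<Longrightarrow> ip (T f) g = ip f (T g)"
  using pos_form_rules(3)[OF form, of g f g] L2_inner_cnj[of a "T g" f] by simp

lemma compactE:
  assumes "\<And>k::nat. x k \<in> H" "\<And>k. nm (x k) \<le> C"
  obtains y r where "y \<in> H" "strict_mono r" "(\<lambda>k. nm (T (x (r k)) - y)) \<longlonglongrightarrow> 0"
  using compact assms unfolding compact_operator_def by (metis image_subsetI)

lemma T_limit:
  assumes "\<And>k. x k \<in> H" "y \<in> H" "(\<lambda>k. nm (x k - y)) \<longlonglongrightarrow> 0"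
  shows "(\<lambda>k. nm (T (x k) - T y)) \<longlonglongrightarrow> 0"
proof -
  obtain C where C: "C \<ge> 0" "\<And>f. f \<in> H \<Longrightarrow> nm (T f) \<le> C * nm f"
    using bounded_operator_bound[OF bounded_T] by blast
  have b: "nm (T (x k) - T y) \<le> C * nm (x k - y)" for k
    using C(2)[of "x k - y"] assms by (simp add: operator_diff[OF bounded_T] H_diff)
  have "(\<lambda>k. C * nm (x k - y)) \<longlonglongrightarrow> 0" using tendsto_mult_right_zero[OF assms(3)] by simp
  then show ?thesis
    by (rule Lim_null_comparison[OF always_eventually, rotated]) (use b in auto)
qed

text \<open>Let M be the supremum of <Tf, f> over the unit ball of the closed invariant subspace V.
  Along a maximising sequence T x - M x tends to 0, and compactness makes T x converge along a
  subsequence; the limit is an eigenvector for M. If M = 0, the zero vector with value 0 is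
  returned.\<close>

lemma max_eigenvector:
  assumes V: "V \<subseteq> H" "0 \<in> V" "\<And>c f. f \<in> V \<Longrightarrow> sc c f \<in> V" "\<And>f. f \<in> V \<Longrightarrow> T f \<in> V"
    and closed: "\<And>x y. (\<And>k. x k \<in> V) \<Longrightarrow> y \<in> H \<Longrightarrow> (\<lambda>k. nm (x k - y)) \<longlonglongrightarrow> 0 \<Longrightarrow> y \<in> V"
  shows "\<exists>e s. e \<in> V \<and> 0 \<le> s \<and> T e = sc (of_real s) e \<and> (s > 0 \<longrightarrow> nm e = 1) \<and> (s = 0 \<longrightarrow> e = 0) \<and>
    (\<forall>f\<in>V. Re (ip (T f) f) \<le> s * (nm f)\<^sup>2)"
proof -
  let ?Q = "\<lambda>f. Re (ip (T f) f)"
  define U where "U = {f \<in> V. nm f \<le> 1}"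
  define M where "M = Sup (?Q ` U)"
  obtain C where C: "C \<ge> 0" "\<And>f. f \<in> H \<Longrightarrow> nm (T f) \<le> C * nm f"
    using bounded_operator_bound[OF bounded_T] by blast
  have Qle: "?Q f \<le> C" if "f \<in> U" for f
  proof -
    have f: "f \<in> H" "nm f \<le> 1" using that V by (auto simp: U_def)
    have "?Q f \<le> nm (T f) * nm f"
      using ip_CS[OF T_mem[OF f(1)] f(1)] complex_Re_le_cmod order.trans by blast
    also have "\<dots> \<le> (C * 1) * 1"
      using C(2)[OF f(1)] mult_left_mono[OF f(2) C(1)] f(2) C(1) by (intro mult_mono) auto
    finally show ?thesis by simp
  qed
  have bdd: "bdd_above (?Q ` U)" using Qle by (intro bdd_aboveI2)
  have QM: "?Q f \<le> M" if "f \<in> U" for f unfolding M_def using that bdd by (intro cSup_upper) auto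
  have zero: "0 \<in> U" using V by (auto simp: U_def)
  have M0: "0 \<le> M" using QM[OF zero] by (simp add: operator_zero[OF bounded_T])
  have QMV: "?Q f \<le> M * (nm f)\<^sup>2" if f: "f \<in> V" for f
  proof (cases "nm f = 0")
    case True
    then have "f = 0" using f V nm_zero_imp by blast
    then show ?thesis by (simp add: operator_zero[OF bounded_T])
  next
    case False
    have fH: "f \<in> H" using f V by auto
    let ?g = "sc (of_real (1 / nm f)) f"
    have "nm ?g = 1" unfolding nm_sc using False by (simp add: norm_divide)
    moreover have "?g \<in> V" by (rule V(3)[OF f])
    ultimately have "?g \<in> U" unfolding U_def by simp
    then have "?Q ?g \<le> M" by (rule QM)
    also have "ip (T ?g) ?g = of_real ((1 / nm f)\<^sup>2) * ip (T f) f"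
      unfolding T_sc[OF fH] ip_sc_left ip_sc_right by (simp add: power2_eq_square)
    finally show ?thesis using False by (simp add: field_simps)
  qed
  show ?thesis
  proof (cases "M = 0")
    case True
    have T0: "T 0 = sc (of_real 0) 0"
      unfolding operator_zero[OF bounded_T] by (simp add: fun_eq_iff)
    show ?thesis
      by (intro exI[of _ 0] exI[of _ "0::real"] conjI V(2) T0) (use True QMV in auto)
  next
    case False
    then have M: "M > 0" using M0 by simp
    \<comment> \<open>Cauchy-Schwarz for the form <T., .> at f and T f; invariance of V allows the
      bound M for the second factor.\<close>
    have TQ: "(nm (T f))\<^sup>2 \<le> M * ?Q f" if f: "f \<in> V" for f
    proof -
      have fH: "f \<in> H" and TfH: "T f \<in> H" and TfV: "T f \<in> V" using f V by auto
      have "((nm (T f))\<^sup>2)\<^sup>2 = (norm (ip (T f) (T f)))\<^sup>2"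
        by (simp only: L2_inner_self norm_of_real abs_power2)
      also have "\<dots> \<le> ?Q f * ?Q (T f)" by (rule pos_form_CS[OF form fH TfH])
      also have "\<dots> \<le> ?Q f * (M * (nm (T f))\<^sup>2)"
        using pos_form_rules(4)[OF form fH fH fH] by (intro mult_left_mono QMV TfV) auto
      finally have "(nm (T f))\<^sup>2 * (nm (T f))\<^sup>2 \<le> (M * ?Q f) * (nm (T f))\<^sup>2"
        by (simp add: power2_eq_square mult_ac)
      moreover have "0 \<le> M * ?Q f" using M pos_form_rules(4)[OF form fH fH fH] by simp
      ultimately show ?thesis by (rule mult_self_le_imp_le) simp
    qed
    have "\<exists>f\<in>U. M - 1 / real (Suc k) < ?Q f" for k
    proof -
      have "M - 1 / real (Suc k) < M" by simp
      then show ?thesis unfolding M_def using less_cSupD[of "?Q ` U"] zero by blast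
    qed
    then obtain x where x: "\<And>k. x k \<in> U" and xQ: "\<And>k. M - 1 / real (Suc k) < ?Q (x k)" by metis
    have xV: "x k \<in> V" and xH: "x k \<in> H" and x1: "nm (x k) \<le> 1" for k using x V by (auto simp: U_def)
    obtain y r where y: "y \<in> H" and r: "strict_mono r" and lim: "(\<lambda>k. nm (T (x (r k)) - y)) \<longlonglongrightarrow> 0"
      by (rule compactE[OF xH x1])
    let ?S = "sc (of_real M)"
    define u where "u k = x (r k)" for k
    have uV: "u k \<in> V" and uH: "u k \<in> H" and u1: "nm (u k) \<le> 1" for k
      unfolding u_def by (rule xV xH x1)+
    have uQ: "M - 1 / real (Suc k) < ?Q (u k)" for k
    proof -
      have "1 / real (Suc (r k)) \<le> 1 / real (Suc k)" using seq_suble[OF r, of k] by (auto simp: frac_le)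
      then show ?thesis using xQ[of "r k"] unfolding u_def by linarith
    qed
    have lim: "(\<lambda>k. nm (T (u k) - y)) \<longlonglongrightarrow> 0" using lim by (simp only: u_def)
    have yV: "y \<in> V" by (rule closed[OF _ y lim]) (intro V uV)
    have small: "(\<lambda>k. 1 / real (Suc k)) \<longlonglongrightarrow> 0" by (rule LIMSEQ_Suc[OF lim_1_over_n])
    \<comment> \<open>The square expands to ||Tu||^2 - 2M <Tu,u> + M^2 ||u||^2, which
      \<open>TQ\<close> and ||u|| \<le> 1 bound by M (M - <Tu,u>).\<close>
    have close: "(nm (T (u k) - ?S (u k)))\<^sup>2 \<le> M * (1 / real (Suc k))" for k
    proof -
      have "T (u k) - ?S (u k) = T (u k) + sc (- of_real M) (u k)" by (auto simp: fun_eq_iff)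
      then have "(nm (T (u k) - ?S (u k)))\<^sup>2 = Re (ip (T (u k) + sc (- of_real M) (u k)) (T (u k) + sc (- of_real M) (u k)))"
        by (simp only: nm_square)
      also have "\<dots> = (nm (T (u k)))\<^sup>2 - 2 * M * ?Q (u k) + M\<^sup>2 * (nm (u k))\<^sup>2"
        by (subst pos_form_expand[OF pos_form_ip T_mem[OF uH] uH]) (simp add: nm_square)
      also have "\<dots> \<le> M * ?Q (u k) - 2 * M * ?Q (u k) + M\<^sup>2 * 1"
      proof (intro add_mono diff_mono TQ uV mult_left_mono)
        show "(nm (u k))\<^sup>2 \<le> 1" using u1 by (simp add: power_le_one)
      qed (use M in auto)
      also have "\<dots> = M * (M - ?Q (u k))" by (simp add: power2_eq_square algebra_simps)
      also have "\<dots> \<le> M * (1 / real (Suc k))" using uQ[of k] M by (intro mult_left_mono) auto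
      finally show ?thesis .
    qed
    have lim1: "(\<lambda>k. nm (T (u k) - ?S (u k))) \<longlonglongrightarrow> 0"
    proof -
      have "(\<lambda>k. (nm (T (u k) - ?S (u k)))\<^sup>2) \<longlonglongrightarrow> 0"
        by (rule Lim_null_comparison[OF always_eventually tendsto_mult_right_zero[OF small, of M]]) (use close in auto)
      from tendsto_real_sqrt[OF this] show ?thesis by simp
    qed
    have "nm (?S (u k) - y) \<le> nm (T (u k) - ?S (u k)) + nm (T (u k) - y)" for k
      by (subst nm_minus_commute[of "T (u k)" "?S (u k)"]) (rule nm_triangle3[OF H_sc[OF uH] T_mem[OF uH] y])
    \<comment> \<open>Since T u - M u tends to 0 and T u tends to y, also M u tends to y; as M > 0,
      this is norm convergence of the maximising vectors themselves.\<close>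
    then have limM: "(\<lambda>k. nm (?S (u k) - y)) \<longlonglongrightarrow> 0"
      by (intro Lim_null_comparison[OF always_eventually tendsto_add_zero[OF lim1 lim]])
        (simp only: real_norm_def abs_of_nonneg[OF L2_norm_nonneg] simp_thms)
    have Ty: "T y = ?S y"
    proof (rule nm_limit_unique[where x = "\<lambda>k. T (?S (u k))"])
      show "(\<lambda>k. nm (T (?S (u k)) - T y)) \<longlonglongrightarrow> 0"
        by (rule T_limit[OF H_sc[OF uH] y limM])
      have "T (?S (u k)) - ?S y = ?S (T (u k) - y)" for k
        by (simp add: T_sc uH fun_eq_iff algebra_simps)
      then have "nm (T (?S (u k)) - ?S y) = M * nm (T (u k) - y)" for k
        using M by (simp only: nm_sc norm_of_real abs_of_pos)
      then show "(\<lambda>k. nm (T (?S (u k)) - ?S y)) \<longlonglongrightarrow> 0"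
        using tendsto_mult_right_zero[OF lim, of M] by (simp only:)
    qed (intro T_mem H_sc uH y)+
    \<comment> \<open>A zero limit would give M ||u|| -> 0, whereas M ||u||^2 dominates <Tu, u>,
      which tends to M > 0.\<close>
    have y0: "nm y \<noteq> 0"
    proof
      assume "nm y = 0"
      then have "(\<lambda>k. M * nm (u k)) \<longlonglongrightarrow> 0"
        using nm_limit_nm[OF H_sc[OF uH] y limM] M by (simp add: nm_sc)
      from tendsto_mult[OF this this] have "(\<lambda>k. M * nm (u k) * (M * nm (u k))) \<longlonglongrightarrow> 0" by simp
      moreover have "(\<lambda>k. M * (M - 1 / real (Suc k))) \<longlonglongrightarrow> M * (M - 0)"
        by (intro tendsto_intros small)
      moreover have "M * (M - 1 / real (Suc k)) \<le> M * nm (u k) * (M * nm (u k))" for k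
      proof -
        have "M * (M - 1 / real (Suc k)) \<le> M * (M * (nm (u k))\<^sup>2)"
          using uQ[of k] QMV[OF uV[of k]] M by (intro mult_left_mono) auto
        then show ?thesis by (simp add: power2_eq_square algebra_simps)
      qed
      ultimately have "M * (M - 0) \<le> 0" by (intro LIMSEQ_le) auto
      then show False using M by (simp add: mult_le_0_iff)
    qed
    show ?thesis
    proof (intro exI[of _ "sc (of_real (1 / nm y)) y"] exI[of _ M] conjI ballI impI)
      show "sc (of_real (1 / nm y)) y \<in> V" using V yV by blast
      show "T (sc (of_real (1 / nm y)) y) = ?S (sc (of_real (1 / nm y)) y)"
        unfolding T_sc[OF y] Ty by (simp add: fun_eq_iff)
      show "nm (sc (of_real (1 / nm y)) y) = 1" unfolding nm_sc using y0 by (simp add: norm_divide)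
    qed (use M QMV in auto)
  qed
qed

text \<open>The zero vector is used as \<open>e k\<close> once the remaining maximum \<open>s k\<close> of the quadratic form is 0,
  so the sequence never stops, whatever the rank of \<open>T\<close> and the dimension of \<open>H\<close>.\<close>

definition eigenpairs :: "(nat \<Rightarrow> complex^'n \<Rightarrow> complex) \<Rightarrow> (nat \<Rightarrow> real) \<Rightarrow> bool" where
  "eigenpairs e s \<longleftrightarrow> (\<forall>k. e k \<in> H \<and> (\<forall>j<k. ip (e k) (e j) = 0) \<and> 0 \<le> s k \<and> T (e k) = sc (of_real (s k)) (e k) \<and>
     (s k > 0 \<longrightarrow> nm (e k) = 1) \<and> (s k = 0 \<longrightarrow> e k = 0) \<and>
     (\<forall>f\<in>H. (\<forall>j<k. ip f (e j) = 0) \<longrightarrow> Re (ip (T f) f) \<le> s k * (nm f)\<^sup>2))"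

text \<open>The k-th pair is taken from \<open>max_eigenvector\<close> on the orthogonal complement
  of the earlier eigenvectors, which is closed and, by self-adjointness, invariant. Vectors and
  values are packed into one function \<open>F\<close> so that the dependent choice is made
  jointly.\<close>

lemma eigenpairs_exist: "\<exists>e s. eigenpairs e s"
proof -
  let ?P = "\<lambda>(F :: nat \<Rightarrow> (complex^'n \<Rightarrow> complex) \<times> real) k r.
     fst r \<in> H \<and> (\<forall>j<k. ip (fst r) (fst (F j)) = 0) \<and> 0 \<le> snd r \<and> T (fst r) = sc (of_real (snd r)) (fst r) \<and>
     (snd r > 0 \<longrightarrow> nm (fst r) = 1) \<and> (snd r = 0 \<longrightarrow> fst r = 0) \<and>
     (\<forall>f\<in>H. (\<forall>j<k. ip f (fst (F j)) = 0) \<longrightarrow> Re (ip (T f) f) \<le> snd r * (nm f)\<^sup>2)"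
  have "\<exists>F. \<forall>k. ?P F k (F k)"
  proof (rule dependent_wf_choice[where R = less_than])
    fix F k assume IH: "\<And>j. (j, k) \<in> less_than \<Longrightarrow> ?P F j (F j)"
    let ?V = "{f \<in> H. \<forall>j<k. ip f (fst (F j)) = 0}"
    have "\<exists>e s. e \<in> ?V \<and> 0 \<le> s \<and> T e = sc (of_real s) e \<and> (s > 0 \<longrightarrow> nm e = 1) \<and> (s = 0 \<longrightarrow> e = 0) \<and>
      (\<forall>f\<in>?V. Re (ip (T f) f) \<le> s * (nm f)\<^sup>2)"
    proof (rule max_eigenvector)
      show "sc c f \<in> ?V" if "f \<in> ?V" for c f using that by (auto simp: H_sc ip_sc_left)
      show "T f \<in> ?V" if "f \<in> ?V" for f
      proof -
        have "ip (T f) (fst (F j)) = 0" if j: "j < k" for j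
        proof -
          have Fj: "fst (F j) \<in> H" "T (fst (F j)) = sc (of_real (snd (F j))) (fst (F j))"
            using IH[of j] j by auto
          have "ip (T f) (fst (F j)) = ip f (T (fst (F j)))"
            using \<open>f \<in> ?V\<close> Fj by (intro T_selfadjoint) auto
          also have "\<dots> = of_real (snd (F j)) * ip f (fst (F j))"
            unfolding Fj(2) ip_sc_right by simp
          also have "\<dots> = 0" using \<open>f \<in> ?V\<close> j by simp
          finally show ?thesis .
        qed
        then show ?thesis using that T_mem by auto
      qed
      show "y \<in> ?V" if x: "\<And>m. x m \<in> ?V" and y: "y \<in> H" and lim: "(\<lambda>m. nm (x m - y)) \<longlonglongrightarrow> 0" for x :: "nat \<Rightarrow> _" and y
      proof -
        have "ip y (fst (F j)) = 0" if j: "j < k" for j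
        proof -
          have Fj: "fst (F j) \<in> H" using IH[of j] j by auto
          have "norm (ip y (fst (F j))) \<le> nm (x m - y) * nm (fst (F j))" for m
          proof -
            have xm: "x m \<in> H" "ip (x m) (fst (F j)) = 0" using x[of m] j by auto
            have "ip (x m - y) (fst (F j)) = - ip y (fst (F j))"
              using ip_diff_left[OF xm(1) y Fj] xm(2) by simp
            then show ?thesis using ip_CS[OF H_diff[OF xm(1) y] Fj] by simp
          qed
          moreover have "(\<lambda>m. nm (x m - y) * nm (fst (F j))) \<longlonglongrightarrow> 0 * nm (fst (F j))"
            by (intro tendsto_intros lim)
          ultimately have "norm (ip y (fst (F j))) \<le> 0 * nm (fst (F j))"
            by (intro LIMSEQ_le_const) auto
          then show ?thesis by simp
        qed
        then show ?thesis using y by simp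
      qed
    qed (auto simp: H_zero)
    then obtain e s where "e \<in> ?V" "0 \<le> s" "T e = sc (of_real s) e" "s > 0 \<longrightarrow> nm e = 1" "s = 0 \<longrightarrow> e = 0"
      "\<forall>f\<in>?V. Re (ip (T f) f) \<le> s * (nm f)\<^sup>2" by blast
    then show "\<exists>r. ?P F k r" by (intro exI[of _ "(e, s)"]) auto
  qed auto
  then obtain F where F: "\<And>k. ?P F k (F k)" by blast
  show ?thesis
    by (intro exI[of _ "\<lambda>k. fst (F k)"] exI[of _ "\<lambda>k. snd (F k)"]) (unfold eigenpairs_def, use F in blast)
qed

context
  fixes e :: "nat \<Rightarrow> complex^'n \<Rightarrow> complex" and s :: "nat \<Rightarrow> real"
  assumes es: "eigenpairs e s"
begin

lemma eigen: "e k \<in> H" "0 \<le> s k" "T (e k) = sc (of_real (s k)) (e k)" "s k > 0 \<Longrightarrow> nm (e k) = 1"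
    "s k = 0 \<Longrightarrow> e k = 0"
  using es unfolding eigenpairs_def by blast+

lemma eigen_max: "f \<in> H \<Longrightarrow> (\<And>j. j < k \<Longrightarrow> ip f (e j) = 0) \<Longrightarrow> Re (ip (T f) f) \<le> s k * (nm f)\<^sup>2"
  using es unfolding eigenpairs_def by blast

lemma eigen_orth: "i \<noteq> j \<Longrightarrow> ip (e i) (e j) = 0"
proof -
  have *: "ip (e i) (e j) = 0" if "j < i" for i j using es that unfolding eigenpairs_def by blast
  assume "i \<noteq> j"
  then consider "j < i" | "i < j" by linarith
  then show ?thesis using * L2_inner_cnj[of a "e j" "e i"] by cases auto
qed

lemma eigen_self: "of_real (s k) * ip (e k) (e k) = of_real (s k)"
  using eigen(4)[of k] eigen(2)[of k] by (cases "s k = 0") (auto simp: L2_inner_self)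

text \<open>The vector \<open>e (Suc k)\<close> is orthogonal to the first k eigenvectors, hence a
  competitor in the maximum property of \<open>s k\<close>.\<close>

lemma eigen_decseq: "decseq s"
proof (rule decseq_SucI)
  fix k
  show "s (Suc k) \<le> s k"
  proof (cases "s (Suc k) = 0")
    case False
    then have n: "nm (e (Suc k)) = 1" using eigen(2)[of "Suc k"] eigen(4)[of "Suc k"] by simp
    have "Re (ip (T (e (Suc k))) (e (Suc k))) \<le> s k * (nm (e (Suc k)))\<^sup>2"
      by (intro eigen_max eigen eigen_orth) auto
    moreover have "ip (T (e (Suc k))) (e (Suc k)) = of_real (s (Suc k))"
      unfolding eigen(3) ip_sc_left by (rule eigen_self)
    ultimately show ?thesis using n by simp
  qed (simp add: eigen)
qed

text \<open>If the limit l were positive, the vectors T e_k would be pairwise orthogonal of norm at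
  least l, hence at distance at least l from each other, and no subsequence could converge, against
  compactness.\<close>

lemma eigen_tendsto_0: "s \<longlonglongrightarrow> 0"
proof -
  obtain l where l: "s \<longlonglongrightarrow> l" "\<And>i. l \<le> s i"
    using decseq_convergent[OF eigen_decseq, of 0] eigen(2) by blast
  have "l = 0"
  proof (rule ccontr)
    assume "l \<noteq> 0"
    have "0 \<le> l" by (rule LIMSEQ_le_const[OF l(1)]) (use eigen in auto)
    then have lpos: "l > 0" using \<open>l \<noteq> 0\<close> by simp
    then have sp: "s k > 0" for k using l(2)[of k] by simp
    have n: "nm (e k) \<le> 1" for k using eigen(4)[OF sp] by simp
    obtain y r where y: "y \<in> H" and r: "strict_mono r" and lim: "(\<lambda>k. nm (T (e (r k)) - y)) \<longlonglongrightarrow> 0"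
      by (rule compactE[OF eigen(1) n])
    have "(\<lambda>k. nm (T (e (r k)) - y) + nm (T (e (r (Suc k))) - y)) \<longlonglongrightarrow> 0 + 0"
      by (intro tendsto_intros lim LIMSEQ_Suc[OF lim])
    moreover have "l \<le> nm (T (e (r k)) - y) + nm (T (e (r (Suc k))) - y)" for k
    proof -
      let ?f = "T (e (r k))" and ?g = "T (e (r (Suc k)))"
      have ne: "r k \<noteq> r (Suc k)" using strict_mono_less[OF r, of k "Suc k"] by auto
      have fg: "?f \<in> H" "?g \<in> H" by (intro T_mem eigen)+
      have o: "ip ?f ?g = 0" unfolding eigen(3) ip_sc_left ip_sc_right eigen_orth[OF ne] by simp
      have eq: "?f - ?g = ?f + sc (- 1) ?g" by (auto simp: fun_eq_iff)
      have "(nm (?f - ?g))\<^sup>2 = (nm ?f)\<^sup>2 + (nm ?g)\<^sup>2"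
        unfolding nm_square eq using pos_form_expand[OF pos_form_ip fg, of "- 1"] o by simp
      then have "(nm ?f)\<^sup>2 \<le> (nm (?f - ?g))\<^sup>2" by simp
      then have "nm ?f \<le> nm (?f - ?g)" by (rule power2_le_imp_le) simp
      moreover have "nm ?f = s (r k)"
        unfolding eigen(3) nm_sc eigen(4)[OF sp] using eigen(2) by simp
      ultimately show ?thesis
        using nm_triangle3[OF fg(1) y fg(2)] nm_minus_commute[of y ?g] l(2)[of "r k"] by simp
    qed
    ultimately have "l \<le> 0 + 0" by (intro LIMSEQ_le_const) auto
    then show False using lpos by simp
  qed
  then show ?thesis using l by simp
qed

text \<open>The eigenvectors are orthonormal apart from zero vectors, which add nothing, so this is
  the orthogonal projection onto the span of the first N.\<close>

definition proj where "proj N f = (\<Sum>k<N. sc (ip f (e k)) (e k))" for N :: nat and f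

lemma proj_mem: "proj N f \<in> H"
  unfolding proj_def by (intro H_sum H_sc eigen)

text \<open>T respects the splitting into \<open>proj N f\<close> and the remainder, so the cross
  term of the form vanishes and the form at the projection is diagonal.\<close>

lemma eigen_expansion_finite:
  assumes f: "f \<in> H"
  shows "Re (ip (T f) f) = (\<Sum>k<N. s k * (norm (ip f (e k)))\<^sup>2) + Re (ip (T (f - proj N f)) (f - proj N f))"
    "\<And>j. j < N \<Longrightarrow> s j > 0 \<Longrightarrow> ip (f - proj N f) (e j) = 0" "nm (f - proj N f) \<le> nm f"
proof -
  let ?p = "proj N f" and ?r = "f - proj N f"
  have p: "?p \<in> H" and r: "?r \<in> H" by (intro proj_mem H_diff f)+
  have pe: "ip ?p (e j) = (\<Sum>k<N. ip f (e k) * ip (e k) (e j))" for j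
    unfolding proj_def by (subst ip_sum_left) (auto intro: H_sc eigen simp: ip_sc_left)
  have pe2: "ip ?p (e j) = ip f (e j) * ip (e j) (e j)" if "j < N" for j
  proof -
    have "ip ?p (e j) = (\<Sum>k<N. if k = j then ip f (e j) * ip (e j) (e j) else 0)"
      unfolding pe by (intro sum.cong) (auto simp: eigen_orth)
    then show ?thesis using that by simp
  qed
  \<comment> \<open>Covers unit vectors and the zero vector alike: in either case
    \<open>ip (e j) (e j)\<close> acts as 1 here.\<close>
  have z: "ip f (e j) * ip (e j) (e j) = ip f (e j)" for j
    using eigen(2)[of j] eigen(4)[of j] eigen(5)[of j] by (cases "s j = 0") (auto simp: L2_inner_self)
  have orth: "ip ?r (e j) = 0" if "j < N" for j
    using ip_diff_left[OF f p eigen(1)] pe2[OF that] z by simp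
  then show "\<And>j. j < N \<Longrightarrow> s j > 0 \<Longrightarrow> ip ?r (e j) = 0" by blast
  have lin: "ip g ?p = (\<Sum>k<N. cnj (ip f (e k)) * ip g (e k))" if "g \<in> H" for g
    by (subst (1 2) L2_inner_cnj[symmetric], subst proj_def, subst ip_sum_left)
      (auto intro: H_sc eigen that simp: ip_sc_left)
  have rp: "ip ?r ?p = 0" unfolding lin[OF r] by (simp add: orth)
  have Te: "ip (T g) (e k) = of_real (s k) * ip g (e k)" if "g \<in> H" for g k
    using T_selfadjoint[OF that eigen(1)] unfolding eigen(3) ip_sc_right by simp
  have Trp: "ip (T ?r) ?p = 0" unfolding lin[OF T_mem[OF r]] by (simp add: Te[OF r] orth)
  have f_eq: "f = ?r + sc 1 ?p" by (auto simp: fun_eq_iff)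
  have "Re (ip (T f) f) = Re (ip (T (?r + sc 1 ?p)) (?r + sc 1 ?p))" using f_eq by simp
  also have "\<dots> = Re (ip (T ?r) ?r) + Re (ip (T ?p) ?p)"
    by (subst pos_form_expand[OF form r p, of 1]) (simp add: Trp)
  also have "ip (T ?p) ?p = (\<Sum>k<N. of_real (s k * (norm (ip f (e k)))\<^sup>2))"
    unfolding lin[OF T_mem[OF p]]
  proof (rule sum.cong)
    fix k assume "k \<in> {..<N}"
    then have "ip ?p (e k) = ip f (e k)" using pe2 z by simp
    then have "cnj (ip f (e k)) * ip (T ?p) (e k) = of_real (s k) * (ip f (e k) * cnj (ip f (e k)))"
      unfolding Te[OF p] by simp
    also have "\<dots> = of_real (s k * (norm (ip f (e k)))\<^sup>2)"
      unfolding complex_norm_square[symmetric] by simp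
    finally show "cnj (ip f (e k)) * ip (T ?p) (e k) = of_real (s k * (norm (ip f (e k)))\<^sup>2)" .
  qed simp
  finally have "Re (ip (T f) f) = Re (ip (T ?r) ?r) + Re (\<Sum>k<N. of_real (s k * (norm (ip f (e k)))\<^sup>2))" .
  then show "Re (ip (T f) f) = (\<Sum>k<N. s k * (norm (ip f (e k)))\<^sup>2) + Re (ip (T ?r) ?r)"
    unfolding Re_sum Re_complex_of_real by (simp only: add.commute)
  have "(nm f)\<^sup>2 = Re (ip (?r + sc 1 ?p) (?r + sc 1 ?p))" unfolding nm_square using f_eq by simp
  also have "\<dots> = (nm ?r)\<^sup>2 + (nm ?p)\<^sup>2"
    by (subst pos_form_expand[OF pos_form_ip r p, of 1]) (simp add: rp nm_square)
  finally have "(nm ?r)\<^sup>2 \<le> (nm f)\<^sup>2" by simp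
  then show "nm ?r \<le> nm f" by (rule power2_le_imp_le) simp
qed

text \<open>The remainder is orthogonal to the first N eigenvectors, so the maximum property bounds
  the form there by s(N) ||f||^2, which tends to 0. The vectors \<open>e\<close> may fail to span H;
  what is orthogonal to all of them lies in the kernel of T and contributes nothing.\<close>

lemma eigen_expansion:
  assumes f: "f \<in> H"
  shows "(\<lambda>k. s k * (norm (ip f (e k)))\<^sup>2) sums Re (ip (T f) f)"
proof -
  let ?R = "\<lambda>N. Re (ip (T (f - proj N f)) (f - proj N f))"
  have r: "f - proj N f \<in> H" for N by (intro H_diff f proj_mem)
  have up: "?R N \<le> s N * (nm f)\<^sup>2" for N
  proof -
    have "?R N \<le> s N * (nm (f - proj N f))\<^sup>2"
    proof (rule eigen_max[OF r])
      fix j assume "j < N"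
      then show "ip (f - proj N f) (e j) = 0"
        using eigen_expansion_finite(2)[OF f] eigen(2)[of j] eigen(5)[of j] by (cases "s j = 0") auto
    qed
    also have "\<dots> \<le> s N * (nm f)\<^sup>2"
      by (intro mult_left_mono power_mono eigen_expansion_finite(3) f eigen) auto
    finally show ?thesis .
  qed
  have "(\<lambda>N. s N * (nm f)\<^sup>2) \<longlonglongrightarrow> 0"
    using tendsto_mult_left_zero[OF eigen_tendsto_0] by simp
  then have "?R \<longlonglongrightarrow> 0"
    by (rule Lim_null_comparison[OF always_eventually, rotated])
      (use up pos_form_rules(4)[OF form r r r] in auto)
  then have "(\<lambda>N. Re (ip (T f) f) - ?R N) \<longlonglongrightarrow> Re (ip (T f) f) - 0"
    by (intro tendsto_intros)
  moreover have "Re (ip (T f) f) - ?R N = (\<Sum>k<N. s k * (norm (ip f (e k)))\<^sup>2)" for N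
    using eigen_expansion_finite(1)[OF f, of N] by linarith
  ultimately show ?thesis unfolding sums_def by simp
qed

text \<open>The expansion gives <Tf, f> = 0, and Cauchy-Schwarz for the form, tested with T f,
  upgrades this to T f = 0.\<close>

lemma kernel_perp_eigen:
  assumes f: "f \<in> H" and orth: "\<And>k. ip f (e k) = 0"
  shows "T f = 0"
proof -
  have "(\<lambda>k. s k * (norm (ip f (e k)))\<^sup>2) sums 0" by (simp add: orth)
  then have z: "Re (ip (T f) f) = 0" using eigen_expansion[OF f] sums_unique2 by blast
  have "(norm (ip (T f) (T f)))\<^sup>2 \<le> Re (ip (T f) f) * Re (ip (T (T f)) (T f))"
    by (rule pos_form_CS[OF form f T_mem[OF f]])
  then have "ip (T f) (T f) = 0" by (simp add: z)
  then have "nm (T f) = 0" by (simp add: L2_inner_self)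
  then show ?thesis by (rule nm_zero_imp[OF T_mem[OF f]])
qed

section \<open>Eigenspaces and singular values\<close>

lemma eigenspace_finite:
  assumes "\<sigma> > 0" shows "finite {k. s k = \<sigma>}"
proof -
  have "\<forall>\<^sub>F k in sequentially. s k < \<sigma>" using order_tendstoD(2)[OF eigen_tendsto_0 assms] .
  then obtain N where "\<And>k. k \<ge> N \<Longrightarrow> s k < \<sigma>" by (auto simp: eventually_sequentially)
  then have "{k. s k = \<sigma>} \<subseteq> {..<N}" by (force simp: not_less[symmetric])
  then show ?thesis by (rule finite_subset) simp
qed

lemma adjoint_T: "f \<in> H \<Longrightarrow> adjoint_op a H T f = T f"
  unfolding adjoint_op_def
proof (rule the_equality)
  assume f: "f \<in> H"
  show "T f \<in> H \<and> (\<forall>g\<in>H. ip (T f) g = ip f (T g))" using T_mem[OF f] T_selfadjoint[OF f] by blast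
  fix h assume h: "h \<in> H \<and> (\<forall>g\<in>H. ip h g = ip f (T g))"
  show "h = T f"
  proof
    fix z
    have "ip h (K z) = ip (T f) (K z)" using h T_selfadjoint[OF f kernel_mem] kernel_mem by metis
    then show "h z = T f z" using h T_mem[OF f] by (simp add: repro)
  qed
qed

text \<open>T^2 - \<sigma>^2 = (T + \<sigma>)(T - \<sigma>), and T + \<sigma> is injective because T
  is positive and \<sigma> > 0: for g = (T - \<sigma>) f, the identity T g = -\<sigma> g makes <Tg,
  g> both nonnegative and nonpositive.\<close>

lemma square_eigenspace:
  assumes \<sigma>: "\<sigma> > 0"
  shows "{f \<in> H. adjoint_op a H T (T f) = (\<lambda>z. of_real (\<sigma>\<^sup>2) * f z)} = {f \<in> H. T f = sc (of_real \<sigma>) f}"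
proof (intro Collect_cong conj_cong refl iffI)
  fix f assume f: "f \<in> H" and "adjoint_op a H T (T f) = (\<lambda>z. of_real (\<sigma>\<^sup>2) * f z)"
  then have TT: "T (T f) = (\<lambda>z. of_real (\<sigma>\<^sup>2) * f z)" by (simp add: adjoint_T T_mem)
  define g where "g = T f - sc (of_real \<sigma>) f"
  have g: "g \<in> H" unfolding g_def by (intro H_diff T_mem H_sc f)
  have "T g = T (T f) - T (sc (of_real \<sigma>) f)"
    unfolding g_def by (rule operator_diff[OF bounded_T T_mem[OF f] H_sc[OF f]])
  also have "\<dots> = sc (- of_real \<sigma>) g"
  proof
    fix z
    have "(T (T f) - T (sc (of_real \<sigma>) f)) z = of_real (\<sigma>\<^sup>2) * f z - of_real \<sigma> * T f z"
      by (simp only: TT T_sc[OF f] minus_apply)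
    also have "\<dots> = - of_real \<sigma> * (T f z - of_real \<sigma> * f z)"
      by (simp add: algebra_simps power2_eq_square)
    also have "\<dots> = - of_real \<sigma> * g z" by (simp only: g_def minus_apply)
    finally show "(T (T f) - T (sc (of_real \<sigma>) f)) z = - of_real \<sigma> * g z" .
  qed
  finally have Tg: "T g = sc (- of_real \<sigma>) g" .
  have "0 \<le> Re (ip (T g) g)" by (rule pos_form_rules(4)[OF form g g g])
  also have "ip (T g) g = - of_real (\<sigma> * (nm g)\<^sup>2)"
    unfolding Tg ip_sc_left L2_inner_self by simp
  finally have "\<sigma> * (nm g)\<^sup>2 \<le> 0" by simp
  moreover have "\<sigma> * (nm g)\<^sup>2 \<ge> 0" using \<sigma> by simp
  ultimately have "nm g = 0" using \<sigma> by simp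
  then have "g = 0" using g nm_zero_imp by blast
  then show "T f = sc (of_real \<sigma>) f" unfolding g_def by (rule right_minus_eq[THEN iffD1])
next
  fix f assume f: "f \<in> H" and Tf: "T f = sc (of_real \<sigma>) f"
  show "adjoint_op a H T (T f) = (\<lambda>z. of_real (\<sigma>\<^sup>2) * f z)"
  proof -
    have "T (T f) = T (sc (of_real \<sigma>) f)" by (rule arg_cong[OF Tf])
    also have "\<dots> = sc (of_real \<sigma>) (T f)" by (rule T_sc[OF f])
    also have "\<dots> = (\<lambda>z. of_real (\<sigma>\<^sup>2) * f z)"
      by (rule ext, subst Tf) (simp add: power2_eq_square)
    finally show ?thesis unfolding adjoint_T[OF T_mem[OF f]] .
  qed
qed

text \<open>Subtract from f its projection p onto the listed eigenvectors. The difference is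
  orthogonal to every \<open>e j\<close>, for other eigenvalues by self-adjointness, so T
  annihilates it; but T also multiplies it by \<sigma> > 0, so it is 0.\<close>

lemma eigenspace_span:
  assumes \<sigma>: "\<sigma> > 0"
  shows "cfun.span (e ` {k. s k = \<sigma>}) = {f \<in> H. T f = sc (of_real \<sigma>) f}" (is "_ = ?E")
proof
  have "cfun.subspace ?E"
    unfolding cfun.subspace_def
  proof (intro conjI ballI allI)
    show "0 \<in> ?E" by (simp add: H_zero operator_zero[OF bounded_T] fun_eq_iff)
    show "x + y \<in> ?E" if "x \<in> ?E" "y \<in> ?E" for x y
      using that by (auto simp: H_add T_add fun_eq_iff algebra_simps)
    show "sc c x \<in> ?E" if "x \<in> ?E" for c x
      using that by (auto simp: H_sc T_sc fun_eq_iff)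
  qed
  then show "cfun.span (e ` {k. s k = \<sigma>}) \<subseteq> ?E"
    by (intro cfun.span_minimal) (auto simp: eigen)
next
  show "?E \<subseteq> cfun.span (e ` {k. s k = \<sigma>})"
  proof
    fix f assume "f \<in> ?E"
    then have f: "f \<in> H" and Tf: "T f = sc (of_real \<sigma>) f" by auto
    let ?I = "{k. s k = \<sigma>}"
    define p where "p = (\<Sum>k\<in>?I. sc (ip f (e k)) (e k))"
    have p: "p \<in> H" unfolding p_def by (intro H_sum H_sc eigen)
    have self: "ip (e k) (e k) = 1" if "k \<in> ?I" for k
      using that \<sigma> eigen(4)[of k] by (simp add: L2_inner_self)
    have pe: "ip p (e j) = (\<Sum>k\<in>?I. ip f (e k) * ip (e k) (e j))" for j
      unfolding p_def by (subst ip_sum_left) (auto intro: H_sc eigen simp: ip_sc_left)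
    have orth: "ip (f - p) (e j) = 0" for j
    proof (cases "s j = \<sigma>")
      case True
      have "ip p (e j) = (\<Sum>k\<in>?I. if k = j then ip f (e j) else 0)"
        unfolding pe by (intro sum.cong) (auto simp: eigen_orth self)
      also have "\<dots> = ip f (e j)" using True by (simp add: eigenspace_finite[OF \<sigma>])
      finally show ?thesis by (simp add: ip_diff_left f p eigen)
    next
      case False
      have "of_real \<sigma> * ip f (e j) = of_real (s j) * ip f (e j)"
        using T_selfadjoint[OF f eigen(1), of j] unfolding Tf eigen(3) ip_sc_left ip_sc_right by simp
      then have "ip f (e j) = 0" using False by simp
      moreover have "ip p (e j) = 0"
        unfolding pe
      proof (intro sum.neutral ballI)
        fix k assume "k \<in> ?I"
        then have "k \<noteq> j" using False by auto
        then show "ip f (e k) * ip (e k) (e j) = 0" by (simp add: eigen_orth)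
      qed
      ultimately show ?thesis by (simp add: ip_diff_left f p eigen)
    qed
    have "T (f - p) = 0" by (rule kernel_perp_eigen[OF H_diff[OF f p] orth])
    moreover have "T (f - p) = sc (of_real \<sigma>) (f - p)"
    proof -
      have "T p = (\<Sum>k\<in>?I. T (sc (ip f (e k)) (e k)))"
        unfolding p_def by (intro operator_sum bounded_T H_sc eigen)
      also have "\<dots> = (\<Sum>k\<in>?I. sc (of_real \<sigma>) (sc (ip f (e k)) (e k)))"
        by (intro sum.cong refl) (auto simp: T_sc eigen fun_eq_iff)
      also have "\<dots> = sc (of_real \<sigma>) p"
        unfolding p_def by (rule cfun.scale_sum_right[symmetric])
      finally show ?thesis
        unfolding operator_diff[OF bounded_T f p] Tf by (simp add: fun_eq_iff algebra_simps)
    qed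
    ultimately have "sc (of_real \<sigma>) (f - p) = 0" by simp
    then have "f = p" using \<sigma> by (simp add: fun_eq_iff)
    moreover have "p \<in> cfun.span (e ` ?I)"
      unfolding p_def by (intro cfun.span_sum cfun.span_scale cfun.span_base) auto
    ultimately show "f \<in> cfun.span (e ` ?I)" by simp
  qed
qed

text \<open>Orthonormality makes the listed eigenvectors distinct and independent, so counting
  indices is counting dimensions.\<close>

lemma eigenspace_dim:
  assumes \<sigma>: "\<sigma> > 0"
  shows "card {k. s k = \<sigma>} = cfun.dim {f \<in> H. adjoint_op a H T (T f) = (\<lambda>z. of_real (\<sigma>\<^sup>2) * f z)}"
proof -
  let ?I = "{k. s k = \<sigma>}"
  have self: "ip (e k) (e k) = 1" if "k \<in> ?I" for k
    using that \<sigma> eigen(4)[of k] by (simp add: L2_inner_self)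
  have inj: "inj_on e ?I"
    by (rule inj_onI) (metis self eigen_orth zero_neq_one)
  have "cfun.independent (e ` ?I)"
  proof (rule cfun.independent_if_scalars_zero)
    show "finite (e ` ?I)" using eigenspace_finite[OF \<sigma>] by simp
    fix u x assume sum0: "(\<Sum>x\<in>e ` ?I. sc (u x) x) = 0" and "x \<in> e ` ?I"
    then obtain j where j: "j \<in> ?I" "x = e j" by auto
    have "0 = ip (\<Sum>x\<in>e ` ?I. sc (u x) x) (e j)" by (simp only: sum0 ip_zero_left)
    also have "(\<Sum>x\<in>e ` ?I. sc (u x) x) = (\<Sum>k\<in>?I. sc (u (e k)) (e k))"
      by (rule sum.reindex[OF inj, unfolded o_def])
    also have "ip \<dots> (e j) = (\<Sum>k\<in>?I. u (e k) * ip (e k) (e j))"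
      by (subst ip_sum_left) (auto intro: H_sc eigen simp: ip_sc_left)
    also have "\<dots> = (\<Sum>k\<in>?I. if k = j then u (e j) else 0)"
      by (intro sum.cong) (auto simp: eigen_orth self)
    also have "\<dots> = u x" using j by (simp add: eigenspace_finite[OF \<sigma>])
    finally show "u x = 0" by simp
  qed
  then have "cfun.dim (cfun.span (e ` ?I)) = card (e ` ?I)"
    using cfun.dim_span cfun.dim_eq_card_independent by metis
  then show ?thesis
    unfolding square_eigenspace[OF \<sigma>] eigenspace_span[OF \<sigma>] card_image[OF inj] by simp
qed

lemma singular_values_eq: "singular_values a H T = s"
  unfolding singular_values_def
proof (rule the_equality)
  show "decseq s \<and> s \<longlonglongrightarrow> 0 \<and> (\<forall>\<sigma>>0. card {k. s k = \<sigma>} =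
      cfun.dim {f \<in> H. adjoint_op a H T (T f) = (\<lambda>z. of_real (\<sigma>\<^sup>2) * f z)})"
    using eigen_decseq eigen_tendsto_0 eigenspace_dim by blast
  fix t assume t: "decseq t \<and> t \<longlonglongrightarrow> 0 \<and> (\<forall>\<sigma>>0. card {k. t k = \<sigma>} =
      cfun.dim {f \<in> H. adjoint_op a H T (T f) = (\<lambda>z. of_real (\<sigma>\<^sup>2) * f z)})"
  show "t = s"
    by (rule decseq_eq_if_multiplicities_eq) (use t eigen_decseq eigen_tendsto_0 eigenspace_dim in auto)
qed

end

end

end

subsection \<open>The trace of a Toeplitz operator\<close>

context rkhs
begin

lemma kernel_sym: "K z w = cnj (K w z)"
  using repro[OF kernel_mem, of z w] repro[OF kernel_mem, of w z] L2_inner_cnj[of a "K w" "K z"] by simp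

lemma kernel_diag: "Re (K w w) = (nm (K w))\<^sup>2"
  unfolding nm_square repro[OF kernel_mem] ..

context
  fixes \<mu> :: "(complex^'n) measure"
  assumes sets_mu: "sets \<mu> = sets borel"
begin

lemma pos_form_toeplitz:
  assumes q: "q_bounded a \<mu> H"
  shows "pos_form (\<lambda>f g. ip (toeplitz a \<mu> H f) g)"
proof -
  note T = toeplitz_properties[OF sets_mu q]
  note B = pos_form_rules[OF pos_form_q[OF sets_mu q]]
  show ?thesis unfolding pos_form_def
  proof (intro conjI ballI allI)
    fix f g h c assume f: "f \<in> H" and g: "g \<in> H" and h: "h \<in> H"
    show "ip (toeplitz a \<mu> H (f + g)) h = ip (toeplitz a \<mu> H f) h + ip (toeplitz a \<mu> H g) h"
      by (simp only: T(2)[OF H_add[OF f g] h] T(2)[OF f h] T(2)[OF g h] B(1)[OF f g h])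
  next
    fix f h c assume f: "f \<in> H" and h: "h \<in> H"
    show "ip (toeplitz a \<mu> H (sc c f)) h = c * ip (toeplitz a \<mu> H f) h"
      by (simp only: T(2)[OF H_sc[OF f] h] T(2)[OF f h] B(2)[OF f h h])
    show "ip (toeplitz a \<mu> H h) f = cnj (ip (toeplitz a \<mu> H f) h)"
      unfolding T(2)[OF f h] T(2)[OF h f] by (rule B(3)[OF f h h])
    show "0 \<le> Re (ip (toeplitz a \<mu> H f) f)"
      unfolding T(2)[OF f f] by (rule B(4)[OF f f f])
  qed
qed

text \<open>The constant 1 belongs to H, so e^(-|z|^2/a) is \<mu>-integrable; being bounded below on
  balls, it forces every ball to have finite measure. This is what admits Tonelli before \<mu> is
  known to be finite.\<close>

lemma sigma_finite_mu:
  assumes q: "q_bounded a \<mu> H"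
  shows "sigma_finite_measure \<mu>"
proof
  have sp: "space \<mu> = UNIV" by (rule space_mu[OF sets_mu])
  have fin: "emeasure \<mu> (cball 0 (real n)) \<noteq> \<infinity>" for n
  proof -
    have int: "integrable \<mu> (\<lambda>z. exp (- (norm z)\<^sup>2 / a))"
      using q[unfolded q_bounded_def, THEN conjunct1, rule_format, OF one one]
      by (simp add: complex_of_real_integrable_eq)
    let ?c = "exp (- (real n)\<^sup>2 / a)"
    have "ennreal ?c * emeasure \<mu> (cball 0 (real n)) = (\<integral>\<^sup>+z. ennreal ?c * indicator (cball 0 (real n)) z \<partial>\<mu>)"
      by (subst nn_integral_cmult_indicator) (auto simp: sets_mu)
    also have "\<dots> \<le> (\<integral>\<^sup>+z. ennreal (exp (- (norm z)\<^sup>2 / a)) \<partial>\<mu>)"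
    proof (rule nn_integral_mono)
      fix z :: "complex^'n"
      have "?c \<le> exp (- (norm z)\<^sup>2 / a)" if "norm z \<le> real n"
        using that pos by (auto intro!: divide_right_mono power_mono)
      then show "ennreal ?c * indicator (cball 0 (real n)) z \<le> ennreal (exp (- (norm z)\<^sup>2 / a))"
        by (auto simp: indicator_def intro!: ennreal_leI)
    qed
    also have "\<dots> < \<infinity>" using int by (subst nn_integral_eq_integral) auto
    finally show ?thesis by (auto simp: ennreal_mult_less_top ennreal_mult_eq_top_iff)
  qed
  show "\<exists>A. countable A \<and> A \<subseteq> sets \<mu> \<and> \<Union> A = space \<mu> \<and> (\<forall>a\<in>A. emeasure \<mu> a \<noteq> \<infinity>)"
  proof (intro exI[of _ "range (\<lambda>n::nat. cball 0 (real n))"] conjI)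
    show "\<Union> (range (\<lambda>n::nat. cball 0 (real n))) = space \<mu>"
      unfolding sp using real_arch_simple by auto
  qed (use fin in \<open>auto simp: sets_mu\<close>)
qed

text \<open>Integrating \<open>\<langle>T K\<^sub>z, K\<^sub>z\<rangle> = \<Sum>s\<^sub>k \<bar>e\<^sub>k(z)\<bar>\<^sup>2\<close> against the Gaussian measure gives the sum of the
  eigenvalues, while by Tonelli it gives \<open>\<integral> K(w,w) e\<^bsup>-|w|\<^sup>2/a\<^esup> d\<mu>(w)\<close>. No orthonormal basis of \<open>H\<close>
  is needed.\<close>

lemma trace_toeplitz:
  assumes q: "q_bounded a \<mu> H" and compact: "compact_operator a H (toeplitz a \<mu> H)"
  defines "\<sigma> \<equiv> singular_values a H (toeplitz a \<mu> H)"
  shows "(\<Sum>k. ennreal (\<sigma> k)) = (\<integral>\<^sup>+w. ennreal (Re (K w w) * exp (- (norm w)\<^sup>2 / a)) \<partial>\<mu>)"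
    and "\<sigma> k \<ge> 0"
proof -
  let ?T = "toeplitz a \<mu> H"
  note T = toeplitz_properties[OF sets_mu q]
  note form = pos_form_toeplitz[OF q]
  obtain e s where es: "eigenpairs ?T e s" using eigenpairs_exist[OF compact form] by blast
  have \<sigma>: "\<sigma> = s" unfolding \<sigma>_def by (rule singular_values_eq[OF compact form es])
  note eigen = eigen[OF compact form es]
  show "\<sigma> k \<ge> 0" unfolding \<sigma> by (rule eigen)
  interpret M: sigma_finite_measure \<mu> by (rule sigma_finite_mu[OF q])
  interpret pair_sigma_finite \<mu> "gauss_measure a :: (complex^'n) measure"
    by (intro pair_sigma_finite.intro sigma_finite_gauss[OF pos] M.sigma_finite_measure_axioms)
  have [measurable_cong]: "sets \<mu> = sets borel" by (rule sets_mu)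
  have [measurable]: "(\<lambda>x. K (fst x) (snd x)) \<in> borel_measurable (borel \<Otimes>\<^sub>M borel)"
    using kernel_measurable by (simp add: case_prod_beta')
  have [measurable]: "e k \<in> borel_measurable borel" for k by (intro H_measurable eigen)
  have sum_z: "ennreal (Re (ip (?T (K z)) (K z))) = (\<Sum>k. ennreal (s k) * ennreal ((norm (e k z))\<^sup>2))" for z
  proof -
    \<comment> \<open>The coefficients of \<open>K z\<close> are point values: <K_z, e_k> is the
      conjugate of e_k(z).\<close>
    have "norm (ip (K z) (e k)) = norm (e k z)" for k
      using L2_inner_cnj[of a "K z" "e k"] repro[OF eigen(1), of k z] complex_mod_cnj by metis
    then have "(\<lambda>k. s k * (norm (e k z))\<^sup>2) sums Re (ip (?T (K z)) (K z))"
      using eigen_expansion[OF compact form es kernel_mem, of z] by simp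
    then have "(\<Sum>k. ennreal (s k * (norm (e k z))\<^sup>2)) = ennreal (Re (ip (?T (K z)) (K z)))"
      by (intro suminf_ennreal_eq) (auto simp: eigen)
    then show ?thesis by (simp add: ennreal_mult eigen)
  qed
  have "(\<integral>\<^sup>+z. ennreal (Re (ip (?T (K z)) (K z))) \<partial>gauss_measure a)
      = (\<Sum>k. \<integral>\<^sup>+z. ennreal (s k) * ennreal ((norm (e k z))\<^sup>2) \<partial>gauss_measure a)"
    unfolding sum_z by (rule nn_integral_suminf) measurable
  also have "\<dots> = (\<Sum>k. ennreal (s k))"
  proof (rule arg_cong[where f = suminf], rule ext)
    fix k
    have "(\<integral>\<^sup>+z. ennreal (s k) * ennreal ((norm (e k z))\<^sup>2) \<partial>gauss_measure a) = ennreal (s k) * ennreal ((nm (e k))\<^sup>2)"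
      by (subst nn_integral_cmult) (auto simp: ennreal_L2_norm_square[OF sqi[OF eigen(1)]])
    \<comment> \<open>The vector is a unit vector when s(k) > 0; otherwise the factor s(k) = 0
      absorbs the norm.\<close>
    also have "\<dots> = ennreal (s k)"
      using eigen(2)[of k] eigen(4)[of k] by (cases "s k = 0") auto
    finally show "(\<integral>\<^sup>+z. ennreal (s k) * ennreal ((norm (e k z))\<^sup>2) \<partial>gauss_measure a) = ennreal (s k)" .
  qed
  finally have 1: "(\<integral>\<^sup>+z. ennreal (Re (ip (?T (K z)) (K z))) \<partial>gauss_measure a) = (\<Sum>k. ennreal (\<sigma> k))"
    by (simp add: \<sigma>)
  let ?E = "\<lambda>w::complex^'n. ennreal (exp (- (norm w)\<^sup>2 / a))"
  have "(\<integral>\<^sup>+z. ennreal (Re (ip (?T (K z)) (K z))) \<partial>gauss_measure a)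
      = (\<integral>\<^sup>+z. (\<integral>\<^sup>+w. ennreal ((norm (K z w))\<^sup>2) * ?E w \<partial>\<mu>) \<partial>gauss_measure a)"
    by (simp only: T(2)[OF kernel_mem kernel_mem] Re_q_form_self[OF sets_mu q kernel_mem])
  also have "\<dots> = (\<integral>\<^sup>+w. (\<integral>\<^sup>+z. ennreal ((norm (K z w))\<^sup>2) * ?E w \<partial>gauss_measure a) \<partial>\<mu>)"
  proof (rule Fubini')
    have "(\<lambda>x. (\<lambda>y. K (fst y) (snd y)) (snd x, fst x)) \<in> borel_measurable (\<mu> \<Otimes>\<^sub>M gauss_measure a)"
      by measurable
    then have [measurable]: "(\<lambda>x. K (snd x) (fst x)) \<in> borel_measurable (\<mu> \<Otimes>\<^sub>M gauss_measure a)" by simp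
    show "(\<lambda>(w, z). ennreal ((norm (K z w))\<^sup>2) * ?E w) \<in> borel_measurable (\<mu> \<Otimes>\<^sub>M gauss_measure a)"
      unfolding case_prod_beta' by measurable
  qed
  also have "\<dots> = (\<integral>\<^sup>+w. ennreal (Re (K w w) * exp (- (norm w)\<^sup>2 / a)) \<partial>\<mu>)"
  proof (rule nn_integral_cong)
    fix w
    \<comment> \<open>Hermitian symmetry lets the inner integration run over the second argument of
      the kernel, producing the squared norm of \<open>K w\<close>, that is K(w,w).\<close>
    have n: "norm (K z w) = norm (K w z)" for z by (subst kernel_sym) simp
    have [measurable]: "K w \<in> borel_measurable borel" by (intro H_measurable kernel_mem)
    have "(\<integral>\<^sup>+z. ennreal ((norm (K z w))\<^sup>2) * ?E w \<partial>gauss_measure a) = ennreal ((nm (K w))\<^sup>2) * ?E w"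
      unfolding n ennreal_L2_norm_square[OF sqi[OF kernel_mem]] by (rule nn_integral_multc) measurable
    then show "(\<integral>\<^sup>+z. ennreal ((norm (K z w))\<^sup>2) * ?E w \<partial>gauss_measure a) = ennreal (Re (K w w) * exp (- (norm w)\<^sup>2 / a))"
      by (simp add: kernel_diag ennreal_mult)
  qed
  finally show "(\<Sum>k. ennreal (\<sigma> k)) = (\<integral>\<^sup>+w. ennreal (Re (K w w) * exp (- (norm w)\<^sup>2 / a)) \<partial>\<mu>)"
    using 1 by simp
qed

text \<open>Evaluation satisfies |f(z)|^2 \<le> ||f||^2 K(z,z), so the weighted integrand is at most
  A ||f|| ||g||. This single bound gives boundedness of the form and the majorant for dominated
  convergence.\<close>

lemma toeplitz_finite_measure:
  assumes fin: "emeasure \<mu> UNIV < \<infinity>" and A: "\<And>w. Re (K w w) * exp (- (norm w)\<^sup>2 / a) \<le> A"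
  shows "q_bounded a \<mu> H" "compact_operator a H (toeplitz a \<mu> H)"
proof -
  have sp: "space \<mu> = UNIV" by (rule space_mu[OF sets_mu])
  interpret finite_measure \<mu> by standard (use fin in \<open>simp add: sp\<close>)
  have [measurable_cong]: "sets \<mu> = sets borel" by (rule sets_mu)
  let ?E = "\<lambda>w::complex^'n. exp (- (norm w)\<^sup>2 / a)"
  let ?F = "\<lambda>f g z. f z * cnj (g z) * complex_of_real (?E z)"
  have bound: "norm (?F f g z) \<le> A * (nm f * nm g)" if f: "f \<in> H" and g: "g \<in> H" for f g z
  proof -
    have "norm (?F f g z) = norm (f z) * norm (g z) * ?E z" by (simp add: norm_mult)
    also have "\<dots> \<le> (nm f * nm (K z)) * (nm g * nm (K z)) * ?E z"
      by (intro mult_mono eval_bound f g mult_nonneg_nonneg) auto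
    also have "\<dots> = (nm f * nm g) * (Re (K z z) * ?E z)"
      by (simp add: kernel_diag power2_eq_square mult_ac)
    also have "\<dots> \<le> (nm f * nm g) * A" by (intro mult_left_mono A) auto
    finally show ?thesis by (simp add: mult_ac)
  qed
  have meas: "?F f g \<in> borel_measurable \<mu>" if f: "f \<in> H" and g: "g \<in> H" for f g
  proof -
    note [measurable] = H_measurable[OF f] H_measurable[OF g]
    show ?thesis by measurable
  qed
  have int: "integrable \<mu> (?F f g)" if f: "f \<in> H" and g: "g \<in> H" for f g
    by (rule integrable_const_bound[OF always_eventually meas[OF f g]]) (use bound[OF f g] in auto)
  have qb: "norm (q_form a \<mu> f g) \<le> A * measure \<mu> UNIV * nm f * nm g" if f: "f \<in> H" and g: "g \<in> H" for f g
  proof -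
    have "norm (q_form a \<mu> f g) \<le> (\<integral>z. norm (?F f g z) \<partial>\<mu>)"
      unfolding q_form_def by (rule integral_norm_bound)
    also have "\<dots> \<le> (\<integral>z. A * (nm f * nm g) \<partial>\<mu>)"
      by (intro integral_mono integrable_norm int f g bound) auto
    also have "\<dots> = A * measure \<mu> UNIV * nm f * nm g" by (simp add: sp mult_ac)
    finally show ?thesis .
  qed
  show q: "q_bounded a \<mu> H" unfolding q_bounded_def using int qb by blast
  let ?T = "toeplitz a \<mu> H"
  note T = toeplitz_properties[OF sets_mu q]
  note form = pos_form_q[OF sets_mu q]
  define C1 where "C1 = \<bar>A * measure \<mu> UNIV\<bar>"
  \<comment> \<open>Cauchy-Schwarz for q at f and T f. It turns q(d, d) -> 0 into norm convergence
    of T d, so that bounded pointwise convergence of d is enough.\<close>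
  have T_le: "(nm (?T f))\<^sup>2 \<le> C1 * Re (q_form a \<mu> f f)" if f: "f \<in> H" for f
  proof -
    have Tf: "?T f \<in> H" by (rule bounded_operatorD(1)[OF T(1) f])
    have qT: "q_form a \<mu> f (?T f) = of_real ((nm (?T f))\<^sup>2)"
      using T(2)[OF f Tf] L2_inner_self by metis
    have "Re (q_form a \<mu> (?T f) (?T f)) \<le> A * measure \<mu> UNIV * nm (?T f) * nm (?T f)"
      using qb[OF Tf Tf] complex_Re_le_cmod order.trans by blast
    also have "\<dots> \<le> C1 * nm (?T f) * nm (?T f)"
      unfolding C1_def by (intro mult_right_mono) auto
    finally have 2: "Re (q_form a \<mu> (?T f) (?T f)) \<le> C1 * (nm (?T f))\<^sup>2" by (simp add: power2_eq_square)
    have "((nm (?T f))\<^sup>2)\<^sup>2 = (norm (q_form a \<mu> f (?T f)))\<^sup>2"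
      by (simp only: qT norm_of_real abs_power2)
    also have "\<dots> \<le> Re (q_form a \<mu> f f) * Re (q_form a \<mu> (?T f) (?T f))"
      by (rule pos_form_CS[OF form f Tf])
    also have "\<dots> \<le> Re (q_form a \<mu> f f) * (C1 * (nm (?T f))\<^sup>2)"
      by (intro mult_left_mono 2 pos_form_rules(4)[OF form f f f])
    finally have "(nm (?T f))\<^sup>2 * (nm (?T f))\<^sup>2 \<le> (C1 * Re (q_form a \<mu> f f)) * (nm (?T f))\<^sup>2"
      by (simp add: power2_eq_square mult_ac)
    moreover have "0 \<le> C1 * Re (q_form a \<mu> f f)"
      using pos_form_rules(4)[OF form f f f] by (simp add: C1_def)
    ultimately show ?thesis by (rule mult_self_le_imp_le) simp
  qed
  show "compact_operator a H ?T"
    unfolding compact_operator_def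
  proof (intro conjI allI impI)
    show "bounded_operator a H ?T" by (rule T)
    fix x :: "nat \<Rightarrow> complex^'n \<Rightarrow> complex"
    assume "range x \<subseteq> H \<and> (\<exists>C. \<forall>k. nm (x k) \<le> C)"
    then obtain C where x: "\<And>k. x k \<in> H" and C: "\<And>k. nm (x k) \<le> C" by blast
    have "\<exists>y\<in>H. \<exists>r. strict_mono r \<and> (\<forall>z. (\<lambda>k. x (r k) z) \<longlonglongrightarrow> y z)"
      by (rule montel[OF x C])
    then obtain y and r :: "nat \<Rightarrow> nat" where y: "y \<in> H" and r: "strict_mono r" and lim: "\<And>z. (\<lambda>k. x (r k) z) \<longlonglongrightarrow> y z"
      by blast
    define d where "d k = x (r k) - y" for k
    have d: "d k \<in> H" for k unfolding d_def by (intro H_diff x y)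
    have nd: "nm (d k) \<le> C + nm y" for k
      using nm_triangle3[OF x H_zero y, of "r k"] C[of "r k"] nm_minus_commute[of 0 y] by (simp add: d_def)
    have "(\<lambda>k. (\<integral>z. ?F (d k) (d k) z \<partial>\<mu>)) \<longlonglongrightarrow> (\<integral>z. 0 \<partial>\<mu>)"
    proof (rule integral_dominated_convergence)
      show "integrable \<mu> (\<lambda>z. \<bar>A\<bar> * ((C + nm y) * (C + nm y)))" by simp
      show "AE z in \<mu>. (\<lambda>k. ?F (d k) (d k) z) \<longlonglongrightarrow> 0"
      proof (rule AE_I2)
        fix z
        have "(\<lambda>k. d k z) \<longlonglongrightarrow> 0" using LIM_zero[OF lim[of z]] by (simp add: d_def)
        from tendsto_mult[OF tendsto_mult[OF this tendsto_cnj[OF this]] tendsto_const[of "complex_of_real (?E z)"]]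
        show "(\<lambda>k. ?F (d k) (d k) z) \<longlonglongrightarrow> 0" by simp
      qed
      show "AE z in \<mu>. norm (?F (d k) (d k) z) \<le> \<bar>A\<bar> * ((C + nm y) * (C + nm y))" for k
      proof (rule AE_I2)
        fix z
        have "norm (?F (d k) (d k) z) \<le> A * (nm (d k) * nm (d k))" by (rule bound[OF d d])
        also have "\<dots> \<le> \<bar>A\<bar> * (nm (d k) * nm (d k))" by (intro mult_right_mono) auto
        also have "\<dots> \<le> \<bar>A\<bar> * ((C + nm y) * (C + nm y))"
          using order.trans[OF L2_norm_nonneg nd] by (intro mult_left_mono mult_mono nd) auto
        finally show "norm (?F (d k) (d k) z) \<le> \<bar>A\<bar> * ((C + nm y) * (C + nm y))" .
      qed
    qed (use meas d in auto)
    then have "(\<lambda>k. Re (q_form a \<mu> (d k) (d k))) \<longlonglongrightarrow> Re 0"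
      unfolding q_form_def by (intro tendsto_Re) simp
    then have "(\<lambda>k. C1 * Re (q_form a \<mu> (d k) (d k))) \<longlonglongrightarrow> 0"
      using tendsto_mult_right_zero by simp
    then have "(\<lambda>k. (nm (?T (d k)))\<^sup>2) \<longlonglongrightarrow> 0"
      by (rule Lim_null_comparison[OF always_eventually, rotated]) (use T_le d in auto)
    from tendsto_real_sqrt[OF this] have "(\<lambda>k. nm (?T (d k))) \<longlonglongrightarrow> 0" by simp
    moreover have "?T (d k) = ?T (x (r k)) - ?T y" for k
      unfolding d_def by (rule operator_diff[OF T(1) x y])
    ultimately have "(\<lambda>k. nm (?T (x (r k)) - ?T y)) \<longlonglongrightarrow> 0" by (simp only:)
    then show "\<exists>y\<in>H. \<exists>r. strict_mono r \<and> (\<lambda>k. nm (?T (x (r k)) - y)) \<longlonglongrightarrow> 0"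
      using r bounded_operatorD(1)[OF T(1) y] by blast
  qed
qed

end

text \<open>The lower bound 1 makes the trace dominate the total mass, hence trace class implies
  finite measure; the upper bound A supplies boundedness and integrability for the converse.\<close>

lemma finite_iff_trace_class:
  assumes sets_mu: "sets \<mu> = sets borel"
    and A: "\<And>w. Re (K w w) * exp (- (norm w)\<^sup>2 / a) \<le> A"
    and one_le: "\<And>w. 1 \<le> Re (K w w) * exp (- (norm w)\<^sup>2 / a)"
  shows "emeasure \<mu> UNIV < \<infinity> \<longleftrightarrow> q_bounded a \<mu> H \<and> trace_class a H (toeplitz a \<mu> H)"
    and "emeasure \<mu> UNIV < \<infinity> \<Longrightarrow>
      trace_norm a H (toeplitz a \<mu> H) = (\<integral>w. Re (K w w) * exp (- (norm w)\<^sup>2 / a) \<partial>\<mu>)"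
proof -
  let ?s = "singular_values a H (toeplitz a \<mu> H)"
  let ?k = "\<lambda>w. Re (K w w) * exp (- (norm w)\<^sup>2 / a)"
  have sp: "space \<mu> = UNIV" by (rule space_mu[OF sets_mu])
  have [measurable_cong]: "sets \<mu> = sets borel" by (rule sets_mu)
  have [measurable]: "(\<lambda>x. K (fst x) (snd x)) \<in> borel_measurable (borel \<Otimes>\<^sub>M borel)"
    using kernel_measurable by (simp add: case_prod_beta')
  \<comment> \<open>Measurability on the diagonal, by composing the jointly measurable kernel with w
    -> (w, w).\<close>
  have "(\<lambda>w. (\<lambda>x. K (fst x) (snd x)) (w, w)) \<in> borel_measurable borel" by measurable
  then have [measurable]: "(\<lambda>w. K w w) \<in> borel_measurable borel" by simp
  have k: "integrable \<mu> ?k" if fin: "emeasure \<mu> UNIV < \<infinity>"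
  proof -
    interpret finite_measure \<mu> by standard (use fin in \<open>simp add: sp\<close>)
    have "norm (?k w) \<le> A" for w using A[of w] one_le[of w] by simp
    then show ?thesis by (intro integrable_const_bound[OF always_eventually]) auto
  qed
  have fwd: "q_bounded a \<mu> H \<and> trace_class a H (toeplitz a \<mu> H) \<and>
      trace_norm a H (toeplitz a \<mu> H) = (\<integral>w. ?k w \<partial>\<mu>)" if fin: "emeasure \<mu> UNIV < \<infinity>"
  proof -
    note qc = toeplitz_finite_measure[OF sets_mu fin A]
    note tr = trace_toeplitz[OF sets_mu qc]
    have k0: "0 \<le> ?k w" for w using one_le[of w] by linarith
    have "(\<integral>\<^sup>+w. ennreal (?k w) \<partial>\<mu>) = ennreal (\<integral>w. ?k w \<partial>\<mu>)"
      by (intro nn_integral_eq_integral k fin) (use k0 in auto)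
    then have sum: "(\<Sum>i. ennreal (?s i)) = ennreal (\<integral>w. ?k w \<partial>\<mu>)" using tr(1) by simp
    then have "summable ?s"
      by (intro summable_suminf_not_top tr(2)) simp
    moreover have "ennreal (\<Sum>i. ?s i) = ennreal (\<integral>w. ?k w \<partial>\<mu>)"
      using suminf_ennreal2[OF tr(2) \<open>summable ?s\<close>] sum by simp
    then have "(\<Sum>i. ?s i) = (\<integral>w. ?k w \<partial>\<mu>)"
      using suminf_nonneg[OF \<open>summable ?s\<close> tr(2)] k0 by (subst (asm) ennreal_inj) auto
    ultimately show ?thesis using qc by (simp add: trace_class_def trace_norm_def)
  qed
  show "emeasure \<mu> UNIV < \<infinity> \<Longrightarrow> trace_norm a H (toeplitz a \<mu> H) = (\<integral>w. ?k w \<partial>\<mu>)"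
    using fwd by blast
  show "emeasure \<mu> UNIV < \<infinity> \<longleftrightarrow> q_bounded a \<mu> H \<and> trace_class a H (toeplitz a \<mu> H)"
  proof
    assume "q_bounded a \<mu> H \<and> trace_class a H (toeplitz a \<mu> H)"
    then have q: "q_bounded a \<mu> H" and c: "compact_operator a H (toeplitz a \<mu> H)" and s: "summable ?s"
      by (auto simp: trace_class_def)
    note tr = trace_toeplitz[OF sets_mu q c]
    have "emeasure \<mu> UNIV = (\<integral>\<^sup>+w. 1 \<partial>\<mu>)" by (simp add: sp)
    also have "\<dots> \<le> (\<integral>\<^sup>+w. ennreal (?k w) \<partial>\<mu>)"
      by (intro nn_integral_mono) (use one_le in \<open>auto simp: ennreal_1[symmetric] simp del: ennreal_1 intro!: ennreal_leI\<close>)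
    also have "\<dots> = ennreal (\<Sum>i. ?s i)"
      unfolding tr(1)[symmetric] by (rule suminf_ennreal2[OF tr(2) s])
    also have "\<dots> < \<infinity>" by simp
    finally show "emeasure \<mu> UNIV < \<infinity>" .
  qed (use fwd in blast)
qed

end

subsection \<open>The Fock space and the pluriharmonic Fock space\<close>

lemma square_integrable_cnj: "square_integrable a f \<Longrightarrow> square_integrable a (\<lambda>z. cnj (f z))"
  by (auto simp: square_integrable_def)

text \<open>A crude replacement for Cauchy-Schwarz at a stage where the locale is not yet
  instantiated; any bound in terms of the two norms yields local boundedness.\<close>

lemma L2_inner_bound:
  assumes "square_integrable a f" "square_integrable a g"
  shows "norm (L2_inner a f g) \<le> (L2_norm a f)\<^sup>2 + (L2_norm a g)\<^sup>2"
proof -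
  have i: "integrable (gauss_measure a) (\<lambda>z. (norm (f z))\<^sup>2)" "integrable (gauss_measure a) (\<lambda>z. (norm (g z))\<^sup>2)"
    using assms by (auto simp: square_integrable_def)
  have "norm (L2_inner a f g) \<le> (\<integral>z. norm (f z * cnj (g z)) \<partial>gauss_measure a)"
    unfolding L2_inner_def by (rule integral_norm_bound)
  also have "\<dots> \<le> (\<integral>z. (norm (f z))\<^sup>2 + (norm (g z))\<^sup>2 \<partial>gauss_measure a)"
  proof (rule integral_mono)
    show "norm (f z * cnj (g z)) \<le> (norm (f z))\<^sup>2 + (norm (g z))\<^sup>2" for z
      by (simp add: norm_mult mult_le_sum_squares)
  qed (use i integrable_inner_product[OF assms] in auto)
  also have "\<dots> = (L2_norm a f)\<^sup>2 + (L2_norm a g)\<^sup>2"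
    using i by (simp add: L2_norm_def)
  finally show ?thesis .
qed

section \<open>The Fock kernel and circle means of entire functions\<close>

definition hdot :: "complex^'n \<Rightarrow> complex^'n \<Rightarrow> complex" where
  "hdot z w = (\<Sum>j\<in>UNIV. z $ j * cnj (w $ j))"

lemma hdot_add_right: "hdot w (x + y) = hdot w x + hdot w y"
  by (simp add: hdot_def algebra_simps sum.distrib)

lemma hdot_scalar_left: "hdot (c *s x) w = c * hdot x w"
  by (simp add: hdot_def algebra_simps sum_distrib_left)

lemma hdot_cnj: "cnj (hdot z w) = hdot w z"
  by (simp add: hdot_def mult.commute)

lemma hdot_zero [simp]: "hdot 0 w = 0" "hdot w 0 = 0"
  by (simp_all add: hdot_def)

lemma Re_hdot: "Re (hdot z w) = z \<bullet> w"
  by (simp add: hdot_def inner_vec_def inner_complex_def)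

lemma hdot_self: "hdot z z = of_real ((norm z)\<^sup>2)"
proof -
  have "Im (hdot z z) = 0" using hdot_cnj[of z z] by (simp add: complex_eq_iff)
  then show ?thesis using Re_hdot[of z z] by (simp add: complex_eq_iff power2_norm_eq_inner)
qed

lemma bounded_linear_hdot: "bounded_linear (\<lambda>z. hdot z w)"
proof -
  have "linear (\<lambda>z. hdot z w)"
    by (auto simp: linear_iff hdot_def algebra_simps sum.distrib scaleR_sum_right)
  then show ?thesis by (simp add: linear_conv_bounded_linear)
qed

lemma entire_hdot: "entire (\<lambda>z. hdot z w)"
  by (rule entireI[where D = "\<lambda>z v. hdot v w"])
    (auto intro: bounded_linear_imp_has_derivative bounded_linear_hdot simp: hdot_scalar_left)

lemma continuous_on_hdot [continuous_intros]:
  "continuous_on S f \<Longrightarrow> continuous_on S g \<Longrightarrow> continuous_on S (\<lambda>x. hdot (f x) (g x))"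
  unfolding hdot_def by (intro continuous_intros)

definition fock_kernel :: "real \<Rightarrow> complex^'n \<Rightarrow> complex^'n \<Rightarrow> complex" where
  "fock_kernel a w z = exp (hdot z w / of_real a)"

lemma entire_fock_kernel: "entire (fock_kernel a w)"
  unfolding fock_kernel_def[abs_def] divide_inverse mult.commute[of _ "inverse _"]
  by (intro entire_exp entire_cmult entire_hdot)

lemma fock_kernel_diag: "fock_kernel a w w = of_real (exp ((norm w)\<^sup>2 / a))"
  by (simp add: fock_kernel_def hdot_self exp_of_real[symmetric])

lemma entire_measurable: "entire f \<Longrightarrow> f \<in> borel_measurable borel"
  by (intro borel_measurable_continuous_onI entire_continuous_on)

lemma circle_integrable:
  fixes \<phi> :: "real \<Rightarrow> 'b::euclidean_space"
  assumes "continuous_on UNIV \<phi>"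
  shows "set_integrable lborel {0..1} \<phi>"
  by (rule borel_integrable_atLeastAtMost') (rule continuous_on_subset[OF assms subset_UNIV])

lemma entire_circle_mean:
  assumes "entire f"
  shows "(LINT t:{0..1}|lborel. f (cis (2 * pi * t) *s z)) = f 0"
  using circle_mean_value[OF entire_line_holomorphic[OF assms, of 0 z]] by simp

lemma continuous_on_circle:
  assumes "entire f" shows "continuous_on S (\<lambda>t. f (cis (2 * pi * t) *s z))"
  by (intro continuous_on_compose2[OF entire_continuous_on[OF assms, of UNIV]] continuous_intros) auto

text \<open>On each circle centred at the origin, \<open>g\<close> and the conjugate of \<open>h\<close> are orthogonal, because
  \<open>g h\<close> is holomorphic and vanishes at 0.\<close>

lemma nn_integral_pluriharmonic_split:
  fixes g h :: "complex^'n \<Rightarrow> complex"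
  assumes a: "a > 0" and g: "entire g" and h: "entire h" and h0: "h 0 = 0"
  shows "(\<integral>\<^sup>+z. ennreal ((norm (g z + cnj (h z)))\<^sup>2) \<partial>gauss_measure a) =
    (\<integral>\<^sup>+z. ennreal ((norm (g z))\<^sup>2) \<partial>gauss_measure a) + (\<integral>\<^sup>+z. ennreal ((norm (h z))\<^sup>2) \<partial>gauss_measure a)"
proof -
  note [measurable] = entire_measurable[OF g] entire_measurable[OF h]
  note [continuous_intros] = continuous_on_circle[OF g] continuous_on_circle[OF h]
  let ?A = "\<lambda>z. (norm (g z + cnj (h z)))\<^sup>2" and ?B = "\<lambda>z. (norm (g z))\<^sup>2 + (norm (h z))\<^sup>2"
  let ?c = "\<lambda>t z. cis (2 * pi * t) *s z"
  have nn: "(\<integral>\<^sup>+t. ennreal (\<phi> t) * indicator {0..1} t \<partial>lborel) = ennreal (LINT t:{0..1}|lborel. \<phi> t)"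
    if "continuous_on UNIV \<phi>" "\<And>t. 0 \<le> \<phi> t" for \<phi> :: "real \<Rightarrow> real"
  proof -
    have "(\<integral>\<^sup>+t. ennreal (\<phi> t) * indicator {0..1} t \<partial>lborel) = (\<integral>\<^sup>+t. ennreal (indicator {0..1} t *\<^sub>R \<phi> t) \<partial>lborel)"
      by (intro nn_integral_cong) (auto simp: indicator_def)
    also have "\<dots> = ennreal (LINT t:{0..1}|lborel. \<phi> t)"
      unfolding set_lebesgue_integral_def
      using circle_integrable[OF that(1)] that(2) by (intro nn_integral_eq_integral) (auto simp: set_integrable_def)
    finally show ?thesis .
  qed
  have circ: "(LINT t:{0..1}|lborel. ?A (?c t z)) = (LINT t:{0..1}|lborel. ?B (?c t z))" for z
  proof -
    let ?G = "\<lambda>t. g (?c t z) * h (?c t z)"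
    have G0: "(LINT t:{0..1}|lborel. ?G t) = 0"
      using entire_circle_mean[OF entire_mult[OF g h], of z] h0 by simp
    have Gi: "set_integrable lborel {0..1} ?G" by (intro circle_integrable continuous_intros)
    have "(LINT t:{0..1}|lborel. Re (?G t)) = Re (LINT t:{0..1}|lborel. ?G t)"
      using Gi unfolding set_lebesgue_integral_def set_integrable_def
      by (subst integral_Re[symmetric]) (auto simp: scaleR_conv_of_real[symmetric])
    then have "(LINT t:{0..1}|lborel. Re (?G t)) = 0" by (simp only: G0 zero_complex.sel)
    then have R0: "(LINT t:{0..1}|lborel. 2 * Re (?G t)) = 0" by (simp only: set_integral_mult_right mult_zero_right)
    have "?A y = ?B y + 2 * Re (g y * h y)" for y
      unfolding cmod_power2 by (simp add: power2_eq_square algebra_simps)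
    then have "(LINT t:{0..1}|lborel. ?A (?c t z)) = (LINT t:{0..1}|lborel. ?B (?c t z) + 2 * Re (?G t))"
      by (simp only:)
    also have "\<dots> = (LINT t:{0..1}|lborel. ?B (?c t z)) + (LINT t:{0..1}|lborel. 2 * Re (?G t))"
      by (rule set_integral_add; intro circle_integrable continuous_intros)
    finally show ?thesis using R0 by simp
  qed
  have "(\<integral>\<^sup>+z. ennreal (?A z) \<partial>gauss_measure a) =
     (\<integral>\<^sup>+z. (\<integral>\<^sup>+t. ennreal (?A (?c t z)) * indicator {0..1} t \<partial>lborel) \<partial>gauss_measure a)"
    by (rule nn_integral_gauss_circle[OF a, symmetric]) measurable
  also have "\<dots> = (\<integral>\<^sup>+z. (\<integral>\<^sup>+t. ennreal (?B (?c t z)) * indicator {0..1} t \<partial>lborel) \<partial>gauss_measure a)"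
  proof (rule nn_integral_cong)
    fix z
    have c: "continuous_on UNIV (\<lambda>t. ?A (?c t z))" "continuous_on UNIV (\<lambda>t. ?B (?c t z))"
      by (intro continuous_intros)+
    have "0 \<le> ?A y" "0 \<le> ?B y" for y by auto
    then show "(\<integral>\<^sup>+t. ennreal (?A (?c t z)) * indicator {0..1} t \<partial>lborel) =
        (\<integral>\<^sup>+t. ennreal (?B (?c t z)) * indicator {0..1} t \<partial>lborel)"
      by (simp only: nn[OF c(1)] nn[OF c(2)] circ)
  qed
  also have "\<dots> = (\<integral>\<^sup>+z. ennreal (?B z) \<partial>gauss_measure a)"
    by (rule nn_integral_gauss_circle[OF a]) measurable
  also have "\<dots> = (\<integral>\<^sup>+z. ennreal ((norm (g z))\<^sup>2) \<partial>gauss_measure a) + (\<integral>\<^sup>+z. ennreal ((norm (h z))\<^sup>2) \<partial>gauss_measure a)"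
    by (simp add: nn_integral_add)
  finally show ?thesis .
qed

context
  fixes a :: real
  assumes a: "a > 0"
begin

lemma entire_gauss_mean:
  fixes f :: "complex^'n \<Rightarrow> complex"
  assumes f: "entire f" and int: "integrable (gauss_measure a) f"
  shows "(\<integral>z. f z \<partial>gauss_measure a) = f 0"
  by (rule integral_gauss_circle_mean[OF a entire_measurable[OF f] int entire_circle_mean[OF f]])

lemma norm_fock_kernel: "norm (fock_kernel a w z) = exp ((z \<bullet> w) / a)"
  by (simp add: fock_kernel_def norm_exp_eq_Re Re_hdot)

text \<open>The function |K_w|^2 is e^(|w|^2/a) times the density that belongs to translation by -w,
  whose total mass is 1.\<close>

lemma square_integrable_fock_kernel: "square_integrable a (fock_kernel a w :: complex^'n \<Rightarrow> complex)"
proof -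
  interpret prob_space "gauss_measure a :: (complex^'n) measure" by (rule prob_space_gauss[OF a])
  have [measurable]: "fock_kernel a w \<in> borel_measurable borel"
    by (intro entire_measurable entire_fock_kernel)
  let ?d = "\<lambda>z. ennreal (exp (- (2 * (z \<bullet> (- w)) + (norm (- w))\<^sup>2) / a))"
  have e: "ennreal ((norm (fock_kernel a w z))\<^sup>2) = ennreal (exp ((norm w)\<^sup>2 / a)) * ?d z" for z
  proof -
    have "z \<bullet> w / a + z \<bullet> w / a = (norm w)\<^sup>2 / a + (- (2 * (z \<bullet> (- w)) + (norm (- w))\<^sup>2) / a)"
      using a by (simp add: field_simps)
    then have "(norm (fock_kernel a w z))\<^sup>2 = exp ((norm w)\<^sup>2 / a) * exp (- (2 * (z \<bullet> (- w)) + (norm (- w))\<^sup>2) / a)"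
      by (simp only: norm_fock_kernel power2_eq_square[of "exp _"] mult_exp_exp)
    then show ?thesis by (simp only: ennreal_mult exp_ge_zero)
  qed
  have "emeasure (distr (density (gauss_measure a) ?d) borel (\<lambda>z. z + (- w))) UNIV = 1"
    unfolding gauss_distr_translate[OF a] using emeasure_space_1 by simp
  then have "(\<integral>\<^sup>+z. ?d z \<partial>gauss_measure a) = 1"
    by (simp add: emeasure_distr emeasure_density)
  then have "(\<integral>\<^sup>+z. ennreal ((norm (fock_kernel a w z))\<^sup>2) \<partial>gauss_measure a) = ennreal (exp ((norm w)\<^sup>2 / a))"
    unfolding e by (subst nn_integral_cmult) auto
  then show ?thesis unfolding square_integrable_def by (auto intro!: integrableI_bounded)
qed

lemma fock_kernel_mem: "fock_kernel a w \<in> Fock a"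
  by (simp add: Fock_def entire_fock_kernel square_integrable_fock_kernel)

text \<open>Translating the Gaussian by \<open>w\<close> turns \<open>\<langle>f, K\<^sub>w\<rangle>\<close> into the Gaussian mean of the entire function
  \<open>f(z + w) exp(-\<langle>z, w\<rangle>/a)\<close>, that is, into its value at 0.\<close>

lemma fock_reproducing:
  fixes f :: "complex^'n \<Rightarrow> complex"
  assumes "f \<in> Fock a"
  shows "L2_inner a f (fock_kernel a w) = f w"
proof -
  have f: "entire f" and sf: "square_integrable a f" using assms by (auto simp: Fock_def)
  let ?G = "\<lambda>z. f z * cnj (fock_kernel a w z)"
  let ?F = "\<lambda>z. f (z + w) * exp (- (1 / of_real a) * hdot z w)"
  let ?d = "\<lambda>z. exp (- (2 * (z \<bullet> w) + (norm w)\<^sup>2) / a)"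
  have [measurable]: "f \<in> borel_measurable borel" "fock_kernel a w \<in> borel_measurable borel"
    by (intro entire_measurable f entire_fock_kernel)+
  have F: "entire ?F"
    by (rule entire_mult[OF entire_translate[OF f] entire_exp[OF entire_cmult[OF entire_hdot]]])
  have dG: "?d z *\<^sub>R ?G (z + w) = ?F z" for z
  proof -
    have "2 * complex_of_real (z \<bullet> w) = hdot z w + hdot w z"
      using Re_hdot[of z w] hdot_cnj[of z w] by (simp add: complex_eq_iff)
    then have "complex_of_real (- (2 * (z \<bullet> w) + (norm w)\<^sup>2) / a) + hdot w (z + w) / of_real a = - (1 / of_real a) * hdot z w"
      using a by (simp add: hdot_add_right hdot_self field_simps)
    moreover have "?d z *\<^sub>R ?G (z + w) = f (z + w) *
        exp (complex_of_real (- (2 * (z \<bullet> w) + (norm w)\<^sup>2) / a) + hdot w (z + w) / of_real a)"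
      unfolding fock_kernel_def exp_cnj exp_add exp_of_real scaleR_conv_of_real
      by (simp add: hdot_cnj)
    ultimately show ?thesis by simp
  qed
  have iG: "integrable (gauss_measure a) ?G"
    by (rule integrable_inner_product[OF sf square_integrable_fock_kernel])
  let ?M = "density (gauss_measure a) (\<lambda>z. ennreal (?d z))"
  have "integrable (distr ?M borel (\<lambda>z. z + w)) ?G"
    unfolding gauss_distr_translate[OF a] by (rule iG)
  then have "integrable ?M (\<lambda>z. ?G (z + w))"
    by (subst (asm) integrable_distr_eq) auto
  then have iF: "integrable (gauss_measure a) ?F"
    by (subst (asm) integrable_density) (auto simp only: dG, auto)
  have "L2_inner a f (fock_kernel a w) = (\<integral>z. ?G z \<partial>distr ?M borel (\<lambda>z. z + w))"
    unfolding gauss_distr_translate[OF a] L2_inner_def ..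
  also have "\<dots> = (\<integral>z. ?G (z + w) \<partial>?M)"
    by (rule integral_distr) auto
  also have "\<dots> = (\<integral>z. ?d z *\<^sub>R ?G (z + w) \<partial>gauss_measure a)"
    by (rule integral_density) auto
  also have "\<dots> = (\<integral>z. ?F z \<partial>gauss_measure a)" by (simp only: dG)
  also have "\<dots> = f w" unfolding entire_gauss_mean[OF F iF] by simp
  finally show ?thesis .
qed

lemma square_integrable_const: "square_integrable a (\<lambda>z::complex^'n. c)"
proof -
  interpret prob_space "gauss_measure a :: (complex^'n) measure" by (rule prob_space_gauss[OF a])
  show ?thesis by (simp add: square_integrable_def)
qed

lemma continuous_fock_kernel: "continuous_on UNIV (\<lambda>x. fock_kernel a (fst x) (snd x))"
  unfolding fock_kernel_def using a by (intro continuous_intros) auto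

text \<open>The reproducing property bounds |x_k(z)| by C^2 + e^(|z|^2/a), uniformly in k and
  locally in z, so Montel applies; Fatou keeps the limit square integrable.\<close>

lemma fock_montel:
  fixes x :: "nat \<Rightarrow> complex^'n \<Rightarrow> complex"
  assumes x: "\<And>k. x k \<in> Fock a" and C: "\<And>k. L2_norm a (x k) \<le> C"
  shows "\<exists>y\<in>Fock a. \<exists>r. strict_mono r \<and> (\<forall>z. (\<lambda>k. x (r k) z) \<longlonglongrightarrow> y z)"
proof -
  have ent: "entire (x k)" and sqi: "square_integrable a (x k)" for k using x by (auto simp: Fock_def)
  let ?k = "fock_kernel a :: complex^'n \<Rightarrow> complex^'n \<Rightarrow> complex"
  have bd: "norm (x k z) \<le> C\<^sup>2 + exp ((norm z)\<^sup>2 / a)" for k z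
  proof -
    have "norm (x k z) \<le> (L2_norm a (x k))\<^sup>2 + (L2_norm a (?k z))\<^sup>2"
      using L2_inner_bound[OF sqi square_integrable_fock_kernel] by (simp add: fock_reproducing[OF x])
    moreover have "(L2_norm a (?k z))\<^sup>2 = exp ((norm z)\<^sup>2 / a)"
    proof -
      have "complex_of_real ((L2_norm a (?k z))\<^sup>2) = of_real (exp ((norm z)\<^sup>2 / a))"
        unfolding L2_inner_self[symmetric] fock_reproducing[OF fock_kernel_mem] by (rule fock_kernel_diag)
      then show ?thesis by (simp only: of_real_eq_iff)
    qed
    moreover have "(L2_norm a (x k))\<^sup>2 \<le> C\<^sup>2" using C by (intro power_mono) auto
    ultimately show ?thesis by simp
  qed
  obtain r F where r: "strict_mono r" and F: "\<And>z. (\<lambda>k. x (r k) z) \<longlonglongrightarrow> F z" "entire F"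
  proof (rule entire_montel[OF ent])
    show "\<exists>B. \<forall>k z. norm z \<le> R \<longrightarrow> norm (x k z) \<le> B" for R
    proof (intro exI allI impI)
      fix k and z :: "complex^'n" assume "norm z \<le> R"
      then have "(norm z)\<^sup>2 \<le> R\<^sup>2" by (intro power_mono) auto
      then have "exp ((norm z)\<^sup>2 / a) \<le> exp (R\<^sup>2 / a)" using a by (simp add: divide_right_mono)
      then show "norm (x k z) \<le> C\<^sup>2 + exp (R\<^sup>2 / a)" using bd[of k z] by linarith
    qed
  qed auto
  have "square_integrable a F"
    by (rule L2_norm_fatou(1)[of a "\<lambda>k. x (r k)"]) (use sqi F C in auto)
  then show ?thesis using r F by (intro bexI[of _ F] exI[of _ r]) (auto simp: Fock_def)
qed

lemma rkhs_Fock: "rkhs a (Fock a :: (complex^'n \<Rightarrow> complex) set) (fock_kernel a)"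
proof
  show "a > 0" by (rule a)
  show "f + g \<in> Fock a" if "f \<in> Fock a" "g \<in> Fock a" for f g :: "complex^'n \<Rightarrow> complex"
    using that by (auto simp: Fock_def plus_fun_def entire_add square_integrable_add)
  show "(\<lambda>z. c * f z) \<in> Fock a" if "f \<in> Fock a" for c and f :: "complex^'n \<Rightarrow> complex"
    using that by (auto simp: Fock_def entire_cmult square_integrable_cmult)
  show "(\<lambda>z::complex^'n. 1) \<in> Fock a"
    by (simp add: Fock_def entire_const square_integrable_const)
  show "(\<lambda>(w, z). fock_kernel a w z) \<in> borel_measurable (borel \<Otimes>\<^sub>M borel :: ((complex^'n) \<times> (complex^'n)) measure)"
    unfolding borel_prod case_prod_beta' by (intro borel_measurable_continuous_onI continuous_fock_kernel)
  show "square_integrable a f" if "f \<in> Fock a" for f :: "complex^'n \<Rightarrow> complex"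
    using that by (simp add: Fock_def)
qed (fact fock_kernel_mem fock_reproducing fock_montel)+

text \<open>The orthogonal splitting is an identity in [0, infinity], so it applies before
  \<open>g\<close> and \<open>h\<close> are known to be square integrable and transfers finiteness
  of the norm of \<open>f\<close> to both.\<close>

lemma PH_iff: "f \<in> PH a \<longleftrightarrow> (\<exists>g\<in>Fock a. \<exists>h\<in>Fock a. h 0 = 0 \<and> f = (\<lambda>z. g z + cnj (h z)))"
proof
  assume "f \<in> PH a"
  then have "pluriharmonic f" and sf: "square_integrable a f" by (auto simp: PH_def)
  then obtain g h where g: "entire g" and h: "entire h" "h 0 = 0" and f: "f = (\<lambda>z. g z + cnj (h z))"
    using pluriharmonic_decompose by blast
  note [measurable] = entire_measurable[OF g] entire_measurable[OF h(1)]
  have "(\<integral>\<^sup>+z. ennreal ((norm (f z))\<^sup>2) \<partial>gauss_measure a) < \<infinity>"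
    unfolding ennreal_L2_norm_square[OF sf, symmetric] by simp
  then have "(\<integral>\<^sup>+z. ennreal ((norm (g z))\<^sup>2) \<partial>gauss_measure a) + (\<integral>\<^sup>+z. ennreal ((norm (h z))\<^sup>2) \<partial>gauss_measure a) < \<infinity>"
    unfolding f nn_integral_pluriharmonic_split[OF a g h] .
  then have "square_integrable a g" "square_integrable a h"
    unfolding square_integrable_def by (auto intro!: integrableI_bounded)
  then show "\<exists>g\<in>Fock a. \<exists>h\<in>Fock a. h 0 = 0 \<and> f = (\<lambda>z. g z + cnj (h z))"
    using f g h by (auto simp: Fock_def)
next
  assume "\<exists>g\<in>Fock a. \<exists>h\<in>Fock a. h 0 = 0 \<and> f = (\<lambda>z. g z + cnj (h z))"
  then show "f \<in> PH a"
    by (auto simp: Fock_def PH_def intro!: pluriharmonic_add_cnj square_integrable_add square_integrable_cnj)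
qed

lemma PH_cases:
  assumes "f \<in> PH a"
  obtains g h where "g \<in> Fock a" "h \<in> Fock a" "h 0 = 0" "f = (\<lambda>z. g z + cnj (h z))"
  using assms unfolding PH_iff by blast

lemma PH_I: "g \<in> Fock a \<Longrightarrow> h \<in> Fock a \<Longrightarrow> h 0 = 0 \<Longrightarrow> (\<lambda>z. g z + cnj (h z)) \<in> PH a"
  unfolding PH_iff by blast

lemma PH_norm_split:
  assumes g: "g \<in> Fock a" and h: "h \<in> Fock a" "h 0 = 0"
  shows "(L2_norm a (\<lambda>z. g z + cnj (h z)))\<^sup>2 = (L2_norm a g)\<^sup>2 + (L2_norm a h)\<^sup>2"
proof -
  have s: "square_integrable a g" "square_integrable a h" and e: "entire g" "entire h"
    using g h by (auto simp: Fock_def)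
  have sf: "square_integrable a (\<lambda>z. g z + cnj (h z))"
    by (intro square_integrable_add square_integrable_cnj s)
  have "ennreal ((L2_norm a (\<lambda>z. g z + cnj (h z)))\<^sup>2) = ennreal ((L2_norm a g)\<^sup>2 + (L2_norm a h)\<^sup>2)"
    unfolding ennreal_L2_norm_square[OF sf] nn_integral_pluriharmonic_split[OF a e h(2)]
    by (simp add: ennreal_L2_norm_square[OF s(1)] ennreal_L2_norm_square[OF s(2)])
  then show ?thesis by (subst (asm) ennreal_inj) auto
qed

text \<open>Constants must be counted once. The 1 is subtracted within the conjugated summand so
  that this summand vanishes at 0, as the normal form in \<open>PH_iff\<close> requires.\<close>

definition ph_kernel :: "complex^'n \<Rightarrow> complex^'n \<Rightarrow> complex" where
  "ph_kernel w z = fock_kernel a w z + cnj (fock_kernel a w z - 1)"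

lemma fock_kernel_at_0 [simp]: "fock_kernel a w 0 = 1"
  by (simp add: fock_kernel_def)

lemma Fock_diff_1: "f \<in> Fock a \<Longrightarrow> (\<lambda>z. f z - 1) \<in> Fock a"
  using square_integrable_add[of a f "\<lambda>z. -1"]
  by (auto simp: Fock_def intro!: entire_diff entire_const square_integrable_const)

lemma ph_kernel_mem: "ph_kernel w \<in> PH a"
  unfolding ph_kernel_def[abs_def] by (intro PH_I Fock_diff_1 fock_kernel_mem) simp

text \<open>The kernel is real valued, so the holomorphic and the conjugated part both reduce to the
  integral of u times the kernel with u in the Fock space: u(0) from k, u(w) from its conjugate,
  -u(0) from the constant.\<close>

lemma ph_reproducing:
  fixes f :: "complex^'n \<Rightarrow> complex"
  assumes "f \<in> PH a"
  shows "L2_inner a f (ph_kernel w) = f w"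
proof -
  obtain g h where g: "g \<in> Fock a" and h: "h \<in> Fock a" "h 0 = 0" and f: "f = (\<lambda>z. g z + cnj (h z))"
    using assms by (rule PH_cases)
  let ?k = "fock_kernel a w"
  let ?I = "\<lambda>F. \<integral>z. F z \<partial>gauss_measure a"
  have s: "square_integrable a g" "square_integrable a h" and e: "entire g" "entire h"
    using g h by (auto simp: Fock_def)
  note sk = square_integrable_fock_kernel[of w]
  have i: "integrable (gauss_measure a) (\<lambda>z. u z * ?k z)" "integrable (gauss_measure a) (\<lambda>z. u z * cnj (?k z))"
     "integrable (gauss_measure a) u"
    if "square_integrable a u" for u
    using integrable_inner_product[OF that square_integrable_cnj[OF sk]] integrable_inner_product[OF that sk]
      integrable_inner_product[OF that square_integrable_const[of 1]] by auto
  have mean: "?I (\<lambda>z. u z * ?k z) = u 0" "?I u = u 0" "?I (\<lambda>z. u z * cnj (?k z)) = u w" if u: "u \<in> Fock a" for u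
  proof -
    have su: "square_integrable a u" "entire u" using u by (auto simp: Fock_def)
    show "?I (\<lambda>z. u z * ?k z) = u 0"
      using entire_gauss_mean[OF entire_mult[OF su(2) entire_fock_kernel] i(1)[OF su(1)]] by simp
    show "?I u = u 0" by (rule entire_gauss_mean[OF su(2) i(3)[OF su(1)]])
    show "?I (\<lambda>z. u z * cnj (?k z)) = u w"
      using fock_reproducing[OF u, of w] by (simp add: L2_inner_def)
  qed
  have c: "?I (\<lambda>z. cnj (F z)) = cnj (?I F)" for F
    by (rule Bochner_Integration.integral_cnj)
  let ?P = "\<lambda>u z. u z * ?k z + u z * cnj (?k z) - u z"
  have P: "integrable (gauss_measure a) (?P u)" "?I (?P u) = u w" if "u \<in> Fock a" for u
  proof -
    have su: "square_integrable a u" using that by (auto simp: Fock_def)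
    show "integrable (gauss_measure a) (?P u)" using i[OF su] by auto
    show "?I (?P u) = u w"
      using i[OF su] mean[OF that] by simp
  qed
  have "L2_inner a f (ph_kernel w) = ?I (\<lambda>z. ?P g z + cnj (?P h z))"
    unfolding L2_inner_def f ph_kernel_def by (intro Bochner_Integration.integral_cong) (auto simp: algebra_simps)
  also have "\<dots> = ?I (?P g) + ?I (\<lambda>z. cnj (?P h z))"
    by (intro Bochner_Integration.integral_add P g integrable_cnj h)
  also have "\<dots> = f w" unfolding c P(2)[OF g] P(2)[OF h(1)] f ..
  finally show ?thesis .
qed

text \<open>The Pythagorean identity bounds the holomorphic and antiholomorphic parts separately;
  two successive extractions are composed, and the normalisation at 0 survives the pointwise
  limit.\<close>

lemma ph_montel:
  fixes x :: "nat \<Rightarrow> complex^'n \<Rightarrow> complex"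
  assumes x: "\<And>k. x k \<in> PH a" and C: "\<And>k. L2_norm a (x k) \<le> C"
  shows "\<exists>y\<in>PH a. \<exists>r. strict_mono r \<and> (\<forall>z. (\<lambda>k. x (r k) z) \<longlonglongrightarrow> y z)"
proof -
  have "\<forall>k. \<exists>p. fst p \<in> Fock a \<and> snd p \<in> Fock a \<and> snd p 0 = 0 \<and> x k = (\<lambda>z. fst p z + cnj (snd p z))"
  proof
    fix k
    obtain g h where "g \<in> Fock a" "h \<in> Fock a" "h 0 = 0" "x k = (\<lambda>z. g z + cnj (h z))"
      using x[of k] by (rule PH_cases)
    then show "\<exists>p. fst p \<in> Fock a \<and> snd p \<in> Fock a \<and> snd p 0 = 0 \<and> x k = (\<lambda>z. fst p z + cnj (snd p z))"
      by (intro exI[of _ "(g, h)"]) simp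
  qed
  from choice[OF this] obtain p where p: "\<And>k. fst (p k) \<in> Fock a \<and> snd (p k) \<in> Fock a \<and> snd (p k) 0 = 0 \<and>
    x k = (\<lambda>z. fst (p k) z + cnj (snd (p k) z))" by blast
  define g h where "g k = fst (p k)" and "h k = snd (p k)" for k
  have g: "g k \<in> Fock a" and h: "h k \<in> Fock a" "h k 0 = 0" and eq: "x k = (\<lambda>z. g k z + cnj (h k z))" for k
    using p[of k] by (simp_all only: g_def h_def)
  have n: "(L2_norm a (g k))\<^sup>2 + (L2_norm a (h k))\<^sup>2 = (L2_norm a (x k))\<^sup>2" for k
    unfolding eq by (rule PH_norm_split[OF g h, symmetric])
  have gC: "L2_norm a (g k) \<le> C" and hC: "L2_norm a (h k) \<le> C" for k
  proof -
    have "(L2_norm a (g k))\<^sup>2 \<le> (L2_norm a (x k))\<^sup>2" "(L2_norm a (h k))\<^sup>2 \<le> (L2_norm a (x k))\<^sup>2"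
      using n[of k] zero_le_power2[of "L2_norm a (g k)"] zero_le_power2[of "L2_norm a (h k)"] by linarith+
    then have "L2_norm a (g k) \<le> L2_norm a (x k)" "L2_norm a (h k) \<le> L2_norm a (x k)"
      by (auto intro: power2_le_imp_le)
    then show "L2_norm a (g k) \<le> C" "L2_norm a (h k) \<le> C" using C[of k] by linarith+
  qed
  have "\<exists>y\<in>Fock a. \<exists>r. strict_mono r \<and> (\<forall>z. (\<lambda>k. g (r k) z) \<longlonglongrightarrow> y z)"
    by (rule fock_montel[OF g gC])
  then obtain G and r :: "nat \<Rightarrow> nat" where G: "G \<in> Fock a" and r: "strict_mono r" and Glim: "\<And>z. (\<lambda>k. g (r k) z) \<longlonglongrightarrow> G z"
    by blast
  have "\<exists>y\<in>Fock a. \<exists>q. strict_mono q \<and> (\<forall>z. (\<lambda>k. h (r (q k)) z) \<longlonglongrightarrow> y z)"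
    by (rule fock_montel[of "\<lambda>k. h (r k)", OF h(1) hC])
  then obtain F and q :: "nat \<Rightarrow> nat" where F: "F \<in> Fock a" and q: "strict_mono q" and Flim: "\<And>z. (\<lambda>k. h (r (q k)) z) \<longlonglongrightarrow> F z"
    by blast
  have "F 0 = 0" using Flim[of 0] by (simp add: h(2) LIMSEQ_const_iff)
  have "(\<lambda>k. x (r (q k)) z) \<longlonglongrightarrow> G z + cnj (F z)" for z
    unfolding eq using LIMSEQ_subseq_LIMSEQ[OF Glim[of z] q]
    by (intro tendsto_intros Flim) (simp add: o_def)
  moreover have "strict_mono (\<lambda>k. r (q k))" using strict_mono_o[OF r q] by (simp add: o_def)
  ultimately show ?thesis
    using PH_I[OF G F \<open>F 0 = 0\<close>] by (intro bexI[of _ "\<lambda>z. G z + cnj (F z)"] exI[of _ "\<lambda>k. r (q k)"]) auto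
qed

lemma rkhs_PH: "rkhs a (PH a :: (complex^'n \<Rightarrow> complex) set) ph_kernel"
proof
  interpret F: rkhs a "Fock a :: (complex^'n \<Rightarrow> complex) set" "fock_kernel a" by (rule rkhs_Fock)
  show "a > 0" by (rule a)
  show "f + f' \<in> PH a" if fP: "f \<in> PH a" "f' \<in> PH a" for f f' :: "complex^'n \<Rightarrow> complex"
  proof -
    obtain g h where g: "g \<in> Fock a" and h: "h \<in> Fock a" "h 0 = 0" and f: "f = (\<lambda>z. g z + cnj (h z))"
      using fP(1) by (rule PH_cases)
    obtain g' h' where g': "g' \<in> Fock a" and h': "h' \<in> Fock a" "h' 0 = 0" and f': "f' = (\<lambda>z. g' z + cnj (h' z))"
      using fP(2) by (rule PH_cases)
    have "f + f' = (\<lambda>z. (g + g') z + cnj ((h + h') z))" unfolding f f' by (auto simp: fun_eq_iff)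
    then show ?thesis using PH_I[OF F.H_add[OF g g'] F.H_add[OF h(1) h'(1)]] h h' by simp
  qed
  show "(\<lambda>z. c * f z) \<in> PH a" if fP: "f \<in> PH a" for c and f :: "complex^'n \<Rightarrow> complex"
  proof -
    obtain g h where g: "g \<in> Fock a" and h: "h \<in> Fock a" "h 0 = 0" and f: "f = (\<lambda>z. g z + cnj (h z))"
      using fP(1) by (rule PH_cases)
    have "(\<lambda>z. c * f z) = (\<lambda>z. (c * g z) + cnj (cnj c * h z))" unfolding f by (auto simp: fun_eq_iff algebra_simps)
    then show ?thesis using PH_I[OF F.H_sc[OF g, of c] F.H_sc[OF h(1), of "cnj c"]] h by simp
  qed
  show "(\<lambda>z::complex^'n. 1) \<in> PH a"
    using PH_I[OF F.one F.H_sc[OF F.one, of 0]] by simp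
  show "(\<lambda>(w, z). ph_kernel w z) \<in> borel_measurable (borel \<Otimes>\<^sub>M borel :: ((complex^'n) \<times> (complex^'n)) measure)"
    unfolding borel_prod case_prod_beta' ph_kernel_def
    by (intro borel_measurable_continuous_onI continuous_intros continuous_fock_kernel)
  show "square_integrable a f" if "f \<in> PH a" for f :: "complex^'n \<Rightarrow> complex"
    using that by (simp add: PH_def)
qed (fact ph_kernel_mem ph_reproducing ph_montel)+

lemma Re_fock_kernel_weighted: "Re (fock_kernel a w w) * exp (- (norm w)\<^sup>2 / a) = 1"
  by (simp add: fock_kernel_diag exp_add[symmetric])

lemma Re_ph_kernel_weighted: "Re (ph_kernel w w) * exp (- (norm w)\<^sup>2 / a) = 2 - exp (- (norm w)\<^sup>2 / a)"
proof -
  have "Re (ph_kernel w w) = 2 * Re (fock_kernel a w w) - 1" by (simp add: ph_kernel_def)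
  moreover have "(2 * k - 1) * e = 2 * (k * e) - e" for k e :: real by (simp add: algebra_simps)
  ultimately show ?thesis by (simp only: Re_fock_kernel_weighted mult_1_right)
qed

end

subsection \<open>Finite measures, trace norms and their ratio\<close>

context
  fixes a :: real and \<mu> :: "(complex^'n) measure"
  assumes a: "a > 0" and sets_mu: "sets \<mu> = sets borel"
begin

lemma gauss_weight_le_1: "exp (- (norm (z::complex^'n))\<^sup>2 / a) \<le> 1"
  using a by simp

lemma integrable_gauss_weight:
  assumes fin: "emeasure \<mu> UNIV < \<infinity>"
  shows "integrable \<mu> (\<lambda>z. exp (- (norm z)\<^sup>2 / a))"
proof -
  interpret finite_measure \<mu>
    by standard (use fin sets_eq_imp_space_eq[OF sets_mu] in simp)
  have [measurable_cong]: "sets \<mu> = sets borel" by (rule sets_mu)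
  show ?thesis
    by (rule integrable_const_bound[where B = 1, OF always_eventually]) (use a in auto)
qed

lemma toeplitz_Fock:
  shows "emeasure \<mu> UNIV < \<infinity> \<longleftrightarrow> q_bounded a \<mu> (Fock a) \<and> trace_class a (Fock a) (toeplitz a \<mu> (Fock a))"
    and "emeasure \<mu> UNIV < \<infinity> \<Longrightarrow> trace_norm a (Fock a) (toeplitz a \<mu> (Fock a)) = measure \<mu> UNIV"
proof -
  interpret F: rkhs a "Fock a :: (complex^'n \<Rightarrow> complex) set" "fock_kernel a" by (rule rkhs_Fock[OF a])
  \<comment> \<open>For the Fock kernel the weighted diagonal is constantly 1, so both bounds hold
    with equality and the trace integral is the total mass.\<close>
  note r = F.finite_iff_trace_class[OF sets_mu, where A = 1, unfolded Re_fock_kernel_weighted[OF a], OF order.refl order.refl]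
  show "emeasure \<mu> UNIV < \<infinity> \<longleftrightarrow> q_bounded a \<mu> (Fock a) \<and> trace_class a (Fock a) (toeplitz a \<mu> (Fock a))"
    by (rule r(1))
  show "trace_norm a (Fock a) (toeplitz a \<mu> (Fock a)) = measure \<mu> UNIV" if "emeasure \<mu> UNIV < \<infinity>"
    using r(2)[OF that] sets_eq_imp_space_eq[OF sets_mu] by simp
qed

lemma toeplitz_PH:
  shows "emeasure \<mu> UNIV < \<infinity> \<longleftrightarrow> q_bounded a \<mu> (PH a) \<and> trace_class a (PH a) (toeplitz a \<mu> (PH a))"
    and "emeasure \<mu> UNIV < \<infinity> \<Longrightarrow> trace_norm a (PH a) (toeplitz a \<mu> (PH a)) =
      2 * measure \<mu> UNIV - (\<integral>z. exp (- (norm z)\<^sup>2 / a) \<partial>\<mu>)"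
proof -
  interpret P: rkhs a "PH a :: (complex^'n \<Rightarrow> complex) set" "ph_kernel a" by (rule rkhs_PH[OF a])
  have b: "2 - exp (- (norm w)\<^sup>2 / a) \<le> 2" "1 \<le> 2 - exp (- (norm w)\<^sup>2 / a)" for w :: "complex^'n"
    using gauss_weight_le_1[of w] by auto
  note r = P.finite_iff_trace_class[OF sets_mu, where A = 2, unfolded Re_ph_kernel_weighted[OF a], OF b]
  show "emeasure \<mu> UNIV < \<infinity> \<longleftrightarrow> q_bounded a \<mu> (PH a) \<and> trace_class a (PH a) (toeplitz a \<mu> (PH a))"
    by (rule r(1))
  assume fin: "emeasure \<mu> UNIV < \<infinity>"
  have sp: "space \<mu> = UNIV" using sets_eq_imp_space_eq[OF sets_mu] by simp
  interpret finite_measure \<mu> by standard (use fin sp in simp)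
  have "(\<integral>z. 2 - exp (- (norm z)\<^sup>2 / a) \<partial>\<mu>) = (\<integral>z. 2 \<partial>\<mu>) - (\<integral>z. exp (- (norm z)\<^sup>2 / a) \<partial>\<mu>)"
    by (rule Bochner_Integration.integral_diff) (use integrable_gauss_weight[OF fin] in auto)
  then show "trace_norm a (PH a) (toeplitz a \<mu> (PH a)) = 2 * measure \<mu> UNIV - (\<integral>z. exp (- (norm z)\<^sup>2 / a) \<partial>\<mu>)"
    using r(2)[OF fin] by (simp add: sp)
qed

context
  assumes fin: "emeasure \<mu> UNIV < \<infinity>" and nz: "emeasure \<mu> UNIV \<noteq> 0"
begin

lemma measure_UNIV_pos: "measure \<mu> UNIV > 0"
  using fin nz by (simp add: measure_def enn2real_positive_iff zero_less_iff_neq_zero)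

lemma norm_ratio_eq: "norm_ratio a \<mu> = 2 - 1 / measure \<mu> UNIV * (\<integral>z. exp (- (norm z)\<^sup>2 / a) \<partial>\<mu>)"
  unfolding norm_ratio_def toeplitz_Fock(2)[OF fin] toeplitz_PH(2)[OF fin]
  using measure_UNIV_pos by (simp add: diff_divide_distrib)

text \<open>A strictly positive weight cannot have zero integral against a nonzero measure; this
  keeps the ratio strictly below 2.\<close>

lemma integral_gauss_weight_pos: "(\<integral>z. exp (- (norm z)\<^sup>2 / a) \<partial>\<mu>) > 0"
proof (rule ccontr)
  assume "\<not> ?thesis"
  moreover have "(\<integral>z. exp (- (norm z)\<^sup>2 / a) \<partial>\<mu>) \<ge> 0" by simp
  ultimately have "(\<integral>z. exp (- (norm z)\<^sup>2 / a) \<partial>\<mu>) = 0" by linarith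
  then have "AE z in \<mu>. exp (- (norm z)\<^sup>2 / a) = 0"
    by (subst (asm) integral_nonneg_eq_0_iff_AE[OF integrable_gauss_weight[OF fin]]) auto
  then have "AE z in \<mu>. False" by simp
  then have "emeasure \<mu> (space \<mu>) = 0" by (simp add: AE_iff_measurable[OF sets.top])
  then show False using nz sets_eq_imp_space_eq[OF sets_mu] by simp
qed

lemma integral_one_minus_gauss_weight:
  "(\<integral>z. 1 - exp (- (norm z)\<^sup>2 / a) \<partial>\<mu>) = measure \<mu> UNIV - (\<integral>z. exp (- (norm z)\<^sup>2 / a) \<partial>\<mu>)"
proof -
  have sp: "space \<mu> = UNIV" using sets_eq_imp_space_eq[OF sets_mu] by simp
  interpret finite_measure \<mu> by standard (use fin sp in simp)
  have "(\<integral>z. 1 - exp (- (norm z)\<^sup>2 / a) \<partial>\<mu>) = (\<integral>z. 1 \<partial>\<mu>) - (\<integral>z. exp (- (norm z)\<^sup>2 / a) \<partial>\<mu>)"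
    by (rule Bochner_Integration.integral_diff) (use integrable_gauss_weight[OF fin] in auto)
  then show ?thesis by (simp add: sp)
qed

lemma norm_ratio_range: "1 \<le> norm_ratio a \<mu>" "norm_ratio a \<mu> < 2"
proof -
  have "0 \<le> (\<integral>z. 1 - exp (- (norm z)\<^sup>2 / a) \<partial>\<mu>)"
    by (rule Bochner_Integration.integral_nonneg) (use a in simp)
  then show "1 \<le> norm_ratio a \<mu>"
    unfolding norm_ratio_eq integral_one_minus_gauss_weight using measure_UNIV_pos by (simp add: field_simps)
  show "norm_ratio a \<mu> < 2"
    unfolding norm_ratio_eq using measure_UNIV_pos integral_gauss_weight_pos by simp
qed

text \<open>The ratio exceeds 1 by the mean of 1 - e^(-|z|^2/a), a nonnegative function whose only
  zero is the origin.\<close>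

lemma norm_ratio_eq_1_iff: "norm_ratio a \<mu> = 1 \<longleftrightarrow> emeasure \<mu> (UNIV - {0}) = 0"
proof -
  have sp: "space \<mu> = UNIV" using sets_eq_imp_space_eq[OF sets_mu] by simp
  interpret finite_measure \<mu> by standard (use fin sp in simp)
  have int: "integrable \<mu> (\<lambda>z. 1 - exp (- (norm z)\<^sup>2 / a))"
    using integrable_gauss_weight[OF fin] by auto
  have "norm_ratio a \<mu> = 1 \<longleftrightarrow> (\<integral>z. 1 - exp (- (norm z)\<^sup>2 / a) \<partial>\<mu>) = 0"
    unfolding norm_ratio_eq integral_one_minus_gauss_weight using measure_UNIV_pos by (auto simp: field_simps)
  also have "\<dots> \<longleftrightarrow> (AE z in \<mu>. 1 - exp (- (norm z)\<^sup>2 / a) = 0)"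
    by (rule integral_nonneg_eq_0_iff_AE[OF int]) (use a in simp)
  also have "\<dots> \<longleftrightarrow> (AE z in \<mu>. z = 0)"
    using a by simp
  also have "\<dots> \<longleftrightarrow> emeasure \<mu> (UNIV - {0}) = 0"
    by (rule AE_iff_measurable) (auto simp: sets_mu sp)
  finally show ?thesis .
qed

end

end

text \<open>The Dirac measure at \<open>w\<close>, realised as a push-forward from a one-point
  space; these measures attain every admissible ratio.\<close>

lemma point_mass:
  fixes w :: "complex^'n"
  defines "\<mu> \<equiv> distr (count_space {()}) borel (\<lambda>_. w)"
  shows "nonzero_finite_borel \<mu>" "measure \<mu> UNIV = 1"
    "(\<integral>z. exp (- (norm z)\<^sup>2 / a) \<partial>\<mu>) = exp (- (norm w)\<^sup>2 / a)"
proof -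
  have e: "emeasure \<mu> UNIV = 1" unfolding \<mu>_def by (subst emeasure_distr) auto
  then show "nonzero_finite_borel \<mu>" "measure \<mu> UNIV = 1"
    by (simp_all add: nonzero_finite_borel_def measure_def) (simp add: \<mu>_def)
  show "(\<integral>z. exp (- (norm z)\<^sup>2 / a) \<partial>\<mu>) = exp (- (norm w)\<^sup>2 / a)"
    unfolding \<mu>_def by (subst integral_distr) (auto simp: lebesgue_integral_count_space_finite)
qed

theorem proposition6p1:
  fixes \<alpha> :: real
  assumes "\<alpha> > 0"
  shows "(\<forall>\<mu> :: (complex^'n) measure. sets \<mu> = sets borel \<longrightarrow>
            (emeasure \<mu> UNIV < \<infinity> \<longleftrightarrow>
               q_bounded \<alpha> \<mu> (Fock \<alpha>) \<and> trace_class \<alpha> (Fock \<alpha>) (toeplitz \<alpha> \<mu> (Fock \<alpha>))) \<and>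
            (emeasure \<mu> UNIV < \<infinity> \<longleftrightarrow>
               q_bounded \<alpha> \<mu> (PH \<alpha>) \<and> trace_class \<alpha> (PH \<alpha>) (toeplitz \<alpha> \<mu> (PH \<alpha>))) \<and>
            (emeasure \<mu> UNIV < \<infinity> \<longrightarrow>
               trace_norm \<alpha> (Fock \<alpha>) (toeplitz \<alpha> \<mu> (Fock \<alpha>)) = measure \<mu> UNIV \<and>
               trace_norm \<alpha> (PH \<alpha>) (toeplitz \<alpha> \<mu> (PH \<alpha>)) =
                 2 * measure \<mu> UNIV - (\<integral>z. exp (- (norm z)\<^sup>2 / \<alpha>) \<partial>\<mu>)) \<and>
            (emeasure \<mu> UNIV < \<infinity> \<and> emeasure \<mu> UNIV \<noteq> 0 \<longrightarrow>
               norm_ratio \<alpha> \<mu> =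
                 2 - 1 / measure \<mu> UNIV * (\<integral>z. exp (- (norm z)\<^sup>2 / \<alpha>) \<partial>\<mu>))) \<and>
         {norm_ratio \<alpha> \<mu> | \<mu> :: (complex^'n) measure. nonzero_finite_borel \<mu>} = {1..<2} \<and>
         (\<forall>\<mu> :: (complex^'n) measure. nonzero_finite_borel \<mu> \<longrightarrow>
            (norm_ratio \<alpha> \<mu> = 1 \<longleftrightarrow> emeasure \<mu> (UNIV - {0}) = 0))"
proof (intro conjI allI impI)
  show "{norm_ratio \<alpha> \<mu> | \<mu> :: (complex^'n) measure. nonzero_finite_borel \<mu>} = {1..<2}"
  proof (intro equalityI subsetI)
    fix x assume "x \<in> {norm_ratio \<alpha> \<mu> | \<mu> :: (complex^'n) measure. nonzero_finite_borel \<mu>}"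
    then obtain \<mu> :: "(complex^'n) measure" where x: "x = norm_ratio \<alpha> \<mu>" and "nonzero_finite_borel \<mu>" by blast
    then have "sets \<mu> = sets borel" "emeasure \<mu> UNIV < \<infinity>" "emeasure \<mu> UNIV \<noteq> 0"
      by (auto simp: nonzero_finite_borel_def)
    from norm_ratio_range[OF assms this] show "x \<in> {1..<2}" by (simp add: x)
  next
    fix x :: real assume x: "x \<in> {1..<2}"
    then have l: "- \<alpha> * ln (2 - x) \<ge> 0" using assms by (simp add: mult_nonneg_nonpos)
    \<comment> \<open>Solves 2 - e^(-|w|^2/\<alpha>) = x for |w|; the logarithm is nonpositive
      because 0 < 2 - x \<le> 1.\<close>
    obtain w :: "complex^'n" where w: "norm w = sqrt (- \<alpha> * ln (2 - x))"
      using vector_choose_size[of "sqrt (- \<alpha> * ln (2 - x))"] l by auto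
    have "- (norm w)\<^sup>2 / \<alpha> = ln (2 - x)" unfolding w using l assms by simp
    then have e: "exp (- (norm w)\<^sup>2 / \<alpha>) = 2 - x" using x by simp
    let ?\<mu> = "distr (count_space {()}) borel (\<lambda>_. w)"
    have "sets ?\<mu> = sets borel" "emeasure ?\<mu> UNIV < \<infinity>" "emeasure ?\<mu> UNIV \<noteq> 0"
      using point_mass(1)[of w] by (auto simp: nonzero_finite_borel_def)
    from norm_ratio_eq[OF assms this] have "norm_ratio \<alpha> ?\<mu> = x"
      unfolding point_mass(2,3) e by simp
    then show "x \<in> {norm_ratio \<alpha> \<mu> | \<mu> :: (complex^'n) measure. nonzero_finite_borel \<mu>}"
      using point_mass(1)[of w] by blast
  qed
next
  fix \<mu> :: "(complex^'n) measure" assume "nonzero_finite_borel \<mu>"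
  then have "sets \<mu> = sets borel" "emeasure \<mu> UNIV < \<infinity>" "emeasure \<mu> UNIV \<noteq> 0"
    by (auto simp: nonzero_finite_borel_def)
  then show "norm_ratio \<alpha> \<mu> = 1 \<longleftrightarrow> emeasure \<mu> (UNIV - {0}) = 0"
    by (rule norm_ratio_eq_1_iff[OF assms])
\<comment> \<open>What remains are the two equivalences, the two norm formulas and the ratio
  formula; only the last has a conjunction to split among its assumptions.\<close>
qed ((elim conjE)?, rule toeplitz_Fock[OF assms] toeplitz_PH[OF assms] norm_ratio_eq[OF assms]; assumption)+

end
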